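(* Let $a,b,c,q\ge1$ and $d,e\ge0$ be integers with $c>d$. Let $\{x_i\}_{i=1}^\infty$ be a strictly increasing infinite sequence of positive integers which contains the arithmetic progression $\{a+bi\}_{i=e}^\infty$ as a subsequence. Let $f\in\mathcal{C}$ be multiplicative and increasing on $\{p_i(b)\}_{i=1}^\infty$. Let $\lambda_n^{(1)}\le\dots\le\lambda_n^{(n)}$ be the eigenvalues of the $n\times n$ matrix $\big((f^{(c)}*\mu^{(d)})(\gcd(x_i,x_j))\big)_{1\le i,j\le n}$. Then: (i) if $(f^{(c)}*\mu^{(d)})(p_i(b))=0$ for some $i\ge1$, then $\lambda_n^{(q)}=0$ for all sufficiently large $n$; (ii) if $(f^{(c)}*\mu^{(d)})(p_i(b))\ne0$ for all $i\ge1$ and $\sum_{i=1}^\infty\frac1{f(p_i(b))}=\infty$, then $\lim_{n\to\infty}\lambda_n^{(q)}=0$; (iii) in particular, if $f(p_i(b))\le Cp_i(b)$ for all $i\ge1$ for some constant $C>0$, then $\lim_{n\to\infty}\lambda_n^{(q)}=0$.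
   Context: An arithmetical function is a complex-valued function on the positive integers; $*$ denotes Dirichlet convolution $(f*g)(m)=\sum_{e\mid m}f(e)g(m/e)$, and $\mu$ is the Möbius function. For an arithmetical function $f$, $f^{(0)}=\delta$ (where $\delta(1)=1$, $\delta(m)=0$ for $m>1$) and $f^{(c)}=f^{(c-1)}*f$ for $c\ge1$. For the sequence $\{x_i\}$, $\mathcal{C}$ is the class of arithmetical functions $f$ such that $(f*\mu)(d')\ge0$ (in particular is real) whenever $d'\mid x_i$ for some $i\ge1$. A function $f$ is multiplicative if $f(mn)=f(m)f(n)$ whenever $\gcd(m,n)=1$. $p_1(b)<p_2(b)<\cdots$ denote the primes in the arithmetic progression $\{1+bi\}_{i=0}^\infty$ in increasing order. $f$ is increasing on a sequence $\{y_i\}$ means $f(y_i)\le f(y_j)$ whenever $i<j$. *)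

theory Defs
  imports
    Complex_Main
    "HOL-Library.Infinite_Set"
    "HOL-Library.Complex_Order"
    "HOL-Computational_Algebra.Squarefree"
    "Jordan_Normal_Form.Char_Poly"
begin

text \<open>
  Arithmetical functions are functions of type \<open>nat \<Rightarrow> complex\<close>; their value at \<open>0\<close> is irrelevant.
  The order on complex numbers is that of \<open>Complex_Order\<close>: \<open>z \<le> w\<close> means
  \<open>Re z \<le> Re w \<and> Im z = Im w\<close>, so in particular \<open>0 \<le> z\<close> says that \<open>z\<close> is real and nonnegative.
\<close>

definition dirichlet_conv :: "(nat \<Rightarrow> complex) \<Rightarrow> (nat \<Rightarrow> complex) \<Rightarrow> nat \<Rightarrow> complex" where
  "dirichlet_conv f g m = (\<Sum>e | e dvd m. f e * g (m div e))"

definition dirichlet_delta :: "nat \<Rightarrow> complex" where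
  "dirichlet_delta m = (if m = 1 then 1 else 0)"

primrec dirichlet_power :: "(nat \<Rightarrow> complex) \<Rightarrow> nat \<Rightarrow> nat \<Rightarrow> complex" where
  "dirichlet_power f 0 = dirichlet_delta"
| "dirichlet_power f (Suc c) = dirichlet_conv (dirichlet_power f c) f"

definition moebius :: "nat \<Rightarrow> complex" where
  "moebius m = (if squarefree m then (- 1) ^ card (prime_factors m) else 0)"

text \<open>Sequences of positive integers are indexed from \<open>1\<close>; the value at index \<open>0\<close> is ignored.\<close>

definition class_C :: "(nat \<Rightarrow> nat) \<Rightarrow> (nat \<Rightarrow> complex) set" where
  "class_C x = {f. \<forall>i \<ge> 1. \<forall>d'. d' dvd x i \<longrightarrow> 0 \<le> dirichlet_conv f moebius d'}"

text \<open>The zero function is not excluded.\<close>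

definition multiplicative :: "(nat \<Rightarrow> complex) \<Rightarrow> bool" where
  "multiplicative f \<longleftrightarrow> (\<forall>m n. 0 < m \<longrightarrow> 0 < n \<longrightarrow> gcd m n = 1 \<longrightarrow> f (m * n) = f m * f n)"

text \<open>
  \<open>prime_ap b i\<close> is the \<open>i\<close>-th prime, counted from \<open>i = 1\<close>, in the progression
  \<open>1, 1 + b, 1 + 2b, \<dots>\<close>. For \<open>b \<ge> 1\<close> there are infinitely many such primes, so
  \<open>enumerate\<close> lists them in increasing order.
\<close>

definition prime_ap :: "nat \<Rightarrow> nat \<Rightarrow> nat" where
  "prime_ap b i = enumerate {p. prime p \<and> (\<exists>k. p = 1 + b * k)} (i - 1)"

definition increasing_on_seq :: "(nat \<Rightarrow> complex) \<Rightarrow> (nat \<Rightarrow> nat) \<Rightarrow> bool" where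
  "increasing_on_seq f y \<longleftrightarrow> (\<forall>i j. 1 \<le> i \<longrightarrow> i < j \<longrightarrow> f (y i) \<le> f (y j))"

text \<open>Matrix entries are indexed from \<open>0\<close>, hence the shift.\<close>

definition gcd_matrix :: "(nat \<Rightarrow> complex) \<Rightarrow> (nat \<Rightarrow> nat) \<Rightarrow> nat \<Rightarrow> complex mat" where
  "gcd_matrix h x n = mat n n (\<lambda>(i, j). h (gcd (x (Suc i)) (x (Suc j))))"

text \<open>
  \<open>l 1 \<le> \<dots> \<le> l n\<close> are the eigenvalues of the \<open>n \<times> n\<close> matrix \<open>A\<close>, all real, listed with
  algebraic multiplicity.
\<close>

definition ordered_eigenvalues :: "complex mat \<Rightarrow> (nat \<Rightarrow> real) \<Rightarrow> bool" where
  "ordered_eigenvalues A l \<longleftrightarrow>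
     mono_on {1..dim_row A} l \<and>
     char_poly A = (\<Prod>k = 1..dim_row A. [:- complex_of_real (l k), 1:])"

end

theory Submission
  imports
    "HOL-Complex_Analysis.Complex_Analysis"
    "HOL-Number_Theory.Number_Theory"
    "Jordan_Normal_Form.Schur_Decomposition"
    Defs
begin

hide_const (open) Complex_Transcendental.moebius

text \<open>
  Unless \<open>f\<close> vanishes, \<open>f 1 = 1\<close>, and the class condition gives \<open>f p \<ge> 1\<close> for primes
  \<open>p \<equiv> 1 (mod b)\<close>, so \<open>h p = c f p - d \<ge> 1\<close>; the case \<open>h p = 0\<close> only occurs for \<open>f = 0\<close>.
  The quadratic form of the gcd matrix is \<open>\<Sum>\<^sub>t g t \<bar>\<Sum>\<^bsub>t | x i\<^esub> v i\<bar>\<^sup>2\<close> with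
  \<open>g = h * \<mu> \<ge> 0\<close> on divisors, so the matrix is positive semidefinite. For a finite set \<open>S\<close> of primes
  \<open>p \<equiv> 1 (mod b)\<close> and a suitable fixed multiple \<open>y\<close> of \<open>a\<close>, all numbers \<open>y \<Prod>A\<close> with \<open>A \<subseteq> S\<close> occur
  in the sequence, and weighting them by \<open>\<Prod>\<^bsub>p \<in> A\<^esub> (- 1 / h p)\<close> gives the form the value
  \<open>h y \<Prod>\<^bsub>p \<in> S\<^esub> (1 - 1 / h p)\<close>, which tends to \<open>0\<close> when \<open>\<Sum> 1 / f p\<close> diverges.
  With \<open>q\<close> disjointly supported vectors of this kind the Courant--Fischer principle bounds the \<open>q\<close>-th eigenvalue.

  Part (iii) needs that \<open>\<Sum> 1 / p\<close> over primes \<open>p \<equiv> 1 (mod b)\<close> diverges. Otherwise the product \<open>F\<close> of all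
  \<open>L\<close>-series modulo \<open>b\<close> is bounded near \<open>1\<close> and extends holomorphically to the disc of radius \<open>2\<close> about \<open>2\<close>.
  The derivatives at \<open>2\<close> of \<open>F\<close>, with finitely many Euler factors removed, alternate in sign, so Taylor expansion
  bounds \<open>F s\<close> from below by a principal \<open>L\<close>-series at \<open>N s\<close>, where \<open>N\<close> is the number of characters;
  this is absurd for \<open>s \<rightarrow> 1 / N\<close>.
\<close>

section \<open>Dirichlet convolution\<close>

text \<open>The weights \<open>- 1 / h p\<close> are optimal: at one prime the form on vectors (1,
  s) is 1 + 2 s + s^2 h p, with least value 1 - 1 / h p at s = - 1 / h p, and coprimality turns the
  form over subsets of \<open>S\<close> into a product of such local forms. Divergence over the
  primes in the progression does not go through the nonvanishing of single values L(1, psi); only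
  the product of all L-series is examined. If the sum converged, boundedness near 1 would cancel the
  only pole, that of the principal factor, and the product would be holomorphic on the largest disc
  about 2 inside Re s > 0. The number N enters through the reciprocal local factors: at p coprime to
  b the product over all characters is (1 - p^(-f s))^r with f r = N, which is at most 1 - p^(-N s)
  for real s > 0. So at each prime the product dominates the principal L-series at N s, whose
  divergence at s = 1/N falls inside the disc.\<close>

lemma dirichlet_conv_0 [simp]: "dirichlet_conv f g 0 = 0"
  by (simp add: dirichlet_conv_def)

lemma dirichlet_conv_1 [simp]: "dirichlet_conv f g (Suc 0) = f 1 * g 1"
  by (simp add: dirichlet_conv_def)

lemma dirichlet_conv_commute: "dirichlet_conv f g = dirichlet_conv g f"
proof
  fix m
  show "dirichlet_conv f g m = dirichlet_conv g f m"
  proof (cases "m = 0")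
    case False
    show ?thesis
      unfolding dirichlet_conv_def
      by (rule sum.reindex_bij_witness[of _ "\<lambda>e. m div e" "\<lambda>e. m div e"])
         (use False in \<open>auto elim!: dvdE simp: mult.commute\<close>)
  qed simp
qed

lemma dirichlet_conv_assoc: "dirichlet_conv (dirichlet_conv f g) h = dirichlet_conv f (dirichlet_conv g h)"
proof
  fix m
  show "dirichlet_conv (dirichlet_conv f g) h m = dirichlet_conv f (dirichlet_conv g h) m"
  proof (cases "m = 0")
    case False
    have fin: "finite {e. e dvd n}" if "n dvd m" for n
      using that False by (intro finite_divisors_nat) (auto intro: Nat.gr0I)
    have "dirichlet_conv (dirichlet_conv f g) h m =
        (\<Sum>(e, k)\<in>(SIGMA e:{e. e dvd m}. {k. k dvd e}). f k * g (e div k) * h (m div e))"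
      unfolding dirichlet_conv_def sum_distrib_right using fin by (subst sum.Sigma) auto
    also have "\<dots> = (\<Sum>(k, l)\<in>(SIGMA k:{k. k dvd m}. {l. l dvd m div k}). f k * (g l * h (m div k div l)))"
      by (rule sum.reindex_bij_witness[of _ "\<lambda>(k, l). (k * l, k)" "\<lambda>(e, k). (k, e div k)"])
         (use False in \<open>auto elim!: dvdE simp: mult_ac\<close>)
    also have "\<dots> = dirichlet_conv f (dirichlet_conv g h) m"
      unfolding dirichlet_conv_def sum_distrib_left using fin by (subst sum.Sigma) (auto simp: div_dvd_iff_mult dvd_div_iff_mult)
    finally show ?thesis .
  qed simp
qed

lemma dirichlet_conv_left_commute:
  "dirichlet_conv f (dirichlet_conv g h) = dirichlet_conv g (dirichlet_conv f h)"
  by (metis dirichlet_conv_assoc dirichlet_conv_commute)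

text \<open>Values at 0 never matter: \<open>m div e\<close> is positive for a divisor e of m > 0,
  and at m = 0 the sum runs over an infinite set, hence is 0 by convention.\<close>

lemma dirichlet_conv_cong:
  assumes "\<And>m. m > 0 \<Longrightarrow> g m = g' m"
  shows "dirichlet_conv f g = dirichlet_conv f g'"
proof
  fix m
  show "dirichlet_conv f g m = dirichlet_conv f g' m"
  proof (cases "m = 0")
    case False
    then show ?thesis unfolding dirichlet_conv_def
      by (intro sum.cong refl arg_cong2[where f = times] assms) (auto elim!: dvdE)
  qed simp
qed

lemma dirichlet_conv_delta:
  assumes "m > 0"
  shows "dirichlet_conv f dirichlet_delta m = f m"
proof -
  have "dirichlet_conv f dirichlet_delta m = (\<Sum>e\<in>{m}. f e * dirichlet_delta (m div e))"
    unfolding dirichlet_conv_def using assms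
    by (intro sum.mono_neutral_right) (auto simp: dirichlet_delta_def elim!: dvdE)
  then show ?thesis using assms by (simp add: dirichlet_delta_def)
qed

lemma moebius_1 [simp]: "moebius (Suc 0) = 1"
  by (simp add: moebius_def)

lemma moebius_prime_mult:
  assumes p: "prime p" and m: "m > 0"
  shows "moebius (p * m) = (if p dvd m then 0 else - moebius m)"
proof (cases "p dvd m")
  case True
  then have "p ^ 2 dvd p * m" by (simp add: power2_eq_square)
  then have "\<not> squarefree (p * m)" using p not_prime_unit squarefreeD by blast
  then show ?thesis using True by (simp add: moebius_def)
next
  case False
  then have cop: "coprime p m" using p by (simp add: prime_imp_coprime)
  have "prime_factors (p * m) = insert p (prime_factors m)"
    using p m by (subst prime_factors_product) (auto simp: prime_prime_factors)
  moreover have "p \<notin> prime_factors m" using False by (auto simp: prime_factors_dvd)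
  moreover have "squarefree (p * m) \<longleftrightarrow> squarefree m"
  proof
    assume "squarefree (p * m)"
    then show "squarefree m" by (rule squarefree_mono[rotated]) simp
  qed (rule squarefree_mult_coprime[OF cop squarefree_prime[OF p]])
  ultimately show ?thesis using False by (simp add: moebius_def)
qed

text \<open>For a prime p dividing m, the terms of e and p e cancel when p does not divide e; all
  other divisors that are multiples of p are divisible by p^2 and contribute 0.\<close>

lemma sum_moebius:
  assumes "m > 1"
  shows "(\<Sum>e | e dvd m. moebius e) = 0"
proof -
  obtain p where p: "prime p" "p dvd m" using prime_factor_nat[of m] assms by auto
  have p0: "p > 0" using p(1) prime_gt_0_nat by blast
  have fin: "finite {e. e dvd m}" using assms by (intro finite_divisors_nat) simp
  let ?A = "{e. e dvd m \<and> \<not> p dvd e}"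
  have "(\<Sum>e | e dvd m. moebius e) = sum moebius (?A \<union> {e. e dvd m \<and> p dvd e})"
    by (rule arg_cong[where f = "sum moebius"]) auto
  also have "\<dots> = sum moebius ?A + sum moebius {e. e dvd m \<and> p dvd e}"
    by (intro sum.union_disjoint finite_subset[OF _ fin]) auto
  also have "sum moebius {e. e dvd m \<and> p dvd e} = sum moebius ((*) p ` ?A)"
  proof (rule sum.mono_neutral_right)
    show "finite {e. e dvd m \<and> p dvd e}" by (rule finite_subset[OF _ fin]) auto
    have "p * e dvd m" if "e \<in> ?A" for e
      using that p by (intro divides_mult) (auto simp: prime_imp_coprime)
    then show "(*) p ` ?A \<subseteq> {e. e dvd m \<and> p dvd e}" by (intro image_subsetI CollectI conjI dvd_triv_left)
    show "\<forall>e\<in>{e. e dvd m \<and> p dvd e} - (*) p ` ?A. moebius e = 0"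
    proof
      fix e assume e: "e \<in> {e. e dvd m \<and> p dvd e} - (*) p ` ?A"
      then obtain k where k: "e = p * k" by auto
      then have "k dvd m" "k > 0" using e assms by (auto intro: dvd_mult_right Nat.gr0I)
      then have "p dvd k" using e k by auto
      then show "moebius e = 0" using moebius_prime_mult[OF p(1) \<open>k > 0\<close>] k by simp
    qed
  qed
  also have "\<dots> = (\<Sum>e\<in>?A. moebius (p * e))" using p0 by (subst sum.reindex) (auto simp: inj_on_def)
  also have "\<dots> = (\<Sum>e\<in>?A. - moebius e)"
  proof (intro sum.cong refl)
    fix e assume e: "e \<in> ?A"
    then have "e > 0" using assms by (auto intro: Nat.gr0I)
    then show "moebius (p * e) = - moebius e" using moebius_prime_mult[OF p(1)] e by simp
  qed
  finally show ?thesis by (simp add: sum_negf)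
qed

lemma moebius_inversion:
  assumes "m > 0"
  shows "dirichlet_conv (dirichlet_conv f moebius) (\<lambda>_. 1) m = f m"
proof -
  have "dirichlet_conv moebius (\<lambda>_. 1) m = dirichlet_delta m" if "m > 0" for m
    using that sum_moebius[of m] by (cases "m = 1") (auto simp: dirichlet_conv_def dirichlet_delta_def)
  then have "dirichlet_conv f (dirichlet_conv moebius (\<lambda>_. 1)) = dirichlet_conv f dirichlet_delta"
    by (rule dirichlet_conv_cong)
  then show ?thesis using dirichlet_conv_delta[OF assms] by (simp add: dirichlet_conv_assoc)
qed

text \<open>Each of the d factors \<open>moebius\<close> absorbs one of the factors f.\<close>

lemma dirichlet_power_moebius:
  "dirichlet_conv (dirichlet_power f (k + d)) (dirichlet_power moebius d) =
   dirichlet_conv (dirichlet_power f k) (dirichlet_power (dirichlet_conv f moebius) d)"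
proof (induction d)
  case (Suc d)
  have "dirichlet_conv (dirichlet_power f (k + Suc d)) (dirichlet_power moebius (Suc d)) =
      dirichlet_conv (dirichlet_conv (dirichlet_power f (k + d)) (dirichlet_power moebius d)) (dirichlet_conv f moebius)"
    by (simp add: dirichlet_conv_assoc dirichlet_conv_left_commute[of f])
  then show ?case unfolding Suc by (simp add: dirichlet_conv_assoc)
qed simp

lemma dirichlet_conv_nonneg:
  assumes "\<And>e. e dvd m \<Longrightarrow> 0 \<le> f e" "\<And>e. e dvd m \<Longrightarrow> 0 \<le> g e"
  shows "0 \<le> dirichlet_conv f g m"
  unfolding dirichlet_conv_def
  using assms by (cases "m = 0") (auto intro!: sum_nonneg mult_nonneg_nonneg elim!: dvdE)

lemma dirichlet_power_nonneg:
  assumes "\<And>e. e dvd m \<Longrightarrow> 0 \<le> f e"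
  shows "0 \<le> dirichlet_power f k m"
  using assms
proof (induction k arbitrary: m)
  case (Suc k)
  then show ?case by (auto intro!: dirichlet_conv_nonneg intro: dvd_trans)
qed (simp add: dirichlet_delta_def less_eq_complex_def)

text \<open>With c = k + 1 + d the d Moebius factors use up d copies of f, and \<open>c > d\<close>
  leaves one more copy, which inversion writes as f * mu * 1. Hence g is f^(k) convolved with d + 1
  copies of f * mu, all of them nonnegative on the divisor-closed set \<open>D\<close>.\<close>

lemma divisor_sum_representation:
  assumes cd: "c > d" and closed: "\<And>m e. m \<in> D \<Longrightarrow> e dvd m \<Longrightarrow> e \<in> D" and pos: "\<And>m. m \<in> D \<Longrightarrow> m > 0"
    and nonneg: "\<And>m. m \<in> D \<Longrightarrow> 0 \<le> dirichlet_conv f moebius m"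
  shows "\<exists>g. (\<forall>m\<in>D. 0 \<le> g m) \<and>
    (\<forall>m. m > 0 \<longrightarrow> dirichlet_conv (dirichlet_power f c) (dirichlet_power moebius d) m = (\<Sum>t | t dvd m. g t))"
proof -
  obtain k where k: "c = Suc k + d" using cd less_imp_Suc_add by (metis add.commute add_Suc_right)
  let ?X = "dirichlet_conv f moebius"
  define g where "g = dirichlet_conv (dirichlet_conv (dirichlet_power f k) ?X) (dirichlet_power ?X d)"
  have X: "0 \<le> ?X e" if "m \<in> D" "e dvd m" for m e using nonneg closed that by blast
  have f: "0 \<le> f e" if "m \<in> D" "e dvd m" for m e
  proof -
    have e: "e \<in> D" using closed that by blast
    have "0 \<le> dirichlet_conv ?X (\<lambda>_. 1) e"
      by (intro dirichlet_conv_nonneg X[OF e]) (auto simp: less_eq_complex_def)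
    then show ?thesis using moebius_inversion pos[OF e] by simp
  qed
  have "0 \<le> g m" if "m \<in> D" for m
    unfolding g_def
  proof (rule dirichlet_conv_nonneg)
    fix e assume e: "e dvd m"
    show "0 \<le> dirichlet_power ?X d e"
      by (rule dirichlet_power_nonneg) (rule X[OF that dvd_trans[OF _ e]])
    show "0 \<le> dirichlet_conv (dirichlet_power f k) ?X e"
    proof (rule dirichlet_conv_nonneg)
      fix e' assume e': "e' dvd e"
      show "0 \<le> dirichlet_power f k e'"
        by (rule dirichlet_power_nonneg) (rule f[OF that dvd_trans[OF dvd_trans[OF _ e'] e]])
      show "0 \<le> ?X e'" by (rule X[OF that dvd_trans[OF e' e]])
    qed
  qed
  moreover have "dirichlet_conv (dirichlet_power f c) (dirichlet_power moebius d) = dirichlet_conv g (\<lambda>_. 1)"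
  proof -
    have "dirichlet_conv (dirichlet_power f k) f = dirichlet_conv (dirichlet_power f k) (dirichlet_conv ?X (\<lambda>_. 1))"
      by (rule dirichlet_conv_cong) (simp add: moebius_inversion)
    then have "dirichlet_conv (dirichlet_power f c) (dirichlet_power moebius d) =
        dirichlet_conv (dirichlet_conv (dirichlet_power f k) (dirichlet_conv ?X (\<lambda>_. 1))) (dirichlet_power ?X d)"
      unfolding k dirichlet_power_moebius by simp
    then show ?thesis
      unfolding g_def by (simp only: dirichlet_conv_assoc dirichlet_conv_commute[of "\<lambda>_. 1"])
  qed
  ultimately show ?thesis by (intro exI[of _ g]) (simp add: dirichlet_conv_def)
qed

text \<open>Splitting off one prime is all that products of distinct primes require, and this weak
  form passes easily to convolutions. The condition \<open>f 1 = 1\<close> excludes the zero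
  function.\<close>

definition prime_multiplicative :: "(nat \<Rightarrow> complex) \<Rightarrow> bool" where
  "prime_multiplicative f \<longleftrightarrow> f 1 = 1 \<and> (\<forall>p m. prime p \<longrightarrow> m > 0 \<longrightarrow> \<not> p dvd m \<longrightarrow> f (p * m) = f p * f m)"

text \<open>As p does not divide m, the divisors of p m are the e and the p e with e dividing m. The
  former sum to g p times, the latter to f p times the convolution at m.\<close>

lemma prime_multiplicative_conv:
  assumes f: "prime_multiplicative f" and g: "prime_multiplicative g"
  shows "prime_multiplicative (dirichlet_conv f g)" and "prime p \<Longrightarrow> dirichlet_conv f g p = f p + g p"
proof -
  have *: "dirichlet_conv f g (p * m) = (f p + g p) * dirichlet_conv f g m"
    if p: "prime p" and m: "m > 0" "\<not> p dvd m" for p m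
  proof -
    have p0: "p > 0" using p prime_gt_0_nat by blast
    have fin: "finite {e. e dvd m}" using m by (intro finite_divisors_nat) simp
    have D: "{e. e dvd p * m} = {e. e dvd m} \<union> (*) p ` {e. e dvd m}"
    proof (intro equalityI subsetI)
      fix e assume e: "e \<in> {e. e dvd p * m}"
      show "e \<in> {e. e dvd m} \<union> (*) p ` {e. e dvd m}"
      proof (cases "p dvd e")
        case True
        then obtain k where k: "e = p * k" by auto
        then have "k dvd m" using e p0 by simp
        then show ?thesis using k by auto
      next
        case False
        then have "coprime p e" by (rule prime_imp_coprime[OF p])
        then have "coprime e p" by (rule coprime_imp_coprime) auto
        then show ?thesis using e by (simp add: coprime_dvd_mult_right_iff)
      qed
    qed auto
    have dis: "{e. e dvd m} \<inter> (*) p ` {e. e dvd m} = {}" using m(2) by (auto dest: dvd_mult_left)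
    have e0: "e > 0" "\<not> p dvd e" "m div e > 0" "\<not> p dvd m div e" if "e dvd m" for e
      using that m by (auto elim!: dvdE intro: Nat.gr0I)
    have "dirichlet_conv f g (p * m) = (\<Sum>e | e dvd m. f e * g (p * m div e)) + (\<Sum>e\<in>(*) p ` {e. e dvd m}. f e * g (p * m div e))"
      unfolding dirichlet_conv_def D by (rule sum.union_disjoint) (use fin dis in auto)
    also have "(\<Sum>e | e dvd m. f e * g (p * m div e)) = (\<Sum>e | e dvd m. g p * (f e * g (m div e)))"
    proof (intro sum.cong refl)
      fix e assume "e \<in> {e. e dvd m}"
      then have e: "e dvd m" by simp
      then have "p * m div e = p * (m div e)" by (simp add: div_mult_swap)
      then show "f e * g (p * m div e) = g p * (f e * g (m div e))"
        using g e0[OF e] p unfolding prime_multiplicative_def by simp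
    qed
    also have "(\<Sum>e\<in>(*) p ` {e. e dvd m}. f e * g (p * m div e)) = (\<Sum>e | e dvd m. f (p * e) * g (m div e))"
      using p0 by (subst sum.reindex) (auto simp: inj_on_def)
    also have "\<dots> = (\<Sum>e | e dvd m. f p * (f e * g (m div e)))"
    proof (intro sum.cong refl)
      fix e assume "e \<in> {e. e dvd m}"
      then show "f (p * e) * g (m div e) = f p * (f e * g (m div e))"
        using f e0[of e] p unfolding prime_multiplicative_def by simp
    qed
    finally show ?thesis
      unfolding sum_distrib_left[symmetric] by (simp add: dirichlet_conv_def distrib_right)
  qed
  have 1: "dirichlet_conv f g (Suc 0) = 1" using f g by (simp add: prime_multiplicative_def)
  have P: "dirichlet_conv f g p = f p + g p" if "prime p" for p
    using *[OF that, of 1] 1 prime_gt_1_nat[OF that] by auto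
  then show "prime p \<Longrightarrow> dirichlet_conv f g p = f p + g p" .
  show "prime_multiplicative (dirichlet_conv f g)"
    unfolding prime_multiplicative_def using * P 1 by simp
qed

lemma prime_multiplicative_power:
  assumes "prime_multiplicative f"
  shows "prime_multiplicative (dirichlet_power f k) \<and> (\<forall>p. prime p \<longrightarrow> dirichlet_power f k p = of_nat k * f p)"
proof (induction k)
  case 0
  show ?case by (auto simp: prime_multiplicative_def dirichlet_delta_def)
next
  case (Suc k)
  then show ?case using prime_multiplicative_conv[OF _ assms] by (simp add: algebra_simps)
qed

lemma prime_multiplicative_moebius: "prime_multiplicative moebius"
  using moebius_prime_mult moebius_prime_mult[of _ 1]
  by (auto simp: prime_multiplicative_def)

lemma moebius_prime: "prime p \<Longrightarrow> moebius p = - 1"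
  using moebius_prime_mult[of p 1] by auto

lemma prime_multiplicative_prod:
  assumes f: "prime_multiplicative f" and "finite C" "\<And>p. p \<in> C \<Longrightarrow> prime p \<and> \<not> p dvd y" "y > 0"
  shows "f (y * \<Prod>C) = f y * (\<Prod>p\<in>C. f p)"
  using assms(2-4)
proof (induction C rule: finite_induct)
  case (insert p C)
  have "\<not> p dvd y * \<Prod>C"
  proof
    assume "p dvd y * \<Prod>C"
    then obtain q where "q \<in> C" "p dvd q"
      using insert.prems insert.hyps(1) by (metis insertI1 prime_dvd_mult_iff prime_dvd_prod_iff)
    then show False using insert.prems insert.hyps(2) by (metis insertCI primes_dvd_imp_eq)
  qed
  moreover have "y * \<Prod>C > 0" using insert by (auto intro!: prod_pos simp: prime_gt_0_nat)
  ultimately have "f (p * (y * \<Prod>C)) = f p * f (y * \<Prod>C)"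
    using f insert.prems unfolding prime_multiplicative_def by blast
  then show ?case using insert by (simp add: mult_ac)
qed simp

section \<open>Eigenvalues of Hermitian matrices\<close>

definition cinner :: "nat \<Rightarrow> (nat \<Rightarrow> complex) \<Rightarrow> (nat \<Rightarrow> complex) \<Rightarrow> complex" where
  "cinner n u v = (\<Sum>i<n. cnj (u i) * v i)"

text \<open>Vectors are functions of which only the first n values count; cutting off the result
  beyond n lets eigenvector equations be equalities of functions.\<close>

definition mat_app :: "nat \<Rightarrow> (nat \<Rightarrow> nat \<Rightarrow> complex) \<Rightarrow> (nat \<Rightarrow> complex) \<Rightarrow> nat \<Rightarrow> complex" where
  "mat_app n A v i = (if i < n then \<Sum>m<n. A i m * v m else 0)"

lemma mat_app_sum: "mat_app n A (\<lambda>i. \<Sum>j\<in>J. c j * u j i) = (\<lambda>i. \<Sum>j\<in>J. c j * mat_app n A (u j) i)"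
proof
  fix i
  show "mat_app n A (\<lambda>i. \<Sum>j\<in>J. c j * u j i) i = (\<Sum>j\<in>J. c j * mat_app n A (u j) i)"
  proof (cases "i < n")
    case True
    have "mat_app n A (\<lambda>i. \<Sum>j\<in>J. c j * u j i) i = (\<Sum>m<n. \<Sum>j\<in>J. c j * (A i m * u j m))"
      using True by (simp add: mat_app_def sum_distrib_left mult_ac)
    also have "\<dots> = (\<Sum>j\<in>J. \<Sum>m<n. c j * (A i m * u j m))" by (rule sum.swap)
    finally show ?thesis using True by (simp add: mat_app_def sum_distrib_left)
  qed (simp add: mat_app_def)
qed

lemma cinner_sum_right: "cinner n v (\<lambda>i. \<Sum>j\<in>J. c j * u j i) = (\<Sum>j\<in>J. c j * cinner n v (u j))"
proof -
  have "cinner n v (\<lambda>i. \<Sum>j\<in>J. c j * u j i) = (\<Sum>m<n. \<Sum>j\<in>J. c j * (cnj (v m) * u j m))"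
    by (simp add: cinner_def sum_distrib_left mult_ac)
  also have "\<dots> = (\<Sum>j\<in>J. \<Sum>m<n. c j * (cnj (v m) * u j m))" by (rule sum.swap)
  finally show ?thesis by (simp add: cinner_def sum_distrib_left)
qed

lemma cinner_commute: "cinner n v u = cnj (cinner n u v)"
  by (simp add: cinner_def mult.commute)

lemma cinner_sum_left: "cinner n (\<lambda>i. \<Sum>j\<in>J. c j * u j i) v = (\<Sum>j\<in>J. cnj (c j) * cinner n (u j) v)"
  by (subst cinner_commute, subst cinner_sum_right, simp, subst cinner_commute, simp)

lemma cinner_add_right: "cinner n v (\<lambda>i. x i + y i) = cinner n v x + cinner n v y"
  and cinner_scale_right: "cinner n v (\<lambda>i. c * x i) = c * cinner n v x"
  and cinner_scale_left: "cinner n (\<lambda>i. c * x i) v = cnj c * cinner n x v"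
  by (simp_all add: cinner_def distrib_left sum.distrib sum_distrib_left mult_ac)

lemma cinner_self: "cinner n v v = of_real (\<Sum>i<n. (norm (v i))\<^sup>2)"
  unfolding cinner_def of_real_sum complex_norm_square by (simp add: mult.commute)

lemma cinner_self_eq_0: "cinner n v v = 0 \<Longrightarrow> i < n \<Longrightarrow> v i = 0"
  unfolding cinner_self of_real_eq_0_iff by (subst (asm) sum_nonneg_eq_0_iff) auto

lemma mat_app_hermitian:
  assumes "\<And>i j. i < n \<Longrightarrow> j < n \<Longrightarrow> A j i = cnj (A i j)"
  shows "cinner n u (mat_app n A v) = cinner n (mat_app n A u) v"
proof -
  have "cinner n u (mat_app n A v) = (\<Sum>i<n. \<Sum>m<n. cnj (u i) * A i m * v m)"
    by (simp add: cinner_def mat_app_def sum_distrib_left mult_ac)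
  also have "\<dots> = (\<Sum>m<n. \<Sum>i<n. cnj (u i) * A i m * v m)" by (rule sum.swap)
  also have "\<dots> = (\<Sum>m<n. \<Sum>i<n. cnj (A m i * u i) * v m)"
  proof (intro sum.cong refl)
    fix m i assume "m \<in> {..<n}" "i \<in> {..<n}"
    then have "A i m = cnj (A m i)" by (intro assms) simp_all
    then show "cnj (u i) * A i m * v m = cnj (A m i * u i) * v m" by simp
  qed
  also have "\<dots> = cinner n (mat_app n A u) v" by (simp add: cinner_def mat_app_def sum_distrib_right)
  finally show ?thesis .
qed

text \<open>Orthogonalising a basis in which a Hermitian matrix is triangular diagonalises the matrix.\<close>

lemma hermitian_triangular_imp_orthogonal_eigenbasis:
  assumes herm: "\<And>i j. i < n \<Longrightarrow> j < n \<Longrightarrow> A j i = cnj (A i j)"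
    and supp: "\<And>k i. i \<ge> n \<Longrightarrow> p k i = 0"
    and tri: "\<And>k. k < n \<Longrightarrow> mat_app n A (p k) = (\<lambda>i. of_real (l k) * p k i + (\<Sum>m<k. B m k * p m i))"
    and indep: "\<And>c m. \<forall>i. (\<Sum>m<n. c m * p m i) = 0 \<Longrightarrow> m < n \<Longrightarrow> c m = 0"
  shows "\<exists>u. \<forall>k<n. mat_app n A (u k) = (\<lambda>i. of_real (l k) * u k i) \<and> (\<forall>j<k. cinner n (u j) (u k) = 0) \<and> cinner n (u k) (u k) \<noteq> 0"
proof -
  \<comment> \<open>Invariant of Gram-Schmidt. That \<open>u k\<close> lies in the span of p 0, ...,
    p k yields its nonvanishing by independence; that p k is \<open>u k\<close> plus earlier vectors
    expresses the off-diagonal part of the triangular relation in the orthogonal family.\<close>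
  define good where "good u k \<longleftrightarrow> mat_app n A (u k) = (\<lambda>i. of_real (l k) * u k i) \<and>
    (\<forall>j<k. cinner n (u j) (u k) = 0) \<and> cinner n (u k) (u k) \<noteq> 0 \<and>
    (\<exists>c. (\<forall>m>k. c m = 0) \<and> u k = (\<lambda>i. \<Sum>m<n. c m * p m i)) \<and>
    (\<exists>d. p k = (\<lambda>i. u k i + (\<Sum>j<k. d j * u j i)))" for u :: "nat \<Rightarrow> nat \<Rightarrow> complex" and k
  have good_cong: "good u k \<longleftrightarrow> good u' k" if "\<And>j. j \<le> k \<Longrightarrow> u j = u' j" for u u' k
  proof -
    have "(\<Sum>j<k. d j * u j i) = (\<Sum>j<k. d j * u' j i)" for d i
      using that by (intro sum.cong) auto
    then show ?thesis unfolding good_def using that by simp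
  qed
  have "\<exists>u. \<forall>k<K. good u k" if "K \<le> n" for K
    using that
  proof (induction K)
    case (Suc K)
    then obtain u where u: "\<forall>k<K. good u k" by auto
    have K: "K < n" using Suc.prems by simp
    have eig: "mat_app n A (u k) = (\<lambda>i. of_real (l k) * u k i)" if "k < K" for k using u that unfolding good_def by blast
    have nz: "cinner n (u k) (u k) \<noteq> 0" if "k < K" for k using u that unfolding good_def by blast
    have orth: "cinner n (u j) (u k) = 0" if "j < K" "k < K" "j \<noteq> k" for j k
    proof (cases "j < k")
      case True
      then show ?thesis using u that unfolding good_def by blast
    next
      case False
      then have "cinner n (u k) (u j) = 0" using u that unfolding good_def by (metis linorder_neqE_nat)
      then show ?thesis by (subst cinner_commute) simp
    qed
    have "\<forall>k. \<exists>c. k < K \<longrightarrow> (\<forall>m>k. c m = 0) \<and> u k = (\<lambda>i. \<Sum>m<n. c m * p m i)"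
      using u unfolding good_def by blast
    from choice[OF this] obtain c where c: "\<And>k m. k < K \<Longrightarrow> m > k \<Longrightarrow> c k m = 0"
      "\<And>k. k < K \<Longrightarrow> u k = (\<lambda>i. \<Sum>m<n. c k m * p m i)" by blast
    have "\<forall>k. \<exists>d. k < K \<longrightarrow> p k = (\<lambda>i. u k i + (\<Sum>j<k. d j * u j i))"
      using u unfolding good_def by blast
    from choice[OF this] obtain d where d: "\<And>k. k < K \<Longrightarrow> p k = (\<lambda>i. u k i + (\<Sum>j<k. d k j * u j i))" by blast
    define d' where "d' k j = (if j = k then 1 else if j < k then d k j else 0)" for k j
    have d': "p k i = (\<Sum>j<K. d' k j * u j i)" if "k < K" for k i
    proof -
      have "(\<Sum>j<K. d' k j * u j i) = (\<Sum>j\<in>insert k {..<k}. d' k j * u j i)"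
        using that by (intro sum.mono_neutral_right) (auto simp: d'_def)
      also have "\<dots> = u k i + (\<Sum>j<k. d k j * u j i)" by (simp add: d'_def)
      finally show ?thesis using fun_cong[OF d[OF that], of i] by simp
    qed
    define e where "e j = cinner n (u j) (p K) / cinner n (u j) (u j)" for j
    define w where "w i = p K i + (\<Sum>j<K. (- e j) * u j i)" for i
    have wu: "cinner n (u j) w = 0" if j: "j < K" for j
    proof -
      have "cinner n (u j) w = cinner n (u j) (p K) + (\<Sum>k<K. (- e k) * cinner n (u j) (u k))"
        unfolding w_def cinner_add_right cinner_sum_right ..
      also have "(\<Sum>k<K. (- e k) * cinner n (u j) (u k)) = (\<Sum>k\<in>{j}. (- e k) * cinner n (u j) (u k))"
        using j orth by (intro sum.mono_neutral_right) auto
      finally show ?thesis using nz[OF j] by (simp add: e_def)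
    qed
    have pw: "p K = (\<lambda>i. w i + (\<Sum>j<K. e j * u j i))"
      by (rule ext) (simp add: w_def sum_negf)
    have wc: "w i = (\<Sum>m<n. ((if m = K then 1 else 0) - (\<Sum>j<K. e j * c j m)) * p m i)" for i
    proof -
      have "(\<Sum>j<K. e j * u j i) = (\<Sum>j<K. \<Sum>m<n. e j * c j m * p m i)"
        using c(2) by (intro sum.cong) (simp_all add: sum_distrib_left mult.assoc)
      also have "\<dots> = (\<Sum>m<n. \<Sum>j<K. e j * c j m * p m i)" by (rule sum.swap)
      finally have 1: "(\<Sum>j<K. e j * u j i) = (\<Sum>m<n. (\<Sum>j<K. e j * c j m) * p m i)"
        by (simp add: sum_distrib_right)
      have 2: "(\<Sum>m<n. (if m = K then 1 else 0) * p m i) = p K i"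
        using K by (simp add: if_distrib[of "\<lambda>x. x * _"] cong: if_cong)
      show ?thesis
        unfolding left_diff_distrib sum_subtractf 2 1[symmetric] by (simp add: w_def sum_negf)
    qed
    have wnz: "cinner n w w \<noteq> 0"
    proof
      assume 0: "cinner n w w = 0"
      have "w i = 0" for i
      proof (cases "i < n")
        case False
        then show ?thesis unfolding wc using supp by simp
      qed (rule cinner_self_eq_0[OF 0])
      then have "(if K = K then 1 else 0) - (\<Sum>j<K. e j * c j K) = 0"
        using indep[of "\<lambda>m. (if m = K then 1 else 0) - (\<Sum>j<K. e j * c j m)" K] K wc by simp
      then show False using c(1) by simp
    qed
    define S where "S j = (\<Sum>m<K. B m K * d' m j)" for j
    define g where "g j = S j + (of_real (l K) - of_real (l j)) * e j" for j
    have Aw: "mat_app n A w i = of_real (l K) * w i + (\<Sum>j<K. g j * u j i)" for i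
    proof -
      have "mat_app n A w i = mat_app n A (p K) i + (\<Sum>j<K. (- e j) * mat_app n A (u j) i)"
      proof -
        have "w = (\<lambda>i. \<Sum>j\<in>{..<Suc K}. (if j = K then 1 else - e j) * (if j = K then p K else u j) i)"
          by (rule ext) (simp add: w_def)
        then have "mat_app n A w i = (\<Sum>j\<in>{..<Suc K}. (if j = K then 1 else - e j) * mat_app n A (if j = K then p K else u j) i)"
          by (simp only: mat_app_sum)
        then show ?thesis by simp
      qed
      also have "\<dots> = of_real (l K) * p K i + (\<Sum>m<K. B m K * p m i) + (\<Sum>j<K. - e j * (of_real (l j) * u j i))"
        unfolding tri[OF K] using eig by simp
      also have "(\<Sum>m<K. B m K * p m i) = (\<Sum>m<K. \<Sum>j<K. B m K * d' m j * u j i)"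
        using d' by (intro sum.cong) (simp_all add: sum_distrib_left mult.assoc)
      also have "\<dots> = (\<Sum>j<K. S j * u j i)"
        unfolding S_def sum_distrib_right by (rule sum.swap)
      also have "of_real (l K) * p K i = of_real (l K) * w i + (\<Sum>j<K. of_real (l K) * e j * u j i)"
        by (subst pw) (simp add: distrib_left sum_distrib_left mult.assoc)
      also have "of_real (l K) * w i + (\<Sum>j<K. of_real (l K) * e j * u j i) + (\<Sum>j<K. S j * u j i)
          + (\<Sum>j<K. - e j * (of_real (l j) * u j i)) = of_real (l K) * w i + (\<Sum>j<K. g j * u j i)"
        unfolding g_def add.assoc sum.distrib[symmetric]
        by (intro arg_cong2[where f = plus] sum.cong refl) (simp add: algebra_simps)
      finally show ?thesis .
    qed
    \<comment> \<open>Since A is Hermitian and \<open>u j\<close> an eigenvector, A w is orthogonal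
      to \<open>u j\<close> along with w. Pairing with \<open>u j\<close> isolates
      \<open>g j\<close>, so w is an eigenvector.\<close>
    have g0: "g j = 0" if j: "j < K" for j
    proof -
      have "cinner n (u j) (mat_app n A w) = cinner n (mat_app n A (u j)) w" by (rule mat_app_hermitian) (rule herm)
      then have "0 = cinner n (u j) (mat_app n A w)"
        unfolding eig[OF j] cinner_scale_left wu[OF j] by simp
      also have "mat_app n A w = (\<lambda>i. of_real (l K) * w i + (\<Sum>j<K. g j * u j i))" using Aw by blast
      also have "cinner n (u j) \<dots> = (\<Sum>k<K. g k * cinner n (u j) (u k))"
        unfolding cinner_add_right cinner_scale_right cinner_sum_right wu[OF j] by simp
      also have "\<dots> = (\<Sum>k\<in>{j}. g k * cinner n (u j) (u k))"
        using j orth by (intro sum.mono_neutral_right) auto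
      finally show ?thesis using nz[OF j] by simp
    qed
    have "good (u(K := w)) K"
      unfolding good_def
    proof (intro conjI)
      show "mat_app n A ((u(K := w)) K) = (\<lambda>i. of_real (l K) * (u(K := w)) K i)"
        using Aw g0 by auto
      show "\<forall>j<K. cinner n ((u(K := w)) j) ((u(K := w)) K) = 0" using wu by simp
      show "cinner n ((u(K := w)) K) ((u(K := w)) K) \<noteq> 0" using wnz by simp
      show "\<exists>c. (\<forall>m>K. c m = 0) \<and> (u(K := w)) K = (\<lambda>i. \<Sum>m<n. c m * p m i)"
        using wc c(1) by (intro exI[of _ "\<lambda>m. (if m = K then 1 else 0) - (\<Sum>j<K. e j * c j m)"]) auto
      show "\<exists>d. p K = (\<lambda>i. (u(K := w)) K i + (\<Sum>j<K. d j * (u(K := w)) j i))"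
        using pw by (intro exI[of _ e]) simp
    qed
    moreover have "good (u(K := w)) k" if "k < K" for k
      using good_cong[of k u "u(K := w)"] u that by auto
    ultimately have "\<forall>k<Suc K. good (u(K := w)) k" unfolding less_Suc_eq by blast
    then show ?case by blast
  qed simp
  from this[of n] obtain u where "\<forall>k<n. good u k" by auto
  then show ?thesis unfolding good_def by (intro exI[of _ u]) blast
qed

text \<open>There are n equations in n + 1 unknowns; padding with a zero row gives a singular square
  matrix.\<close>

lemma homogeneous_solution:
  fixes M :: "nat \<Rightarrow> nat \<Rightarrow> 'a :: field"
  shows "\<exists>c. (\<exists>j\<le>n. c j \<noteq> 0) \<and> (\<forall>i<n. (\<Sum>j\<le>n. M i j * c j) = 0)"
proof -
  let ?A = "mat (Suc n) (Suc n) (\<lambda>(i, j). if i < n then M i j else 0)"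
  have "?A = mat\<^sub>r (Suc n) (Suc n) (\<lambda>i. if i = n then 0\<^sub>v (Suc n) else vec (Suc n) (M i))"
    by (rule eq_matI) (auto simp: less_Suc_eq)
  also have "det \<dots> = 0" by (rule det_row_0) auto
  finally have "det ?A = 0" .
  then obtain v where v: "v \<in> carrier_vec (Suc n)" "v \<noteq> 0\<^sub>v (Suc n)" "?A *\<^sub>v v = 0\<^sub>v (Suc n)"
    using det_0_iff_vec_prod_zero[of ?A "Suc n"] by auto
  have "\<exists>j\<le>n. vec_index v j \<noteq> 0"
  proof (rule ccontr)
    assume "\<not> ?thesis"
    then have "v = 0\<^sub>v (Suc n)" using v(1) by (intro eq_vecI) auto
    then show False using v(2) by simp
  qed
  moreover have "(\<Sum>j\<le>n. M i j * vec_index v j) = 0" if "i < n" for i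
  proof -
    have "vec_index (?A *\<^sub>v v) i = 0" using v(3) that by simp
    then show ?thesis using that v(1) by (simp add: scalar_prod_def lessThan_atLeast0[symmetric] lessThan_Suc_atMost)
  qed
  ultimately show ?thesis by (intro exI[of _ "vec_index v"]) simp
qed

text \<open>A Schur decomposition A = P B Q gives A P = P B, so A is triangular in the basis of
  columns of P, and the diagonal of B lists the eigenvalues in the prescribed order. Columns count
  from 0 and l from 1, hence \<open>l (Suc k)\<close>.\<close>

lemma hermitian_eigenbasis:
  fixes l :: "nat \<Rightarrow> real"
  assumes A: "A \<in> carrier_mat n n" and herm: "\<And>i j. i < n \<Longrightarrow> j < n \<Longrightarrow> A $$ (j, i) = cnj (A $$ (i, j))"
    and cp: "char_poly A = (\<Prod>k=1..n. [:- complex_of_real (l k), 1:])"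
  shows "\<exists>u. \<forall>k<n. mat_app n (\<lambda>i j. A $$ (i, j)) (u k) = (\<lambda>i. of_real (l (Suc k)) * u k i) \<and>
    (\<forall>j<k. cinner n (u j) (u k) = 0) \<and> cinner n (u k) (u k) \<noteq> 0"
proof -
  let ?es = "map (\<lambda>k. complex_of_real (l k)) [1..<Suc n]"
  obtain B P Q where sd: "schur_decomposition A ?es = (B, P, Q)" by (metis prod_cases3)
  have "char_poly A = (\<Prod>e\<leftarrow>?es. [:- e, 1:])"
    unfolding cp by (simp add: prod.distinct_set_conv_list[symmetric] o_def atLeastLessThanSuc_atLeastAtMost del: upt_Suc)
  from schur_decomposition[OF A this sd] have
    sim: "similar_mat_wit A B P Q" and ut: "upper_triangular B" and dg: "diag_mat B = ?es" by auto
  from similar_mat_witD2[OF A sim] have QP: "Q * P = 1\<^sub>m n" and APBQ: "A = P * B * Q"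
    and c: "B \<in> carrier_mat n n" "P \<in> carrier_mat n n" "Q \<in> carrier_mat n n" by auto
  have "A * P = P * B * (Q * P)" unfolding APBQ using c by (simp add: assoc_mult_mat[of _ n n _ n _ n])
  then have AP: "A * P = P * B" unfolding QP using c by simp
  have Bkk: "B $$ (k, k) = of_real (l (Suc k))" if "k < n" for k
  proof -
    have "diag_mat B ! k = ?es ! k" using dg by simp
    then show ?thesis using that c(1) by (simp add: diag_mat_def del: upt_Suc)
  qed
  have B0: "B $$ (m, k) = 0" if "k < m" "m < n" for m k using ut that c(1) by auto
  define p where "p k i = (if i < n then P $$ (i, k) else 0)" for k i
  have tri: "mat_app n (\<lambda>i j. A $$ (i, j)) (p k) = (\<lambda>i. of_real (l (Suc k)) * p k i + (\<Sum>m<k. B $$ (m, k) * p m i))"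
    if k: "k < n" for k
  proof
    fix i
    show "mat_app n (\<lambda>i j. A $$ (i, j)) (p k) i = of_real (l (Suc k)) * p k i + (\<Sum>m<k. B $$ (m, k) * p m i)"
    proof (cases "i < n")
      case True
      have "(A * P) $$ (i, k) = (P * B) $$ (i, k)" using AP by simp
      then have "(\<Sum>m<n. A $$ (i, m) * P $$ (m, k)) = (\<Sum>m<n. P $$ (i, m) * B $$ (m, k))"
        using True k A c by (simp add: scalar_prod_def lessThan_atLeast0)
      also have "\<dots> = (\<Sum>m<Suc k. P $$ (i, m) * B $$ (m, k))"
        using k B0 by (intro sum.mono_neutral_right) auto
      finally show ?thesis using True k Bkk[OF k] by (simp add: mat_app_def p_def mult.commute)
    qed (simp add: mat_app_def p_def)
  qed
  have "c m = 0" if z: "\<forall>i. (\<Sum>m<n. c m * p m i) = 0" and m: "m < n" for c m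
  proof -
    have "(\<Sum>i<n. Q $$ (m, i) * (\<Sum>k<n. c k * p k i)) = (\<Sum>k<n. c k * (\<Sum>i<n. Q $$ (m, i) * P $$ (i, k)))"
      unfolding sum_distrib_left by (subst sum.swap) (intro sum.cong refl, simp add: p_def)
    also have "\<dots> = (\<Sum>k<n. (if k = m then c k else 0))"
    proof (intro sum.cong refl)
      fix k assume k: "k \<in> {..<n}"
      have "(Q * P) $$ (m, k) = (1\<^sub>m n :: complex mat) $$ (m, k)" using QP by simp
      then show "c k * (\<Sum>i<n. Q $$ (m, i) * P $$ (i, k)) = (if k = m then c k else 0)"
        using k m c by (simp add: scalar_prod_def lessThan_atLeast0)
    qed
    finally show ?thesis using z m by simp
  qed
  note indep = this
  show ?thesis
  proof (rule hermitian_triangular_imp_orthogonal_eigenbasis[where p = p and B = "\<lambda>m k. B $$ (m, k)" and l = "\<lambda>k. l (Suc k)"])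
    show "A $$ (j, i) = cnj (A $$ (i, j))" if "i < n" "j < n" for i j using that by (rule herm)
    show "p k i = 0" if "i \<ge> n" for k i using that by (simp add: p_def)
  qed (rule tri indep; assumption)+
qed

text \<open>The Courant--Fischer bounds for a family \<open>w\<close> spanning a \<open>q\<close>-dimensional test space.\<close>

lemma ordered_eigenvalue_bounds:
  assumes A: "A \<in> carrier_mat n n" and herm: "\<And>i j. i < n \<Longrightarrow> j < n \<Longrightarrow> A $$ (j, i) = cnj (A $$ (i, j))"
    and eig: "ordered_eigenvalues A l" and q: "1 \<le> q" "q \<le> n"
    and psd: "\<And>v. 0 \<le> Re (cinner n v (mat_app n (\<lambda>i j. A $$ (i, j)) v))"
    and test: "\<And>c v. v = (\<lambda>i. \<Sum>j<q. c j * w j i) \<Longrightarrow>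
      Re (cinner n v (mat_app n (\<lambda>i j. A $$ (i, j)) v)) \<le> \<epsilon> * Re (cinner n v v)"
    and indep: "\<And>c. \<forall>i<n. (\<Sum>j<q. c j * w j i) = 0 \<Longrightarrow> \<forall>j<q. c j = 0"
  shows "0 \<le> l q" "l q \<le> \<epsilon>"
proof -
  let ?A = "\<lambda>i j. A $$ (i, j)"
  have mono: "mono_on {1..n} l" and cp: "char_poly A = (\<Prod>k=1..n. [:- complex_of_real (l k), 1:])"
    using eig A unfolding ordered_eigenvalues_def by auto
  obtain u where u: "\<And>k. k < n \<Longrightarrow> mat_app n ?A (u k) = (\<lambda>i. of_real (l (Suc k)) * u k i)"
      "\<And>j k. j < k \<Longrightarrow> k < n \<Longrightarrow> cinner n (u j) (u k) = 0" "\<And>k. k < n \<Longrightarrow> cinner n (u k) (u k) \<noteq> 0"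
    using hermitian_eigenbasis[OF A herm cp] by blast
  have orth: "cinner n (u j) (u k) = 0" if "j < n" "k < n" "j \<noteq> k" for j k
  proof (cases "j < k")
    case False
    then have "cinner n (u k) (u j) = 0" using u(2)[of k j] that by simp
    then show ?thesis by (subst cinner_commute) simp
  qed (use u(2) that in simp)
  define s where "s k = (\<Sum>i<n. (norm (u k i))\<^sup>2)" for k
  have s: "cinner n (u k) (u k) = of_real (s k)" for k unfolding s_def by (rule cinner_self)
  have spos: "s k > 0" if "k < n" for k
  proof -
    have "s k \<noteq> 0" using u(3)[OF that] unfolding s of_real_eq_0_iff .
    moreover have "s k \<ge> 0" unfolding s_def by (intro sum_nonneg) simp
    ultimately show ?thesis by simp
  qed
  have "cinner n (u (q - 1)) (mat_app n ?A (u (q - 1))) = of_real (l q * s (q - 1))"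
    using u(1)[of "q - 1"] q by (simp add: cinner_scale_right s)
  then have "0 \<le> l q * s (q - 1)" using psd[of "u (q - 1)"] by simp
  moreover have "0 < s (q - 1)" using q by (intro spos) simp
  ultimately show "0 \<le> l q" by (simp add: zero_le_mult_iff)
  \<comment> \<open>The unknowns are q coefficients of test vectors and n - q + 1 coefficients of
    the eigenvectors to l q, ..., l n. One more unknown than coordinates forces a nontrivial
    relation, that is, a common vector v of both spans.\<close>
  obtain c where c: "\<exists>j\<le>n. c j \<noteq> 0" "\<forall>i<n. (\<Sum>j\<le>n. (if j < q then w j i else - u (j - 1) i) * c j) = 0"
    using homogeneous_solution[of n "\<lambda>i j. if j < q then w j i else - u (j - 1) i"] by blast
  define K where "K = {q - 1..<n}"
  define d where "d k = c (Suc k)" for k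
  define v where "v i = (\<Sum>j<q. c j * w j i)" for i
  define v' where "v' i = (\<Sum>k\<in>K. d k * u k i)" for i
  have vv': "v i = v' i" if "i < n" for i
  proof -
    have "{..n} = {..<q} \<union> {q..n}" using q by auto
    then have "(\<Sum>j\<le>n. (if j < q then w j i else - u (j - 1) i) * c j) =
        (\<Sum>j<q. (if j < q then w j i else - u (j - 1) i) * c j) + (\<Sum>j=q..n. (if j < q then w j i else - u (j - 1) i) * c j)"
      by (simp only:) (rule sum.union_disjoint; auto)
    also have "(\<Sum>j<q. (if j < q then w j i else - u (j - 1) i) * c j) = v i"
      unfolding v_def by (intro sum.cong) (auto simp: mult.commute)
    also have "(\<Sum>j=q..n. (if j < q then w j i else - u (j - 1) i) * c j) = (\<Sum>k\<in>K. - (d k * u k i))"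
      unfolding K_def d_def using q
      by (intro sum.reindex_bij_witness[of _ Suc "\<lambda>j. j - 1"]) auto
    finally show ?thesis using c(2) that by (simp add: v'_def sum_negf)
  qed
  have ipv: "cinner n v x = cinner n v' x" "cinner n x v = cinner n x v'" "mat_app n ?A v = mat_app n ?A v'" for x
    unfolding cinner_def mat_app_def using vv' by (auto intro!: sum.cong ext)
  have Kn: "k < n" if "k \<in> K" for k using that unfolding K_def by simp
  \<comment> \<open>Used with t = 1 for the squared norm of v and with the eigenvalues as t for its
    quadratic form.\<close>
  have quad: "cinner n v' (\<lambda>i. \<Sum>k\<in>K. of_real (t k) * d k * u k i) = of_real (\<Sum>k\<in>K. t k * ((norm (d k))\<^sup>2 * s k))" for t
  proof -
    have "cinner n v' (\<lambda>i. \<Sum>k\<in>K. of_real (t k) * d k * u k i) =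
        (\<Sum>k\<in>K. of_real (t k) * d k * (\<Sum>j\<in>K. cnj (d j) * cinner n (u j) (u k)))"
      unfolding v'_def cinner_sum_right cinner_sum_left ..
    also have "\<dots> = (\<Sum>k\<in>K. of_real (t k) * d k * (cnj (d k) * of_real (s k)))"
    proof (intro sum.cong refl)
      fix k assume k: "k \<in> K"
      have "(\<Sum>j\<in>K. cnj (d j) * cinner n (u j) (u k)) = (\<Sum>j\<in>{k}. cnj (d j) * cinner n (u j) (u k))"
        using k orth Kn by (intro sum.mono_neutral_right) (auto simp: K_def)
      then show "of_real (t k) * d k * (\<Sum>j\<in>K. cnj (d j) * cinner n (u j) (u k)) = of_real (t k) * d k * (cnj (d k) * of_real (s k))"
        by (simp add: s)
    qed
    also have "\<dots> = (\<Sum>k\<in>K. of_real (t k) * (of_real ((norm (d k))\<^sup>2) * of_real (s k)))"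
      unfolding complex_norm_square by (simp add: mult_ac)
    finally show ?thesis by simp
  qed
  define r where "r = (\<Sum>k\<in>K. (norm (d k))\<^sup>2 * s k)"
  have 1: "Re (cinner n v v) = r"
  proof -
    have "cinner n v v = cinner n v' (\<lambda>i. \<Sum>k\<in>K. of_real 1 * d k * u k i)" unfolding ipv by (simp add: v'_def[abs_def])
    then show ?thesis unfolding quad r_def by simp
  qed
  have 2: "Re (cinner n v (mat_app n ?A v)) = (\<Sum>k\<in>K. l (Suc k) * ((norm (d k))\<^sup>2 * s k))"
  proof -
    have "mat_app n ?A v' = (\<lambda>i. \<Sum>k\<in>K. of_real (l (Suc k)) * d k * u k i)"
      unfolding v'_def mat_app_sum using u(1) Kn by (intro ext sum.cong) (auto simp: mult_ac)
    note eq = this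
    show ?thesis unfolding ipv eq quad by simp
  qed
  have "l q * r \<le> (\<Sum>k\<in>K. l (Suc k) * ((norm (d k))\<^sup>2 * s k))"
    unfolding r_def sum_distrib_left
  proof (intro sum_mono mult_right_mono)
    fix k assume k: "k \<in> K"
    show "l q \<le> l (Suc k)" using mono_onD[OF mono, of q "Suc k"] k q unfolding K_def by auto
    show "0 \<le> (norm (d k))\<^sup>2 * s k" using spos[OF Kn[OF k]] by simp
  qed
  also have "\<dots> \<le> \<epsilon> * r" using test[of v c] unfolding 1 2 by (simp add: v_def[abs_def])
  finally have 3: "l q * r \<le> \<epsilon> * r" .
  \<comment> \<open>Otherwise all \<open>d k\<close> vanish, so v vanishes below n, and independence
    of the test vectors kills the remaining coefficients of the nontrivial relation.\<close>
  have "r > 0"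
  proof (rule ccontr)
    assume "\<not> r > 0"
    have nn: "(norm (d k))\<^sup>2 * s k \<ge> 0" if "k \<in> K" for k using spos[OF Kn[OF that]] by simp
    then have "r = 0" using \<open>\<not> r > 0\<close> sum_nonneg[of K "\<lambda>k. (norm (d k))\<^sup>2 * s k"] unfolding r_def by force
    then have "(norm (d k))\<^sup>2 * s k = 0" if "k \<in> K" for k
      using sum_nonneg_eq_0_iff[of K "\<lambda>k. (norm (d k))\<^sup>2 * s k"] nn that unfolding r_def K_def by auto
    then have d0: "d k = 0" if "k \<in> K" for k using that spos[OF Kn[OF that]] by force
    then have "\<forall>i<n. v i = 0" using vv' by (simp add: v'_def)
    then have "\<forall>j<q. c j = 0" using indep unfolding v_def by blast
    moreover have "c j = 0" if "q \<le> j" "j \<le> n" for j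
    proof -
      have "j - 1 \<in> K" unfolding K_def using that q by (auto simp: diff_le_mono)
      then show ?thesis using d0[of "j - 1"] that q unfolding d_def by simp
    qed
    ultimately show False using c(1) by (meson not_le)
  qed
  then show "l q \<le> \<epsilon>" using 3 by simp
qed

section \<open>Test vectors for gcd matrices\<close>

lemma sum_Pow_insert:
  assumes "finite S" "p \<notin> S"
  shows "(\<Sum>A\<in>Pow (insert p S). F A) = (\<Sum>A\<in>Pow S. F A + F (insert p A))"
proof -
  have "(\<Sum>A\<in>Pow (insert p S). F A) = (\<Sum>A\<in>Pow S. F A) + (\<Sum>A\<in>insert p ` Pow S. F A)"
    unfolding Pow_insert using assms by (intro sum.union_disjoint) auto
  also have "(\<Sum>A\<in>insert p ` Pow S. F A) = (\<Sum>A\<in>Pow S. F (insert p A))"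
    using assms(2) by (subst sum.reindex) (auto simp: inj_on_def)
  finally show ?thesis by (simp add: sum.distrib)
qed

text \<open>An element p lies in neither of A and B, in exactly one (two ways), or in both,
  contributing 1, s p twice, and (s p)^2 k p; the double sum is the expanded product.\<close>

lemma sum_Pow_Pow_prod:
  fixes s k :: "'a \<Rightarrow> 'b :: comm_ring_1"
  assumes "finite S"
  shows "(\<Sum>A\<in>Pow S. \<Sum>B\<in>Pow S. prod s A * prod s B * prod k (A \<inter> B)) = (\<Prod>p\<in>S. 1 + 2 * s p + (s p)\<^sup>2 * k p)"
  using assms
proof (induction S rule: finite_induct)
  case (insert p S)
  let ?F = "\<lambda>A B. prod s A * prod s B * prod k (A \<inter> B)"
  have *: "?F A B + ?F A (insert p B) + (?F (insert p A) B + ?F (insert p A) (insert p B)) =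
      (1 + 2 * s p + (s p)\<^sup>2 * k p) * ?F A B" if "A \<in> Pow S" "B \<in> Pow S" for A B
  proof -
    have fin: "finite A" "finite B" and np: "p \<notin> A" "p \<notin> B"
      using that insert.hyps finite_subset by auto
    have "A \<inter> insert p B = A \<inter> B" "insert p A \<inter> B = A \<inter> B" "insert p A \<inter> insert p B = insert p (A \<inter> B)"
      using np by auto
    then show ?thesis using fin np by (simp add: power2_eq_square algebra_simps)
  qed
  have "(\<Sum>A\<in>Pow (insert p S). \<Sum>B\<in>Pow (insert p S). ?F A B) =
      (\<Sum>A\<in>Pow S. \<Sum>B\<in>Pow S. ?F A B + ?F A (insert p B) + (?F (insert p A) B + ?F (insert p A) (insert p B)))"
    unfolding sum_Pow_insert[OF insert.hyps] sum.distrib by (simp only: add_ac)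
  also have "\<dots> = (\<Sum>A\<in>Pow S. \<Sum>B\<in>Pow S. (1 + 2 * s p + (s p)\<^sup>2 * k p) * ?F A B)"
    using * by (intro sum.cong refl) simp
  also have "\<dots> = (1 + 2 * s p + (s p)\<^sup>2 * k p) * (\<Sum>A\<in>Pow S. \<Sum>B\<in>Pow S. ?F A B)"
    by (simp only: sum_distrib_left)
  finally show ?case using insert by simp
qed simp

lemma prime_dvd_prod_iff_mem:
  fixes A :: "nat set"
  assumes "finite A" "\<And>p. p \<in> A \<Longrightarrow> prime p" "prime p"
  shows "p dvd \<Prod>A \<longleftrightarrow> p \<in> A"
  using assms by (metis dvd_prodI prime_dvd_prod_iff primes_dvd_imp_eq)

lemma gcd_prod_primes:
  fixes A B :: "nat set"
  assumes "finite A" "finite B" "\<And>p. p \<in> A \<union> B \<Longrightarrow> prime p"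
  shows "gcd (\<Prod>A) (\<Prod>B) = \<Prod>(A \<inter> B)"
proof -
  have A: "\<Prod>A = \<Prod>(A \<inter> B) * \<Prod>(A - B)" and B: "\<Prod>B = \<Prod>(A \<inter> B) * \<Prod>(B - A)"
    using assms(1,2) by (subst prod.union_disjoint[symmetric]; auto intro!: prod.cong)+
  have "coprime (\<Prod>(A - B)) (\<Prod>(B - A))"
    using assms(3) by (intro prod_coprime_left prod_coprime_right primes_coprime) auto
  then show ?thesis unfolding A B by (simp add: gcd_mult_distrib_nat[symmetric])
qed

text \<open>The gcd of two entries is y times the product over the intersection of their subsets, so
  the form factorises over \<open>S\<close>; with s = - 1 / k the local factor 1 + 2 s + s^2 k
  becomes 1 - 1 / k. The weight reads the subset off the primes of \<open>S\<close> dividing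
  \<open>x (Suc i)\<close>, which avoids an inverse of \<open>\<phi>\<close>.\<close>

lemma test_vector_form:
  fixes h :: "nat \<Rightarrow> complex" and x :: "nat \<Rightarrow> nat" and n y :: nat and S :: "nat set" and k :: "nat \<Rightarrow> real" 
  assumes h: "prime_multiplicative h" and S: "finite S" "\<And>p. p \<in> S \<Longrightarrow> prime p \<and> \<not> p dvd y" and y: "y > 0"
    and k: "\<And>p. p \<in> S \<Longrightarrow> h p = of_real (k p) \<and> k p > 0"
    and \<phi>: "\<And>A. A \<subseteq> S \<Longrightarrow> \<phi> A < n \<and> x (Suc (\<phi> A)) = y * \<Prod>A"
  defines "w \<equiv> \<lambda>i. if i \<in> \<phi> ` Pow S then \<Prod>p | p \<in> S \<and> p dvd x (Suc i). - of_real (1 / k p) else 0"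
  shows "cinner n w (mat_app n (\<lambda>i j. h (gcd (x (Suc i)) (x (Suc j)))) w) = h y * of_real (\<Prod>p\<in>S. 1 - 1 / k p)"
    and "w (\<phi> {}) = 1"
proof -
  define s where "s p = - complex_of_real (1 / k p)" for p
  have finA: "finite A" if "A \<subseteq> S" for A using that S(1) finite_subset by blast
  \<comment> \<open>No prime of \<open>S\<close> divides y, so A is recovered from its entry; in
    particular \<open>\<phi>\<close> is injective.\<close>
  have mem: "{p \<in> S. p dvd x (Suc (\<phi> A))} = A" if A: "A \<subseteq> S" for A
  proof -
    have "p dvd x (Suc (\<phi> A)) \<longleftrightarrow> p \<in> A" if "p \<in> S" for p
      using \<phi>[OF A] S(2)[OF that] prime_dvd_prod_iff_mem[OF finA[OF A], of p] S(2) A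
      by (auto simp: prime_dvd_mult_iff)
    then show ?thesis using A by auto
  qed
  have inj: "inj_on \<phi> (Pow S)"
    by (rule inj_onI) (metis PowD mem)
  have w: "w (\<phi> A) = prod s A" if "A \<subseteq> S" for A
    using that mem[OF that] unfolding w_def s_def by auto
  then show "w (\<phi> {}) = 1" by simp
  have sub: "\<phi> ` Pow S \<subseteq> {..<n}" using \<phi> by auto
  have w0: "w i = 0" if "i \<notin> \<phi> ` Pow S" for i using that unfolding w_def by simp
  have "cinner n w (mat_app n (\<lambda>i j. h (gcd (x (Suc i)) (x (Suc j)))) w) =
      (\<Sum>i<n. \<Sum>j<n. cnj (w i) * w j * h (gcd (x (Suc i)) (x (Suc j))))"
    by (simp add: cinner_def mat_app_def sum_distrib_left mult_ac)
  also have "\<dots> = (\<Sum>i<n. \<Sum>j\<in>\<phi> ` Pow S. cnj (w i) * w j * h (gcd (x (Suc i)) (x (Suc j))))"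
    using sub w0 by (intro sum.cong refl sum.mono_neutral_right) auto
  also have "\<dots> = (\<Sum>i\<in>\<phi> ` Pow S. \<Sum>j\<in>\<phi> ` Pow S. cnj (w i) * w j * h (gcd (x (Suc i)) (x (Suc j))))"
    using sub w0 by (intro sum.mono_neutral_right) auto
  also have "\<dots> = (\<Sum>A\<in>Pow S. \<Sum>B\<in>Pow S. cnj (w (\<phi> A)) * w (\<phi> B) * h (gcd (x (Suc (\<phi> A))) (x (Suc (\<phi> B)))))"
    by (simp add: sum.reindex[OF inj])
  also have "\<dots> = (\<Sum>A\<in>Pow S. \<Sum>B\<in>Pow S. h y * (prod s A * prod s B * prod h (A \<inter> B)))"
  proof (intro sum.cong refl)
    fix A B assume "A \<in> Pow S" "B \<in> Pow S"
    then have AB: "A \<subseteq> S" "B \<subseteq> S" by auto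
    have "gcd (x (Suc (\<phi> A))) (x (Suc (\<phi> B))) = y * \<Prod>(A \<inter> B)"
      using \<phi>[OF AB(1)] \<phi>[OF AB(2)] gcd_prod_primes[OF finA[OF AB(1)] finA[OF AB(2)]] S(2) AB
      by (simp add: gcd_mult_distrib_nat[symmetric] subset_iff) blast
    moreover have "h (y * \<Prod>(A \<inter> B)) = h y * prod h (A \<inter> B)"
      using S(2) AB finA[OF AB(1)] by (intro prime_multiplicative_prod[OF h _ _ y]) auto
    moreover have "cnj (w (\<phi> A)) = prod s A" unfolding w[OF AB(1)] by (simp add: s_def)
    ultimately show "cnj (w (\<phi> A)) * w (\<phi> B) * h (gcd (x (Suc (\<phi> A))) (x (Suc (\<phi> B)))) =
        h y * (prod s A * prod s B * prod h (A \<inter> B))" unfolding w[OF AB(2)] by simp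
  qed
  also have "\<dots> = h y * (\<Sum>A\<in>Pow S. \<Sum>B\<in>Pow S. prod s A * prod s B * prod h (A \<inter> B))"
    by (simp only: sum_distrib_left)
  also have "\<dots> = h y * (\<Prod>p\<in>S. 1 + 2 * s p + (s p)\<^sup>2 * h p)" unfolding sum_Pow_Pow_prod[OF S(1)] ..
  also have "(\<Prod>p\<in>S. 1 + 2 * s p + (s p)\<^sup>2 * h p) = (\<Prod>p\<in>S. of_real (1 - 1 / k p))"
  proof (intro prod.cong refl)
    fix p assume "p \<in> S"
    then have p: "h p = of_real (k p)" "k p \<noteq> 0" using k[of p] by auto
    have "1 + 2 * s p + (s p)\<^sup>2 * h p = of_real (1 - 2 / k p + (1 / k p)\<^sup>2 * k p)" unfolding s_def p(1) by simp
    also have "1 - 2 / k p + (1 / k p)\<^sup>2 * k p = 1 - 1 / k p" using p(2) by (simp add: power2_eq_square)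
    finally show "1 + 2 * s p + (s p)\<^sup>2 * h p = of_real (1 - 1 / k p)" .
  qed
  finally show "cinner n w (mat_app n (\<lambda>i j. h (gcd (x (Suc i)) (x (Suc j)))) w) = h y * of_real (\<Prod>p\<in>S. 1 - 1 / k p)"
    by simp
qed

text \<open>A number t divides a gcd exactly when it divides both arguments, so it contributes g t
  times a rank-one form. \<open>T\<close> is the finite set of divisors that occur.\<close>

lemma gcd_form:
  fixes h g :: "nat \<Rightarrow> complex" and x :: "nat \<Rightarrow> nat" and n :: nat
  assumes g: "\<And>m. m > 0 \<Longrightarrow> h m = (\<Sum>t | t dvd m. g t)" and x: "\<And>i. x (Suc i) > 0"
  defines "T \<equiv> {t. \<exists>i<n. t dvd x (Suc i)}"
  shows "cinner n v (mat_app n (\<lambda>i j. h (gcd (x (Suc i)) (x (Suc j)))) v) =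
    (\<Sum>t\<in>T. g t * of_real ((norm (\<Sum>i<n. if t dvd x (Suc i) then v i else 0))\<^sup>2))"
proof -
  let ?d = "\<lambda>t i. if t dvd x (Suc i) then v i else 0"
  have "T = (\<Union>i<n. {t. t dvd x (Suc i)})" unfolding T_def by auto
  then have finT: "finite T" using x by (auto simp: finite_divisors_nat)
  have h: "cnj (v i) * (h (gcd (x (Suc i)) (x (Suc j))) * v j) = (\<Sum>t\<in>T. g t * (cnj (?d t i) * ?d t j))" if "i < n" "j < n" for i j
  proof -
    have "h (gcd (x (Suc i)) (x (Suc j))) = (\<Sum>t | t dvd gcd (x (Suc i)) (x (Suc j)). g t)"
      using x[of i] by (intro g) simp
    then have "cnj (v i) * (h (gcd (x (Suc i)) (x (Suc j))) * v j) =
        (\<Sum>t | t dvd gcd (x (Suc i)) (x (Suc j)). g t * (cnj (?d t i) * ?d t j))"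
      by (simp add: sum_distrib_left sum_distrib_right mult_ac)
    also have "\<dots> = (\<Sum>t\<in>T. g t * (cnj (?d t i) * ?d t j))"
      using that by (intro sum.mono_neutral_left finT) (auto simp: T_def)
    finally show ?thesis .
  qed
  have "cinner n v (mat_app n (\<lambda>i j. h (gcd (x (Suc i)) (x (Suc j)))) v) =
      (\<Sum>i<n. \<Sum>j<n. cnj (v i) * (h (gcd (x (Suc i)) (x (Suc j))) * v j))"
    by (simp add: cinner_def mat_app_def sum_distrib_left)
  also have "\<dots> = (\<Sum>i<n. \<Sum>j<n. \<Sum>t\<in>T. g t * (cnj (?d t i) * ?d t j))"
    using h by (intro sum.cong refl) simp
  also have "\<dots> = (\<Sum>i<n. \<Sum>t\<in>T. \<Sum>j<n. g t * (cnj (?d t i) * ?d t j))"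
    by (intro sum.cong refl sum.swap)
  also have "\<dots> = (\<Sum>t\<in>T. \<Sum>i<n. \<Sum>j<n. g t * (cnj (?d t i) * ?d t j))" by (rule sum.swap)
  also have "\<dots> = (\<Sum>t\<in>T. g t * (cnj (\<Sum>i<n. ?d t i) * (\<Sum>j<n. ?d t j)))"
    unfolding cnj_sum sum_product by (simp only: sum_distrib_left)
  also have "\<dots> = (\<Sum>t\<in>T. g t * of_real ((norm (\<Sum>i<n. ?d t i))\<^sup>2))"
    unfolding complex_norm_square by (simp only: mult.commute)
  finally show ?thesis .
qed

lemma norm_sum_square_le:
  fixes a :: "'i \<Rightarrow> complex"
  assumes "finite J"
  shows "(norm (\<Sum>j\<in>J. a j))\<^sup>2 \<le> real (card J) * (\<Sum>j\<in>J. (norm (a j))\<^sup>2)"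
proof -
  have "(norm (\<Sum>j\<in>J. a j))\<^sup>2 \<le> (\<Sum>j\<in>J. norm (a j))\<^sup>2" by (intro power_mono norm_sum) simp
  also have "\<dots> \<le> real (card J) * (\<Sum>j\<in>J. (norm (a j))\<^sup>2)"
    using sum_squared_le_sum_of_squares[of "\<lambda>j. norm (a j)" J] by (simp add: mult.commute)
  finally show ?thesis .
qed

text \<open>The quadratic form of a positive semidefinite matrix is at most \<open>q\<close> times the sum of its values on \<open>q\<close> summands,
  so it suffices to make it small on each of \<open>q\<close> disjointly supported vectors.\<close>

lemma gcd_matrix_eigenvalue_bound:
  assumes g: "\<And>m. m > 0 \<Longrightarrow> h m = (\<Sum>t | t dvd m. g t)" "\<And>t i. t dvd x (Suc i) \<Longrightarrow> 0 \<le> g t"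
    and x: "\<And>i. x (Suc i) > (0::nat)" and q: "1 \<le> q" "q \<le> n" and E: "0 \<le> E"
    and eig: "ordered_eigenvalues (gcd_matrix h x n) l"
    and form: "\<And>j. j < q \<Longrightarrow> Re (cinner n (w j) (mat_app n (\<lambda>i j. h (gcd (x (Suc i)) (x (Suc j)))) (w j))) \<le> E"
    and ix: "\<And>j. j < q \<Longrightarrow> ix j < n" "\<And>j. j < q \<Longrightarrow> w j (ix j) = 1" "\<And>j k. j < q \<Longrightarrow> k < q \<Longrightarrow> j \<noteq> k \<Longrightarrow> w k (ix j) = 0"
  shows "0 \<le> l q" "l q \<le> real q * E"
proof -
  let ?A = "gcd_matrix h x n" and ?H = "\<lambda>i j. h (gcd (x (Suc i)) (x (Suc j)))"
  let ?T = "{t. \<exists>i<n. t dvd x (Suc i)}"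
  let ?lf = "\<lambda>t v. \<Sum>i<n. if t dvd x (Suc i) then v i else 0"
  have A: "?A \<in> carrier_mat n n" by (simp add: gcd_matrix_def)
  have Ae: "?A $$ (i, j) = ?H i j" if "i < n" "j < n" for i j using that by (simp add: gcd_matrix_def)
  have mat_app: "mat_app n (\<lambda>i j. ?A $$ (i, j)) v = mat_app n ?H v" for v
    unfolding mat_app_def using Ae by (intro ext) (auto intro!: sum.cong)
  have g_real: "g t = of_real (Re (g t))" "0 \<le> Re (g t)" if "t dvd x (Suc i)" for t i
    using g(2)[OF that] by (auto simp: less_eq_complex_def complex_eq_iff)
  have hreal: "cnj (?H i j) = ?H i j" for i j
  proof -
    have "?H i j = (\<Sum>t | t dvd gcd (x (Suc i)) (x (Suc j)). g t)" using x[of i] by (intro g(1)) simp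
    moreover have "cnj (g t) = g t" if "t dvd gcd (x (Suc i)) (x (Suc j))" for t
      using g_real(1)[of t i] that by (metis complex_cnj_complex_of_real gcd_nat.boundedE)
    ultimately show ?thesis by simp
  qed
  have Q: "Re (cinner n v (mat_app n ?H v)) = (\<Sum>t\<in>?T. Re (g t) * (norm (?lf t v))\<^sup>2)" for v
  proof -
    have "cinner n v (mat_app n ?H v) = (\<Sum>t\<in>?T. g t * of_real ((norm (?lf t v))\<^sup>2))"
      by (rule gcd_form[where g = g]) (rule g(1) x; assumption?)+
    then show ?thesis by (simp only: Re_sum times_complex.sel Re_complex_of_real Im_complex_of_real mult_zero_right diff_zero)
  qed
  have herm: "?A $$ (j, i) = cnj (?A $$ (i, j))" if "i < n" "j < n" for i j
    using Ae that hreal[of i j] by (simp add: gcd.commute)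
  have psd: "0 \<le> Re (cinner n v (mat_app n (\<lambda>i j. ?A $$ (i, j)) v))" for v
    unfolding mat_app Q using g_real(2) by (intro sum_nonneg mult_nonneg_nonneg) auto
  \<comment> \<open>At \<open>ix j\<close> only \<open>w j\<close> is nonzero, so the coefficients
    are values of v: they are bounded by its norm and vanish with it.\<close>
  have vix: "(\<Sum>k<q. c k * w k (ix j)) = c j" if j: "j < q" for c j
  proof -
    have "(\<Sum>k<q. c k * w k (ix j)) = (\<Sum>k\<in>{j}. c k * w k (ix j))"
      using j ix(3) by (intro sum.mono_neutral_right) auto
    then show ?thesis using ix(2)[OF j] by simp
  qed
  have test: "Re (cinner n v (mat_app n (\<lambda>i j. ?A $$ (i, j)) v)) \<le> real q * E * Re (cinner n v v)"
    if v: "v = (\<lambda>i. \<Sum>j<q. c j * w j i)" for c v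
  proof -
    have l: "?lf t v = (\<Sum>j<q. c j * ?lf t (w j))" for t
    proof -
      have "?lf t v = (\<Sum>i<n. \<Sum>j<q. c j * (if t dvd x (Suc i) then w j i else 0))"
        unfolding v by (intro sum.cong refl) simp
      also have "\<dots> = (\<Sum>j<q. \<Sum>i<n. c j * (if t dvd x (Suc i) then w j i else 0))" by (rule sum.swap)
      finally show ?thesis by (simp only: sum_distrib_left)
    qed
    have "Re (cinner n v (mat_app n ?H v)) \<le> (\<Sum>t\<in>?T. Re (g t) * (real q * (\<Sum>j<q. (norm (c j))\<^sup>2 * (norm (?lf t (w j)))\<^sup>2)))"
      unfolding Q
    proof (intro sum_mono mult_left_mono)
      fix t assume "t \<in> ?T"
      then show "0 \<le> Re (g t)" using g_real(2) by auto
      show "(norm (?lf t v))\<^sup>2 \<le> real q * (\<Sum>j<q. (norm (c j))\<^sup>2 * (norm (?lf t (w j)))\<^sup>2)"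
        unfolding l using norm_sum_square_le[of "{..<q}" "\<lambda>j. c j * ?lf t (w j)"] by (simp add: norm_mult power_mult_distrib)
    qed
    also have "\<dots> = real q * (\<Sum>t\<in>?T. \<Sum>j<q. (norm (c j))\<^sup>2 * (Re (g t) * (norm (?lf t (w j)))\<^sup>2))"
      unfolding sum_distrib_left by (intro sum.cong refl) (simp only: mult_ac)
    also have "(\<Sum>t\<in>?T. \<Sum>j<q. (norm (c j))\<^sup>2 * (Re (g t) * (norm (?lf t (w j)))\<^sup>2)) =
        (\<Sum>j<q. \<Sum>t\<in>?T. (norm (c j))\<^sup>2 * (Re (g t) * (norm (?lf t (w j)))\<^sup>2))" by (rule sum.swap)
    also have "\<dots> = (\<Sum>j<q. (norm (c j))\<^sup>2 * Re (cinner n (w j) (mat_app n ?H (w j))))"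
      unfolding Q sum_distrib_left ..
    also have "\<dots> \<le> (\<Sum>j<q. (norm (c j))\<^sup>2 * E)" using form by (intro sum_mono mult_left_mono) auto
    also have "\<dots> = (\<Sum>j<q. (norm (v (ix j)))\<^sup>2) * E"
      unfolding sum_distrib_right v using vix by (intro sum.cong refl) simp
    also have "(\<Sum>j<q. (norm (v (ix j)))\<^sup>2) = (\<Sum>i\<in>ix ` {..<q}. (norm (v i))\<^sup>2)"
    proof (rule sum.reindex_cong[symmetric, OF _ refl])
      show "inj_on ix {..<q}"
        by (rule inj_onI) (metis ix(2,3) lessThan_iff zero_neq_one)
    qed simp
    also have "\<dots> \<le> Re (cinner n v v)" unfolding cinner_self Re_complex_of_real using ix(1) by (intro sum_mono2) auto
    finally show ?thesis unfolding mat_app using E by (simp add: mult_left_mono mult_right_mono mult_ac)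
  qed
  have indep: "\<forall>j<q. c j = 0" if z: "\<forall>i<n. (\<Sum>j<q. c j * w j i) = 0" for c
    using vix[of _ c] z ix(1) by metis
  show "0 \<le> l q" "l q \<le> real q * E"
    by (rule ordered_eigenvalue_bounds[OF A herm eig q psd test indep]; assumption)+
qed

section \<open>Dirichlet characters\<close>

definition dirichlet_char :: "nat \<Rightarrow> (nat \<Rightarrow> complex) \<Rightarrow> bool" where
  "dirichlet_char b \<psi> \<longleftrightarrow> (\<forall>m n. \<psi> (m * n) = \<psi> m * \<psi> n) \<and>
     (\<forall>m n. [m = n] (mod b) \<longrightarrow> \<psi> m = \<psi> n) \<and> (\<forall>n. \<psi> n \<noteq> 0 \<longleftrightarrow> coprime n b)"

text \<open>A character on a subgroup of the units modulo b, where \<open>H\<close> is the set of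
  all naturals in the residue classes of the subgroup.\<close>

definition partial_char :: "nat \<Rightarrow> nat set \<Rightarrow> (nat \<Rightarrow> complex) \<Rightarrow> bool" where
  "partial_char b H \<psi> \<longleftrightarrow> 1 \<in> H \<and> (\<forall>m\<in>H. coprime m b \<and> \<psi> m \<noteq> 0) \<and>
     (\<forall>m\<in>H. \<forall>n\<in>H. m * n \<in> H \<and> \<psi> (m * n) = \<psi> m * \<psi> n) \<and>
     (\<forall>m\<in>H. \<forall>n. [m = n] (mod b) \<longrightarrow> n \<in> H \<and> \<psi> n = \<psi> m)"

lemma partial_charD:
  assumes "partial_char b H \<psi>"
  shows "1 \<in> H" "m \<in> H \<Longrightarrow> coprime m b" "m \<in> H \<Longrightarrow> \<psi> m \<noteq> 0"
    "m \<in> H \<Longrightarrow> n \<in> H \<Longrightarrow> m * n \<in> H" "m \<in> H \<Longrightarrow> n \<in> H \<Longrightarrow> \<psi> (m * n) = \<psi> m * \<psi> n"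
    "m \<in> H \<Longrightarrow> [m = n] (mod b) \<Longrightarrow> n \<in> H" "m \<in> H \<Longrightarrow> [m = n] (mod b) \<Longrightarrow> \<psi> n = \<psi> m"
  using assms unfolding partial_char_def by blast+

lemma partial_char_1: "partial_char b H \<psi> \<Longrightarrow> \<psi> 1 = 1"
  using partial_charD(1)[of b H \<psi>] partial_charD(3,5)[of b H \<psi> 1] by fastforce

lemma partial_char_power:
  assumes "partial_char b H \<psi>" "u \<in> H"
  shows "u ^ k \<in> H \<and> \<psi> (u ^ k) = \<psi> u ^ k"
  using partial_charD(1,4,5)[OF assms(1)] partial_char_1[OF assms(1)] assms(2)
  by (induction k) auto

text \<open>By Euler's theorem u^(totient b - 1), which lies in \<open>H\<close> as a power of u,
  inverts u modulo b.\<close>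

lemma partial_char_cancel:
  assumes "partial_char b H \<psi>" "b > 0" "u \<in> H" "u * v \<in> H"
  shows "v \<in> H"
proof -
  have "totient b > 0" using assms(2) by simp
  then have "u ^ (totient b - 1) * u = u ^ totient b" by (rule power_minus_mult)
  then have "[u ^ (totient b - 1) * (u * v) = u ^ totient b * v] (mod b)"
    by (simp add: mult.assoc[symmetric])
  also have "[u ^ totient b * v = 1 * v] (mod b)"
    by (intro cong_mult euler_theorem partial_charD(2)[OF assms(1,3)] cong_refl)
  finally show ?thesis
    using partial_charD(4,6)[OF assms(1)] partial_char_power[OF assms(1,3)] assms(4) by (metis mult_1)
qed

text \<open>Here m is the order of x modulo the subgroup. Sending h x^k to
  \<open>\<psi> h * z ^ k\<close> is well defined because z is an m-th root of
  \<open>\<psi> (x ^ m)\<close>. Any such root may be prescribed, which later separates x from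
  1.\<close>

lemma partial_char_extend:
  assumes P: "partial_char b H \<psi>" and b: "b > 0" and x: "coprime x b"
    and m: "m > 0" "x ^ m \<in> H" "\<And>j. 0 < j \<Longrightarrow> j < m \<Longrightarrow> x ^ j \<notin> H" and z: "z ^ m = \<psi> (x ^ m)"
  shows "\<exists>H' \<psi>'. partial_char b H' \<psi>' \<and> H \<subseteq> H' \<and> x \<in> H' \<and> \<psi>' x = z \<and> (\<forall>n\<in>H. \<psi>' n = \<psi> n)"
proof -
  note D = partial_charD[OF P]
  \<comment> \<open>The remainder of j modulo m is again an exponent with its power in
    \<open>H\<close>, so minimality makes m divide j.\<close>
  have A: "\<psi> (x ^ j) = z ^ j" if "x ^ j \<in> H" for j
  proof -
    have e: "x ^ j = (x ^ m) ^ (j div m) * x ^ (j mod m)"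
      by (metis mult_div_mod_eq power_add power_mult)
    have "x ^ (j mod m) \<in> H"
      using partial_char_cancel[OF P b] partial_char_power[OF P m(2)] that e by metis
    then have "j mod m = 0" using m by (metis gr0I mod_less_divisor)
    then have "j = m * (j div m)" by auto
    then show ?thesis using partial_char_power[OF P m(2)] z by (metis power_mult)
  qed
  \<comment> \<open>Independence of the representation for k \<le> l: cancel x^k and use the
    preceding fact for the exponent l - k. The general case follows by symmetry.\<close>
  have B: "\<psi> h * z ^ k = \<psi> h' * z ^ l"
    if "h \<in> H" "h' \<in> H" "[h * x ^ k = h' * x ^ l] (mod b)" "k \<le> l" for h h' k l
  proof -
    have "[h * x ^ k = (h' * x ^ (l - k)) * x ^ k] (mod b)"
      using that(3,4) by (simp add: mult.assoc flip: power_add)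
    then have c: "[h = h' * x ^ (l - k)] (mod b)"
      using x by (metis cong_mult_rcancel_nat coprime_power_left_iff)
    then have H: "h' * x ^ (l - k) \<in> H" using D(6) that(1) by blast
    then have H2: "x ^ (l - k) \<in> H" using partial_char_cancel[OF P b that(2)] by blast
    have "\<psi> h = \<psi> h' * z ^ (l - k)" using D(7)[OF that(1) c] D(5)[OF that(2) H2] A[OF H2] by simp
    then show ?thesis using that(4) by (simp add: mult.assoc flip: power_add)
  qed
  have B: "\<psi> h * z ^ k = \<psi> h' * z ^ l"
    if "h \<in> H" "h' \<in> H" "[h * x ^ k = h' * x ^ l] (mod b)" for h h' k l
    using B[of h h' k l] B[of h' h l k] that by (metis cong_sym nat_le_linear)
  define H' where "H' = {n. \<exists>h\<in>H. \<exists>k. [n = h * x ^ k] (mod b)}"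
  define \<psi>' where "\<psi>' n = (SOME w. \<exists>h\<in>H. \<exists>k. [n = h * x ^ k] (mod b) \<and> w = \<psi> h * z ^ k)" for n
  have C: "\<psi>' n = \<psi> h * z ^ k" if "h \<in> H" "[n = h * x ^ k] (mod b)" for n h k
  proof -
    have "\<exists>w. \<exists>h\<in>H. \<exists>k. [n = h * x ^ k] (mod b) \<and> w = \<psi> h * z ^ k" using that by blast
    from someI_ex[OF this] obtain h' k' where
      "h' \<in> H" "[n = h' * x ^ k'] (mod b)" "\<psi>' n = \<psi> h' * z ^ k'" unfolding \<psi>'_def by auto
    then show ?thesis using B that by (metis cong_sym cong_trans)
  qed
  have "partial_char b H' \<psi>'"
    unfolding partial_char_def
  proof (intro conjI ballI allI impI)
    show "1 \<in> H'" unfolding H'_def using D(1) by (auto intro!: bexI[of _ 1] exI[of _ 0])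
  next
    fix n assume "n \<in> H'"
    then obtain h k where hk: "h \<in> H" "[n = h * x ^ k] (mod b)" unfolding H'_def by auto
    then show "coprime n b" using D(2)[OF hk(1)] x
      by (metis cong_imp_coprime cong_sym coprime_mult_left_iff coprime_power_left_iff)
    have "z \<noteq> 0" using z m(1,2) D(3) by (metis zero_power)
    then show "\<psi>' n \<noteq> 0" using C[OF hk] D(3)[OF hk(1)] by simp
  next
    fix n1 n2 assume "n1 \<in> H'" "n2 \<in> H'"
    then obtain h k h' k' where hk: "h \<in> H" "[n1 = h * x ^ k] (mod b)"
      "h' \<in> H" "[n2 = h' * x ^ k'] (mod b)" unfolding H'_def by auto
    have c: "[n1 * n2 = (h * h') * x ^ (k + k')] (mod b)"
      using cong_mult[OF hk(2,4)] by (simp add: power_add mult_ac)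
    then show "n1 * n2 \<in> H'" unfolding H'_def using D(4)[OF hk(1,3)] by blast
    show "\<psi>' (n1 * n2) = \<psi>' n1 * \<psi>' n2"
      using C[OF D(4)[OF hk(1,3)] c] C[OF hk(1,2)] C[OF hk(3,4)] D(5)[OF hk(1,3)]
      by (simp add: power_add)
  next
    fix n1 n2 assume a: "n1 \<in> H'" "[n1 = n2] (mod b)"
    then obtain h k where hk: "h \<in> H" "[n1 = h * x ^ k] (mod b)" unfolding H'_def by auto
    have c: "[n2 = h * x ^ k] (mod b)" using hk(2) a(2) by (metis cong_sym cong_trans)
    then show "n2 \<in> H'" unfolding H'_def using hk by blast
    show "\<psi>' n2 = \<psi>' n1" using C[OF hk] C[OF hk(1) c] by simp
  qed
  moreover have "H \<subseteq> H'" unfolding H'_def by (auto intro!: exI[of _ 0] bexI)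
  moreover have "x \<in> H'" unfolding H'_def using D(1) by (auto intro!: bexI[of _ 1] exI[of _ 1])
  moreover have "\<psi>' x = z" using C[of 1 x 1] D(1) partial_char_1[OF P] by simp
  moreover have "\<psi>' n = \<psi> n" if "n \<in> H" for n using C[OF that, of n 0] by simp
  ultimately show ?thesis by blast
qed

lemma least_power_in:
  assumes P: "partial_char b H \<psi>" and b: "b > 0" and x: "coprime x b"
  shows "\<exists>m>0. x ^ m \<in> H \<and> (\<forall>j. 0 < j \<longrightarrow> j < m \<longrightarrow> x ^ j \<notin> H)"
proof -
  have "x ^ totient b \<in> H" "totient b > 0"
    using euler_theorem[OF x] partial_charD(1,6)[OF P] b by (auto simp: cong_sym_eq)
  then have ex: "\<exists>m. m > 0 \<and> x ^ m \<in> H" by blast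
  define m where "m = (LEAST m. m > 0 \<and> x ^ m \<in> H)"
  have "m > 0 \<and> x ^ m \<in> H" unfolding m_def by (rule LeastI_ex[OF ex])
  moreover have "x ^ j \<notin> H" if "0 < j" "j < m" for j
    using not_less_Least[of j "\<lambda>m. m > 0 \<and> x ^ m \<in> H"] that unfolding m_def by simp
  ultimately show ?thesis by (intro exI[of _ m]) simp
qed

text \<open>Induction on the number of unit classes outside \<open>H\<close>: adjoining a missing x
  lowers it, and the complex logarithm supplies the root needed. Once \<open>H\<close> contains all
  units, the value 0 elsewhere completes the character.\<close>

lemma partial_char_total:
  assumes "partial_char b H \<psi>" "b > 0"
  shows "\<exists>\<theta>. dirichlet_char b \<theta> \<and> (\<forall>n\<in>H. \<theta> n = \<psi> n)"
  using assms
proof (induction "card {n. n < b \<and> coprime n b \<and> n \<notin> H}" arbitrary: H \<psi> rule: less_induct)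
  case less
  note D = partial_charD[OF less.prems(1)]
  show ?case
  proof (cases "\<exists>x. coprime x b \<and> x \<notin> H")
    case True
    then obtain x where x: "coprime x b" "x \<notin> H" by blast
    obtain m where m: "m > 0" "x ^ m \<in> H" "\<And>j. 0 < j \<Longrightarrow> j < m \<Longrightarrow> x ^ j \<notin> H"
      using least_power_in[OF less.prems x(1)] by metis
    define w where "w = exp (Ln (\<psi> (x ^ m)) / of_nat m)"
    have "w ^ m = \<psi> (x ^ m)"
      unfolding w_def using m(1) D(3)[OF m(2)] by (simp flip: exp_of_nat_mult)
    from partial_char_extend[OF less.prems x(1) m this] obtain H' \<psi>' where
      H': "partial_char b H' \<psi>'" "H \<subseteq> H'" "x \<in> H'" "\<forall>n\<in>H. \<psi>' n = \<psi> n" by blast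
    have "x mod b \<in> H'" using partial_charD(6)[OF H'(1,3)] by (simp add: cong_def)
    moreover have "x mod b \<notin> H" using D(6)[of "x mod b" x] x(2) by (auto simp: cong_def)
    moreover have "coprime (x mod b) b" using x(1) less.prems(2) by simp
    ultimately have "{n. n < b \<and> coprime n b \<and> n \<notin> H'} \<subset> {n. n < b \<and> coprime n b \<and> n \<notin> H}"
      using H'(2) mod_less_divisor[OF less.prems(2), of x] by blast
    then have "card {n. n < b \<and> coprime n b \<and> n \<notin> H'} < card {n. n < b \<and> coprime n b \<and> n \<notin> H}"
      by (intro psubset_card_mono) auto
    from less.hyps[OF this H'(1) less.prems(2)] show ?thesis using H'(2,4) by (metis subsetD)
  next
    case False
    then have H: "n \<in> H \<longleftrightarrow> coprime n b" for n using D(2) by blast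
    have "dirichlet_char b (\<lambda>n. if n \<in> H then \<psi> n else 0)"
      unfolding dirichlet_char_def
    proof (intro conjI allI impI)
      fix m n
      show "(if m * n \<in> H then \<psi> (m * n) else 0) = (if m \<in> H then \<psi> m else 0) * (if n \<in> H then \<psi> n else 0)"
        using D(4,5)[of m n] H by auto
    next
      fix m n :: nat assume "[m = n] (mod b)"
      then show "(if m \<in> H then \<psi> m else 0) = (if n \<in> H then \<psi> n else 0)"
        using D(6,7)[of m n] D(6)[of n m] by (auto simp: cong_sym_eq)
    qed (use D(3) H in auto)
    then show ?thesis by (intro exI[of _ "\<lambda>n. if n \<in> H then \<psi> n else 0"]) auto
  qed
qed

text \<open>Extend the trivial character of the class of 1. The order m of x exceeds 1, so an m-th
  root of unity other than 1 is available as the value at x.\<close>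

lemma dirichlet_char_separates:
  assumes "b > 0" "coprime x b" "\<not> [x = 1] (mod b)"
  obtains \<psi> where "dirichlet_char b \<psi>" "\<psi> x \<noteq> 1"
proof -
  let ?H = "{n. [n = 1] (mod b)}"
  have P: "partial_char b ?H (\<lambda>_. 1)"
    unfolding partial_char_def
  proof (intro conjI ballI allI impI; (elim CollectE)?; (intro CollectI)?)
    fix m n :: nat assume "[m = 1] (mod b)" "[n = 1] (mod b)"
    then show "[m * n = 1] (mod b)" using cong_mult by fastforce
  next
    fix m n :: nat assume a: "[m = 1] (mod b)" "[m = n] (mod b)"
    show "[n = 1] (mod b)" by (rule cong_trans[OF cong_sym[OF a(2)] a(1)])
  next
    fix m :: nat assume a: "[m = 1] (mod b)"
    show "coprime m b" by (rule cong_imp_coprime[OF cong_sym[OF a]]) simp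
  qed simp_all
  obtain m where m: "m > 0" "x ^ m \<in> ?H" "\<And>j. 0 < j \<Longrightarrow> j < m \<Longrightarrow> x ^ j \<notin> ?H"
    using least_power_in[OF P assms(1,2)] by metis
  have "m \<noteq> 1" using m(2) assms(3) by auto
  then have "card {z::complex. z ^ m = 1} \<ge> 2" using m(1) card_roots_unity_eq[of m] by simp
  then have "\<not> {z::complex. z ^ m = 1} \<subseteq> {1}"
    using card_mono[of "{1::complex}" "{z::complex. z ^ m = 1}"] by auto
  then obtain z :: complex where z: "z ^ m = 1" "z \<noteq> 1" by blast
  from partial_char_extend[OF P assms(1,2) m z(1)] obtain H' \<psi>' where
    H': "partial_char b H' \<psi>'" "x \<in> H'" "\<psi>' x = z" by blast
  obtain \<phi> where "dirichlet_char b \<phi>" "\<forall>n\<in>H'. \<phi> n = \<psi>' n"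
    using partial_char_total[OF H'(1) assms(1)] by blast
  then show thesis using that[of \<phi>] H'(2,3) z(2) by simp
qed

section \<open>Values and orthogonality of characters, and products over all characters\<close>

lemma dirichlet_charD:
  assumes "dirichlet_char b \<psi>"
  shows "\<psi> (m * n) = \<psi> m * \<psi> n" "[m = n] (mod b) \<Longrightarrow> \<psi> m = \<psi> n" "\<psi> n \<noteq> 0 \<longleftrightarrow> coprime n b"
    "\<psi> (Suc 0) = 1" "\<psi> (n ^ k) = \<psi> n ^ k"
proof -
  show *: "\<psi> (m * n) = \<psi> m * \<psi> n" for m n using assms unfolding dirichlet_char_def by blast
  show "[m = n] (mod b) \<Longrightarrow> \<psi> m = \<psi> n" using assms unfolding dirichlet_char_def by blast
  show nz: "\<psi> n \<noteq> 0 \<longleftrightarrow> coprime n b" for n using assms unfolding dirichlet_char_def by blast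
  have "\<psi> 1 = \<psi> 1 * \<psi> 1" "\<psi> 1 \<noteq> 0" using *[of 1 1] nz[of 1] by simp_all
  then show 1: "\<psi> (Suc 0) = 1" by simp
  show "\<psi> (n ^ k) = \<psi> n ^ k" using * 1 by (induction k) simp_all
qed

lemma dirichlet_char_root:
  assumes "dirichlet_char b \<psi>" "coprime n b"
  shows "\<psi> n ^ totient b = 1"
  using dirichlet_charD(2)[OF assms(1) euler_theorem[OF assms(2)]] dirichlet_charD(4,5)[OF assms(1)] by simp

lemma dirichlet_char_norm_le:
  assumes "dirichlet_char b \<psi>" "b > 0"
  shows "norm (\<psi> n) \<le> 1"
proof (cases "coprime n b")
  case True
  have "norm (\<psi> n) ^ totient b = 1 ^ totient b"
    using dirichlet_char_root[OF assms(1) True] by (metis norm_one norm_power power_one)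
  moreover have "totient b > 0" using assms(2) by simp
  ultimately have "norm (\<psi> n) = 1" using power_eq_imp_eq_base[of "norm (\<psi> n)" "totient b" 1] by simp
  then show ?thesis by simp
next
  case False
  then show ?thesis using dirichlet_charD(3)[OF assms(1), of n] by simp
qed

text \<open>A character is determined by its values below b, each of which is 0 or a root of unity
  of order dividing \<open>totient b\<close>.\<close>

lemma finite_dirichlet_char:
  assumes "b > 0"
  shows "finite {\<psi>. dirichlet_char b \<psi>}"
proof (rule finite_imageD)
  let ?g = "\<lambda>\<psi>. restrict \<psi> {..<b}"
  have "totient b > 0" using assms by simp
  then have fin: "finite (insert 0 {z::complex. z ^ totient b = 1})" by (simp add: finite_roots_unity Suc_leI)
  have "\<psi> n \<in> insert 0 {z. z ^ totient b = 1}" if "dirichlet_char b \<psi>" for \<psi> n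
    using dirichlet_char_root[OF that, of n] dirichlet_charD(3)[OF that, of n] by auto
  then have "?g ` {\<psi>. dirichlet_char b \<psi>} \<subseteq> {..<b} \<rightarrow>\<^sub>E insert 0 {z. z ^ totient b = 1}"
    by (intro image_subsetI restrict_PiE_iff[THEN iffD2]) blast
  then show "finite (?g ` {\<psi>. dirichlet_char b \<psi>})"
    using finite_PiE[of "{..<b}" "\<lambda>_. insert 0 {z::complex. z ^ totient b = 1}"] fin
    by (metis finite_lessThan finite_subset)
  show "inj_on ?g {\<psi>. dirichlet_char b \<psi>}"
  proof (rule inj_onI, rule ext)
    fix \<psi> \<phi> n assume a: "\<psi> \<in> {\<psi>. dirichlet_char b \<psi>}" "\<phi> \<in> {\<psi>. dirichlet_char b \<psi>}" "?g \<psi> = ?g \<phi>"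
    then have "\<psi> (n mod b) = \<phi> (n mod b)" using assms by (metis lessThan_iff mod_less_divisor restrict_apply')
    moreover have "\<psi> n = \<psi> (n mod b)" "\<phi> n = \<phi> (n mod b)"
      using a(1,2) dirichlet_charD(2)[of b _ n "n mod b"] by (simp_all add: cong_def)
    ultimately show "\<psi> n = \<phi> n" by simp
  qed
qed

definition principal_char :: "nat \<Rightarrow> nat \<Rightarrow> complex" where
  "principal_char b n = (if coprime n b then 1 else 0)"

lemma dirichlet_char_principal: "dirichlet_char b (principal_char b)"
  unfolding dirichlet_char_def principal_char_def
  by (auto simp: coprime_mult_left_iff dest: cong_imp_coprime cong_sym)

lemma dirichlet_char_mult: "dirichlet_char b \<psi> \<Longrightarrow> dirichlet_char b \<phi> \<Longrightarrow> dirichlet_char b (\<lambda>n. \<psi> n * \<phi> n)"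
  unfolding dirichlet_char_def by simp

lemma dirichlet_char_cnj: "dirichlet_char b \<psi> \<Longrightarrow> dirichlet_char b (\<lambda>n. cnj (\<psi> n))"
  unfolding dirichlet_char_def by simp

lemma dirichlet_char_cnj_mult:
  assumes "dirichlet_char b \<psi>" "b > 0" "coprime n b"
  shows "\<psi> n * cnj (\<psi> n) = 1"
proof -
  have "norm (\<psi> n) ^ totient b = 1 ^ totient b"
    using dirichlet_char_root[OF assms(1,3)] by (metis norm_one norm_power power_one)
  moreover have "totient b > 0" using assms(2) by simp
  ultimately have "norm (\<psi> n) = 1" using power_eq_imp_eq_base[of "norm (\<psi> n)" "totient b" 1] by simp
  then show ?thesis by (simp add: complex_norm_square[symmetric])
qed

lemma mult_mod_bij:
  assumes "coprime x b" "(b::nat) > 0"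
  shows "bij_betw (\<lambda>n. x * n mod b) {..<b} {..<b}"
proof -
  have inj: "inj_on (\<lambda>n. x * n mod b) {..<b}"
  proof (rule inj_onI)
    fix m n assume "m \<in> {..<b}" "n \<in> {..<b}" "x * m mod b = x * n mod b"
    then show "m = n" using assms(1)
      by (metis cong_def cong_mult_lcancel_nat lessThan_iff mod_less)
  qed
  moreover have "(\<lambda>n. x * n mod b) ` {..<b} \<subseteq> {..<b}" using assms(2) by auto
  ultimately show ?thesis by (metis bij_betw_def endo_inj_surj finite_lessThan)
qed

text \<open>For a unit x with \<open>\<psi> x\<close> different from 1, multiplication by x permutes
  the residues but scales the sum by \<open>\<psi> x\<close>.\<close>

lemma dirichlet_char_sum_zero:
  assumes "dirichlet_char b \<psi>" "b > 0" "\<psi> \<noteq> principal_char b"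
  shows "(\<Sum>n<b. \<psi> n) = 0"
proof -
  obtain x where x: "\<psi> x \<noteq> principal_char b x" using assms(3) by blast
  then have cop: "coprime x b" and x1: "\<psi> x \<noteq> 1"
    using dirichlet_charD(3)[OF assms(1), of x] by (auto simp: principal_char_def split: if_splits)
  have "(\<Sum>n<b. \<psi> n) = (\<Sum>n<b. \<psi> (x * n mod b))"
    by (rule sum.reindex_bij_betw[OF mult_mod_bij[OF cop assms(2)], symmetric])
  also have "\<dots> = (\<Sum>n<b. \<psi> x * \<psi> n)"
    using dirichlet_charD(1)[OF assms(1)] dirichlet_charD(2)[OF assms(1), of "x * n mod b" "x * n" for n]
    by (simp add: cong_def)
  also have "\<dots> = \<psi> x * (\<Sum>n<b. \<psi> n)" by (simp add: sum_distrib_left)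
  finally show ?thesis using x1 by simp
qed

text \<open>As polynomials in u the two sides differ by one of degree at most d that vanishes at d +
  1 points, namely 0 and the d-th roots of unity.\<close>

lemma prod_roots_of_unity:
  fixes u :: complex
  assumes "d > 0"
  shows "(\<Prod>z | z ^ d = 1. 1 - z * u) = 1 - u ^ d"
proof -
  let ?I = "{z::complex. z ^ d = 1}"
  have fin: "finite ?I" and card: "card ?I = d" using assms by (simp_all add: finite_roots_unity card_roots_unity_eq Suc_leI)
  define P where "P = (\<Prod>z\<in>?I. [:1, -z:]) - (1 - Polynomial.monom 1 d)"
  have pP: "poly P v = (\<Prod>z\<in>?I. 1 - z * v) - (1 - v ^ d)" for v
    unfolding P_def by (simp add: poly_prod poly_monom mult.commute)
  have "P = 0"
  proof (rule ccontr)
    assume "P \<noteq> 0"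
    have "degree [:1, -z:] \<le> 1" for z :: complex by simp
    then have "sum (degree \<circ> (\<lambda>z. [:1, -z:])) ?I \<le> (\<Sum>z\<in>?I. 1)" by (intro sum_mono) simp
    then have "degree (\<Prod>z\<in>?I. [:1, -z:]) \<le> (\<Sum>z\<in>?I. 1)"
      using degree_prod_sum_le[OF fin] order.trans by blast
    moreover have "degree (1 - Polynomial.monom (1::complex) d) \<le> d"
      by (intro degree_diff_le) (simp_all add: degree_monom_eq)
    ultimately have deg: "degree P \<le> d" unfolding P_def using card by (intro degree_diff_le[OF _ \<open>degree (1 - Polynomial.monom 1 d) \<le> d\<close>]) simp
    have "insert 0 ?I \<subseteq> {v. poly P v = 0}"
    proof
      fix v assume "v \<in> insert 0 ?I"
      then show "v \<in> {v. poly P v = 0}"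
      proof
        assume v: "v \<in> ?I"
        then have nz: "v \<noteq> 0" using assms by (auto simp: zero_power)
        have "inverse v \<in> ?I" using v by (simp add: power_inverse)
        then have "(\<Prod>z\<in>?I. 1 - z * v) = 0"
          using fin nz by (intro prod_zero bexI[of _ "inverse v"]) simp_all
        then show ?thesis using v pP by simp
      qed (use assms pP in \<open>simp add: zero_power\<close>)
    qed
    then have "card (insert 0 ?I) \<le> card {v. poly P v = 0}"
      using poly_roots_finite[OF \<open>P \<noteq> 0\<close>] by (rule card_mono[rotated])
    also have "\<dots> \<le> d" using card_poly_roots_bound[OF \<open>P \<noteq> 0\<close>] deg by simp
    finally show False using fin card assms by (simp add: zero_power)
  qed
  then show ?thesis using pP[of u] by simp
qed

text \<open>The values at p of all characters form a finite group, hence are the f-th roots of unity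
  with f their number; multiplication by a character identifies the fibres, all of size r. Since
  characters separate p from 1, f = 1 exactly when p is 1 modulo b.\<close>

lemma dirichlet_char_prod:
  assumes b: "b > 0" and p: "coprime p b"
  shows "\<exists>f r. f > 0 \<and> r > 0 \<and> f * r = card {\<psi>. dirichlet_char b \<psi>} \<and> (f = 1 \<longleftrightarrow> [p = 1] (mod b)) \<and>
    (\<forall>u. (\<Prod>\<psi> | dirichlet_char b \<psi>. 1 - \<psi> p * u) = (1 - u ^ f) ^ r)"
proof -
  let ?X = "{\<psi>. dirichlet_char b \<psi>}"
  note fin = finite_dirichlet_char[OF b]
  define I where "I = (\<lambda>\<psi>. \<psi> p) ` ?X"
  define r where "r = card {\<psi>\<in>?X. \<psi> p = 1}"
  have finI: "finite I" unfolding I_def using fin by simp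
  have one: "1 \<in> I" unfolding I_def using dirichlet_char_principal[of b] p
    by (auto simp: principal_char_def intro!: image_eqI[of _ _ "principal_char b"])
  define d where "d = card I"
  have d: "d > 0" unfolding d_def using finI one by (auto simp: card_gt_0_iff)
  have nz: "z \<noteq> 0" if "z \<in> I" for z using that dirichlet_charD(3) p unfolding I_def by auto
  \<comment> \<open>Multiplication by z permutes \<open>I\<close>; comparing the products over
    \<open>I\<close> gives the claim.\<close>
  have "z ^ d = 1" if z: "z \<in> I" for z
  proof -
    have "(*) z ` I \<subseteq> I"
      using z unfolding I_def by (auto intro!: image_eqI[OF _ CollectI] dest: dirichlet_char_mult)
    then have "(*) z ` I = I"
      using nz[OF z] finI by (intro endo_inj_surj) (auto intro: inj_onI)
    then have "bij_betw ((*) z) I I" using nz[OF z] by (auto simp: bij_betw_def intro: inj_onI)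
    from prod.reindex_bij_betw[OF this, of "\<lambda>x. x"] have "(\<Prod>x\<in>I. z * x) = (\<Prod>x\<in>I. x)" .
    then have "z ^ d * (\<Prod>x\<in>I. x) = (\<Prod>x\<in>I. x)" unfolding d_def by (simp add: prod.distrib)
    moreover have "(\<Prod>x\<in>I. x) \<noteq> 0" using nz finI by simp
    ultimately show ?thesis by simp
  qed
  then have "I \<subseteq> {z. z ^ d = 1}" by blast
  then have I: "I = {z. z ^ d = 1}"
    using d by (intro card_subset_eq) (simp_all add: finite_roots_unity card_roots_unity_eq Suc_leI flip: d_def)
  have fib: "card {\<psi>\<in>?X. \<psi> p = z} = r" if z: "z \<in> I" for z
  proof -
    obtain \<phi> where \<phi>: "dirichlet_char b \<phi>" "\<phi> p = z" using z unfolding I_def by auto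
    have inv: "cnj (\<phi> n) * (\<phi> n * \<psi> n) = \<psi> n" "\<phi> n * (cnj (\<phi> n) * \<psi> n) = \<psi> n" if "dirichlet_char b \<psi>" for \<psi> n
      using dirichlet_char_cnj_mult[OF \<phi>(1) b, of n] dirichlet_charD(3)[OF that, of n]
      by (cases "coprime n b"; simp add: mult.assoc[symmetric] mult.commute)+
    have "bij_betw (\<lambda>\<psi> n. \<phi> n * \<psi> n) {\<psi>\<in>?X. \<psi> p = 1} {\<psi>\<in>?X. \<psi> p = z}"
    proof (rule bij_betw_byWitness[where f' = "\<lambda>\<psi> n. cnj (\<phi> n) * \<psi> n"])
      show "(\<lambda>\<psi> n. cnj (\<phi> n) * \<psi> n) ` {\<psi>\<in>?X. \<psi> p = z} \<subseteq> {\<psi>\<in>?X. \<psi> p = 1}"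
        using \<phi> dirichlet_char_cnj_mult[OF \<phi>(1) b p] by (auto intro: dirichlet_char_mult dirichlet_char_cnj simp: mult.commute)
    qed (use inv \<phi> in \<open>auto intro: dirichlet_char_mult\<close>)
    from bij_betw_same_card[OF this] show ?thesis unfolding r_def by simp
  qed
  have r: "r > 0" unfolding r_def using fin dirichlet_char_principal[of b] p
    by (auto simp: card_gt_0_iff principal_char_def intro!: exI[of _ "principal_char b"])
  have "card ?X = (\<Sum>z\<in>I. card {\<psi>\<in>?X. \<psi> p = z})"
    using sum.image_gen[OF fin, of "\<lambda>_. 1::nat" "\<lambda>\<psi>. \<psi> p"] unfolding I_def by simp
  then have "d * r = card ?X" using fib by (simp add: d_def)
  moreover have "(\<Prod>\<psi>\<in>?X. 1 - \<psi> p * u) = (1 - u ^ d) ^ r" for u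
  proof -
    have "(\<Prod>\<psi>\<in>?X. 1 - \<psi> p * u) = (\<Prod>z\<in>I. \<Prod>\<psi>\<in>{\<psi>\<in>?X. \<psi> p = z}. 1 - \<psi> p * u)"
      unfolding I_def by (rule prod.image_gen[OF fin])
    also have "\<dots> = (\<Prod>z\<in>I. (1 - z * u) ^ r)" using fib by (intro prod.cong) simp_all
    also have "\<dots> = (1 - u ^ d) ^ r" unfolding I using prod_roots_of_unity[OF d] by (simp flip: prod_power_distrib)
    finally show ?thesis .
  qed
  moreover have "d = 1 \<longleftrightarrow> [p = 1] (mod b)"
  proof
    assume "d = 1"
    then have "\<psi> p = 1" if "dirichlet_char b \<psi>" for \<psi> using I that unfolding I_def by auto
    then show "[p = 1] (mod b)" using dirichlet_char_separates[OF b p] by blast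
  next
    assume "[p = 1] (mod b)"
    then have "I \<subseteq> {1}" unfolding I_def using dirichlet_charD(2,4) by fastforce
    then show "d = 1" unfolding d_def using one by (metis card_1_singleton_iff empty_iff subset_singletonD One_nat_def)
  qed
  ultimately show ?thesis using d r by (intro exI[of _ d] exI[of _ r]) simp
qed

section \<open>Analytic continuation of Dirichlet series\<close>

text \<open>The Dirichlet term n^(-s), written with exp to be visibly entire in s.\<close>

definition npow :: "nat \<Rightarrow> complex \<Rightarrow> complex" where
  "npow n s = exp (- s * of_real (ln (real n)))"

lemma npow_1 [simp]: "npow (Suc 0) s = 1" "npow 1 s = 1"
  by (simp_all add: npow_def)

lemma npow_mult: "m > 0 \<Longrightarrow> n > 0 \<Longrightarrow> npow (m * n) s = npow m s * npow n s"
  by (simp add: npow_def ln_mult ring_distribs flip: exp_add)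

lemma npow_power: "n > 0 \<Longrightarrow> npow n s ^ k = npow n (of_nat k * s)"
  by (simp add: npow_def mult_ac flip: exp_of_nat_mult)

lemma npow_of_real: "n > 0 \<Longrightarrow> npow n (of_real s) = of_real (real n powr (- s))"
  by (simp add: npow_def powr_def exp_of_real[symmetric])

lemma norm_npow: "n > 0 \<Longrightarrow> norm (npow n s) = real n powr (- Re s)"
  by (simp add: npow_def powr_def norm_exp_eq_Re)

lemma holomorphic_npow [holomorphic_intros]:
  "g holomorphic_on A \<Longrightarrow> (\<lambda>s. npow n (g s)) holomorphic_on A"
  unfolding npow_def by (intro holomorphic_intros)

text \<open>The derivative of exp (- z) has norm at most 1 on the convex half plane Re z \<ge>
  0.\<close>

lemma norm_one_minus_exp_le:
  assumes "Re w \<ge> 0"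
  shows "norm (1 - exp (- w)) \<le> norm w"
proof -
  have "norm (exp (- 0) - exp (- w)) \<le> 1 * norm (0 - w)"
  proof (rule field_differentiable_bound[of "{z. Re z \<ge> 0}" "\<lambda>z. exp (- z)" "\<lambda>z. - exp (- z)" 1 0 w])
    show "convex {z. 0 \<le> Re z}" using convex_halfspace_Re_ge by blast
  qed (use assms in \<open>auto intro!: derivative_eq_intros simp: norm_exp_eq_Re\<close>)
  then show ?thesis by simp
qed

text \<open>The difference is n^(-s) (1 - exp (- s l)) with l = ln (1 + 1/n) at most 1/n. The power
  of n gained here makes Abel summation work for all Re s > 0.\<close>

lemma norm_npow_diff:
  assumes "n > 0" "Re s \<ge> 0"
  shows "norm (npow n s - npow (Suc n) s) \<le> norm s * real n powr (- Re s - 1)"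
proof -
  define l where "l = ln (1 + 1 / real n)"
  have l: "0 \<le> l" "l \<le> 1 / real n" unfolding l_def using ln_add_one_self_le_self[of "1 / real n"] by simp_all
  have "real (Suc n) = real n * (1 + 1 / real n)" using assms(1) by (simp add: field_simps)
  then have "ln (real (Suc n)) = ln (real n) + l"
    unfolding l_def using ln_mult_pos[of "real n" "1 + 1 / real n"] assms(1) by (simp add: add_pos_nonneg)
  then have "npow (Suc n) s = npow n s * exp (- (s * of_real l))"
    unfolding npow_def by (simp add: ring_distribs flip: exp_add)
  then have "norm (npow n s - npow (Suc n) s) = norm (npow n s) * norm (1 - exp (- (s * of_real l)))"
    by (simp add: ring_distribs flip: norm_mult)
  also have "\<dots> \<le> real n powr (- Re s) * (norm s * (1 / real n))"
  proof (rule mult_mono)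
    have "norm (1 - exp (- (s * of_real l))) \<le> norm s * l"
      using assms l norm_one_minus_exp_le[of "s * of_real l"] by (simp add: norm_mult)
    also have "\<dots> \<le> norm s * (1 / real n)" using l by (intro mult_left_mono) simp_all
    finally show "norm (1 - exp (- (s * of_real l))) \<le> norm s * (1 / real n)" .
  qed (use assms in \<open>simp_all add: norm_npow\<close>)
  also have "\<dots> = norm s * real n powr (- Re s - 1)"
    using assms(1) by (simp add: powr_diff)
  finally show ?thesis .
qed

text \<open>Summation by parts leads to terms A n (n^(-s) - (n+1)^(-s)) with bounded A, dominated
  locally uniformly by a convergent series. The boundary term tends to 0.\<close>

lemma dirichlet_series_abel:
  fixes a :: "nat \<Rightarrow> complex"
  assumes M: "\<And>n. norm (\<Sum>k=1..n. a k) \<le> M"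
  shows "\<exists>\<Phi>. \<Phi> holomorphic_on {s. Re s > 0} \<and>
    (\<forall>s. Re s > 0 \<longrightarrow> (\<lambda>N. \<Sum>k=1..N. a k * npow k s) \<longlonglongrightarrow> \<Phi> s)"
proof -
  define A where "A n = (\<Sum>k=1..n. a k)" for n
  have A: "norm (A n) \<le> M" for n unfolding A_def by (rule M)
  have M0: "M \<ge> 0" using M[of 0] by simp
  define t where "t n s = A (Suc n) * (npow (Suc n) s - npow (Suc (Suc n)) s)" for n s
  define \<Phi> where "\<Phi> s = (\<Sum>n. t n s)" for s
  have bound: "norm (t n s) \<le> M * K * real (Suc n) powr (- \<sigma> - 1)"
    if "\<sigma> \<ge> 0" "Re s \<ge> \<sigma>" "norm s \<le> K" for n s \<sigma> K
  proof -
    have K: "K \<ge> 0" using that(3) norm_ge_zero order.trans by blast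
    have "norm (t n s) \<le> M * (norm s * real (Suc n) powr (- Re s - 1))"
      unfolding t_def norm_mult using that A M0 by (intro mult_mono norm_npow_diff) simp_all
    also have "\<dots> \<le> M * (K * real (Suc n) powr (- \<sigma> - 1))"
      using that M0 K by (intro mult_left_mono mult_mono powr_mono) simp_all
    finally show ?thesis by simp
  qed
  have summ: "summable (\<lambda>n. M * K * real (Suc n) powr (- \<sigma> - 1))" if "\<sigma> > 0" for K \<sigma>
    using that summable_real_powr_iff[of "- \<sigma> - 1"] by (intro summable_mult) (subst summable_Suc_iff, simp)
  have "\<Phi> holomorphic_on {s. Re s > 0}"
  proof (rule holomorphic_uniform_sequence)
    show "open {s. Re s > 0}" by (rule open_halfspace_Re_gt)
    show "(\<lambda>s. \<Sum>i<n. t i s) holomorphic_on {s. Re s > 0}" for n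
      unfolding t_def by (intro holomorphic_intros)
    fix x assume "x \<in> {s. Re s > 0}"
    then have x: "Re x > 0" by simp
    have c: "Re s \<ge> Re x / 2 \<and> norm s \<le> norm x + Re x / 2" if "s \<in> cball x (Re x / 2)" for s
    proof -
      have "norm (s - x) \<le> Re x / 2" using that by (simp add: dist_norm norm_minus_commute)
      moreover have "\<bar>Re s - Re x\<bar> \<le> norm (s - x)" using abs_Re_le_cmod[of "s - x"] by simp
      ultimately show ?thesis using norm_triangle_sub[of s x] by (intro conjI) linarith+
    qed
    have "uniform_limit (cball x (Re x / 2)) (\<lambda>n s. \<Sum>i<n. t i s) \<Phi> sequentially"
      unfolding \<Phi>_def
    proof (rule Weierstrass_m_test)
      show "norm (t n s) \<le> M * (norm x + Re x / 2) * real (Suc n) powr (- (Re x / 2) - 1)"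
        if "s \<in> cball x (Re x / 2)" for n s
        using c[OF that] x by (intro bound) auto
    qed (use x in \<open>intro summ; simp\<close>)
    moreover have "cball x (Re x / 2) \<subseteq> {s. Re s > 0}" using c x by fastforce
    ultimately show "\<exists>d. 0 < d \<and> cball x d \<subseteq> {s. 0 < Re s} \<and>
        uniform_limit (cball x d) (\<lambda>n s. \<Sum>i<n. t i s) \<Phi> sequentially"
      using x by (intro exI[of _ "Re x / 2"]) simp
  qed
  moreover have "(\<lambda>N. \<Sum>k=1..N. a k * npow k s) \<longlonglongrightarrow> \<Phi> s" if s: "Re s > 0" for s
  proof -
    have "summable (\<lambda>n. t n s)"
      by (rule summable_comparison_test'[OF summ[OF s, of "norm s"]]) (use bound[of "Re s" s "norm s"] s in auto)
    then have 1: "(\<lambda>N. \<Sum>n<N. t n s) \<longlonglongrightarrow> \<Phi> s" unfolding \<Phi>_def by (rule summable_LIMSEQ)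
    have 2: "(\<Sum>k=1..N. a k * npow k s) = (\<Sum>n<N. t n s) + A N * npow (Suc N) s" for N
      by (induction N) (simp_all add: t_def A_def algebra_simps)
    have "(\<lambda>N. M * real (Suc N) powr (- Re s)) \<longlonglongrightarrow> M * 0"
      using s by (intro tendsto_mult tendsto_const LIMSEQ_Suc[of "\<lambda>n. real n powr (- Re s)"] tendsto_neg_powr filterlim_real_sequentially) simp_all
    then have lim: "(\<lambda>N. M * real (Suc N) powr (- Re s)) \<longlonglongrightarrow> 0" by simp
    have "\<forall>\<^sub>F N in sequentially. norm (A N * npow (Suc N) s) \<le> M * real (Suc N) powr (- Re s)"
      using A M0 by (intro always_eventually allI) (simp add: norm_mult norm_npow mult_right_mono del: of_nat_Suc)
    from Lim_null_comparison[OF this lim] have "(\<lambda>N. A N * npow (Suc N) s) \<longlonglongrightarrow> 0" .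
    from tendsto_add[OF 1 this] show ?thesis unfolding 2 by simp
  qed
  ultimately show ?thesis by blast
qed

text \<open>With sum 0 over a period, the partial sums from 0 depend only on the index modulo N;
  \<open>a 0\<close> corrects for sums starting at 1.\<close>

lemma periodic_bounded_partial_sums:
  fixes a :: "nat \<Rightarrow> complex"
  assumes N: "N > 0" and per: "\<And>n. a (n + N) = a n" and zero: "(\<Sum>n<N. a n) = 0"
  shows "\<exists>M. \<forall>n. norm (\<Sum>k=1..n. a k) \<le> M"
proof -
  have 1: "(\<Sum>k<m + N. a k) = (\<Sum>k<m. a k)" for m
  proof -
    have "(\<Sum>k<m + N. a k) = (\<Sum>k<N. a k) + (\<Sum>k<m. a (k + N))"
      by (induction m) (simp_all add: add_ac)
    then show ?thesis using per zero by simp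
  qed
  have 2: "(\<Sum>k<r + q * N. a k) = (\<Sum>k<r. a k)" for r q
  proof (induction q)
    case (Suc q)
    then show ?case using 1[of "r + q * N"] by (simp add: add_ac)
  qed simp
  have "norm (\<Sum>k=1..n. a k) \<le> (\<Sum>k<N. norm (a k)) + norm (a 0)" for n
  proof -
    have "{..<Suc n} = insert 0 {1..n}" by auto
    then have "(\<Sum>k=1..n. a k) = (\<Sum>k<Suc n. a k) - a 0" by simp
    also have "(\<Sum>k<Suc n. a k) = (\<Sum>k<Suc n mod N. a k)"
      using 2[of "Suc n mod N" "Suc n div N"] by simp
    also have "norm (\<dots> - a 0) \<le> norm (\<Sum>k<Suc n mod N. a k) + norm (a 0)" by (rule norm_triangle_ineq4)
    also have "norm (\<Sum>k<Suc n mod N. a k) \<le> (\<Sum>k<Suc n mod N. norm (a k))" by (rule norm_sum)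
    also have "\<dots> \<le> (\<Sum>k<N. norm (a k))"
      using mod_less_divisor[OF N, of "Suc n"] by (intro sum_mono2) auto
    finally show ?thesis by simp
  qed
  then show ?thesis by blast
qed

section \<open>Tails, the sieve, Euler products and continuation of L-series\<close>

lemma has_sum_LIMSEQ_from_1:
  fixes g :: "nat \<Rightarrow> 'a :: real_normed_vector"
  assumes "(g has_sum S) {1..}"
  shows "(\<lambda>N. \<Sum>k=1..N. g k) \<longlonglongrightarrow> S"
proof -
  have "((\<lambda>n. if n = 0 then 0 else g n) has_sum S) UNIV"
    by (rule has_sum_cong_neutral[THEN iffD1, OF _ _ _ assms]) auto
  then have "(\<lambda>N. \<Sum>k<Suc N. if k = 0 then 0 else g k) \<longlonglongrightarrow> S"
    by (intro LIMSEQ_Suc) (auto dest: has_sum_imp_sums simp: sums_def)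
  moreover have "(\<Sum>k<Suc N. if k = 0 then 0 else g k) = (\<Sum>k=1..N. g k)" for N
    by (induction N) simp_all
  ultimately show ?thesis by simp
qed

text \<open>A tail of the zeta series; it serves as the error of the Euler product truncated at P,
  uniformly for Re s \<ge> \<sigma>.\<close>

definition powr_tail :: "real \<Rightarrow> nat \<Rightarrow> real" where
  "powr_tail \<sigma> P = (\<Sum>\<^sub>\<infinity>n\<in>{P<..}. real n powr (- \<sigma>))"

lemma summable_on_powr:
  assumes "\<sigma> > 1"
  shows "(\<lambda>n::nat. real n powr (- \<sigma>)) summable_on A"
proof -
  have "summable (\<lambda>n::nat. real n powr (- \<sigma>))" using assms by (simp add: summable_real_powr_iff)
  then have "(\<lambda>n::nat. real n powr (- \<sigma>)) summable_on UNIV"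
    by (subst summable_on_UNIV_nonneg_real_iff) simp_all
  then show ?thesis by (rule summable_on_subset_banach) simp
qed

lemma powr_tail_tendsto_0:
  assumes "\<sigma> > 1"
  shows "powr_tail \<sigma> \<longlonglongrightarrow> 0"
proof -
  let ?g = "\<lambda>n::nat. real n powr (- \<sigma>)"
  have eq: "powr_tail \<sigma> = (\<lambda>P. infsum ?g {1..} - (\<Sum>k=1..P. ?g k))"
  proof
    fix P :: nat
    have "{P<..} = {1..} - {1..P}" by auto
    then have "powr_tail \<sigma> P = infsum ?g {1..} - infsum ?g {1..P}"
      unfolding powr_tail_def using summable_on_powr[OF assms] by (simp only:) (rule infsum_Diff; auto)
    then show "powr_tail \<sigma> P = infsum ?g {1..} - (\<Sum>k=1..P. ?g k)" by simp
  qed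
  have "(\<lambda>P. infsum ?g {1..} - (\<Sum>k=1..P. ?g k)) \<longlonglongrightarrow> infsum ?g {1..} - infsum ?g {1..}"
    by (intro tendsto_diff tendsto_const has_sum_LIMSEQ_from_1 has_sum_infsum summable_on_powr assms)
  then show ?thesis unfolding eq by simp
qed

text \<open>Let R be the set of integers left so far. It contains q R, over which g sums to g q
  times its sum over R, so removing the multiples of q costs the factor 1 - g q.\<close>

lemma euler_sieve:
  fixes g :: "nat \<Rightarrow> complex"
  assumes mult: "\<And>m n. m > 0 \<Longrightarrow> n > 0 \<Longrightarrow> g (m * n) = g m * g n"
    and summ: "g summable_on {1..}" and "finite Q" "\<And>p. p \<in> Q \<Longrightarrow> prime p"
  shows "infsum g {n. n \<ge> 1 \<and> (\<forall>p\<in>Q. \<not> p dvd n)} = infsum g {1..} * (\<Prod>p\<in>Q. 1 - g p)"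
  using assms(3,4)
proof (induction Q rule: finite_induct)
  case empty
  have "{n. n \<ge> 1} = {1::nat..}" by auto
  then show ?case by simp
next
  case (insert q Q)
  let ?R = "{n. n \<ge> 1 \<and> (\<forall>p\<in>Q. \<not> p dvd n)}"
  have q: "prime q" and q0: "q > 0" using insert.prems prime_gt_0_nat by auto
  have nd: "\<not> p dvd q" if "p \<in> Q" for p
    using that insert.hyps(2) insert.prems q by (metis insertCI primes_dvd_imp_eq)
  have R: "{n. n \<ge> 1 \<and> (\<forall>p\<in>insert q Q. \<not> p dvd n)} = ?R - (*) q ` ?R"
  proof (intro equalityI subsetI)
    fix n assume "n \<in> ?R - (*) q ` ?R"
    moreover have "\<exists>m\<in>?R. n = q * m" if "q dvd n" "n \<in> ?R"
    proof -
      from that(1) obtain m where m: "n = q * m" by (elim dvdE)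
      with that(2) have "m \<in> ?R" by (auto simp: Suc_le_eq)
      with m show ?thesis by blast
    qed
    ultimately show "n \<in> {n. n \<ge> 1 \<and> (\<forall>p\<in>insert q Q. \<not> p dvd n)}" by auto
  qed auto
  have sub: "(*) q ` ?R \<subseteq> ?R"
    using q0 nd insert.prems by (auto simp: prime_dvd_mult_iff)
  have "infsum g ((*) q ` ?R) = infsum (\<lambda>n. g (q * n)) ?R"
    using q0 by (subst infsum_reindex) (auto simp: inj_on_def o_def)
  also have "\<dots> = infsum (\<lambda>n. g q * g n) ?R" using mult q0 by (intro infsum_cong) auto
  also have "\<dots> = g q * infsum g ?R" by (rule infsum_cmult_right')
  finally have "infsum g ((*) q ` ?R) = g q * infsum g ?R" .
  moreover have "infsum g (?R - (*) q ` ?R) = infsum g ?R - infsum g ((*) q ` ?R)"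
    using sub by (intro infsum_Diff summable_on_subset_banach[OF summ]) auto
  ultimately have "infsum g (?R - (*) q ` ?R) = infsum g ?R * (1 - g q)" by (simp add: algebra_simps)
  then show ?case unfolding R using insert by (simp add: mult_ac)
qed

text \<open>Used only for Re s > 1, where the series of a character converges absolutely;
  continuations appear as separate functions.\<close>

definition Lser :: "(nat \<Rightarrow> complex) \<Rightarrow> complex \<Rightarrow> complex" where
  "Lser \<psi> s = (\<Sum>\<^sub>\<infinity>n\<in>{1..}. \<psi> n * npow n s)"

lemma norm_npow_le: "n > 0 \<Longrightarrow> \<sigma> \<le> Re s \<Longrightarrow> norm (npow n s) \<le> real n powr (- \<sigma>)"
  by (simp add: norm_npow powr_mono)

lemma abs_summable_Lser:
  assumes "\<And>n. norm (\<psi> n) \<le> 1" "Re s > 1"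
  shows "(\<lambda>n. norm (\<psi> n * npow n s)) summable_on {1..}"
proof (rule summable_on_comparison_test)
  show "(\<lambda>n. real n powr (- Re s)) summable_on {1..}" by (rule summable_on_powr[OF assms(2)])
  show "norm (\<psi> n * npow n s) \<le> real n powr (- Re s)" if "n \<in> {1..}" for n
    using that assms(1)[of n] mult_mono[OF assms(1)[of n] order_refl, of "real n powr (- Re s)"]
    by (simp add: norm_mult norm_npow)
qed simp

lemma has_sum_Lser:
  assumes "dirichlet_char b \<psi>" "b > 0" "Re s > 1"
  shows "((\<lambda>n. \<psi> n * npow n s) has_sum Lser \<psi> s) {1..}"
  unfolding Lser_def
  by (rule has_sum_infsum, rule abs_summable_summable, rule abs_summable_Lser)
     (use dirichlet_char_norm_le[OF assms(1,2)] assms(3) in auto)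

text \<open>Sieving by the primes up to P leaves 1 and integers whose prime factors all exceed P, so
  that they exceed P themselves.\<close>

lemma Lser_euler:
  assumes \<psi>: "dirichlet_char b \<psi>" "b > 0" and s: "1 < \<sigma>" "\<sigma> \<le> Re s"
  shows "norm (Lser \<psi> s * (\<Prod>p | prime p \<and> p \<le> P. 1 - \<psi> p * npow p s) - 1) \<le> powr_tail \<sigma> P"
proof -
  let ?g = "\<lambda>n. \<psi> n * npow n s" and ?Q = "{p. prime p \<and> p \<le> P}"
  let ?R = "{n. n \<ge> 1 \<and> (\<forall>p\<in>?Q. \<not> p dvd n)}"
  have abs: "(\<lambda>n. norm (?g n)) summable_on {1..}"
    using s by (intro abs_summable_Lser dirichlet_char_norm_le[OF \<psi>]) simp
  then have summ: "?g summable_on {1..}" by (rule abs_summable_summable)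
  have "Lser \<psi> s * (\<Prod>p\<in>?Q. 1 - ?g p) = infsum ?g ?R"
    unfolding Lser_def
    by (rule euler_sieve[symmetric, OF _ summ]) (auto simp: dirichlet_charD(1)[OF \<psi>(1)] npow_mult mult_ac)
  also have "?R = insert 1 (?R - {1})" by auto
  also have "infsum ?g \<dots> = ?g 1 + infsum ?g (?R - {1})"
    by (rule infsum_insert) (auto intro: summable_on_subset_banach[OF summ])
  also have "?g 1 = 1" using dirichlet_charD(4)[OF \<psi>(1)] by simp
  finally have eq: "Lser \<psi> s * (\<Prod>p\<in>?Q. 1 - ?g p) - 1 = infsum ?g (?R - {1})" by simp
  have sub: "?R - {1} \<subseteq> {P<..}"
  proof
    fix n assume n: "n \<in> ?R - {1}"
    then obtain p where p: "prime p" "p dvd n" using prime_factor_nat[of n] by auto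
    then have "p \<le> n" using n by (auto intro: dvd_imp_le)
    then show "n \<in> {P<..}" using n p by (auto simp: not_le[symmetric])
  qed
  have "norm (infsum ?g (?R - {1})) \<le> infsum (\<lambda>n. norm (?g n)) (?R - {1})"
    by (intro norm_infsum_bound summable_on_subset_banach[OF abs]) auto
  also have "\<dots> \<le> powr_tail \<sigma> P"
    unfolding powr_tail_def
  proof (rule infsum_mono_neutral)
    show "(\<lambda>n. norm (?g n)) summable_on (?R - {1})"
      by (rule summable_on_subset_banach[OF abs]) auto
    fix n assume "n \<in> (?R - {1}) \<inter> {P<..}"
    then have "n > 0" by auto
    then show "norm (?g n) \<le> real n powr (- \<sigma>)"
      using mult_mono[OF dirichlet_char_norm_le[OF \<psi>, of n] norm_npow_le[of n \<sigma> s]] s by (simp add: norm_mult)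
  qed (use sub summable_on_powr[OF s(1)] in auto)
  finally show ?thesis unfolding eq .
qed

lemma Lser_LIMSEQ:
  assumes "dirichlet_char b \<psi>" "b > 0" "Re s > 1"
  shows "(\<lambda>N. \<Sum>k=1..N. \<psi> k * npow k s) \<longlonglongrightarrow> Lser \<psi> s"
  by (rule has_sum_LIMSEQ_from_1[OF has_sum_Lser[OF assms]])

lemma Lser_continuation:
  assumes "dirichlet_char b \<psi>" "b > 0" "\<psi> \<noteq> principal_char b"
  shows "\<exists>\<Phi>. \<Phi> holomorphic_on {s. Re s > 0} \<and> (\<forall>s. Re s > 1 \<longrightarrow> \<Phi> s = Lser \<psi> s)"
proof -
  obtain M where "\<And>n. norm (\<Sum>k=1..n. \<psi> k) \<le> M"
    using periodic_bounded_partial_sums[OF assms(2) dirichlet_charD(2)[OF assms(1)] dirichlet_char_sum_zero[OF assms]]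
    by (auto simp: cong_def)
  from dirichlet_series_abel[OF this] obtain \<Phi> where
    "\<Phi> holomorphic_on {s. Re s > 0}" "\<And>s. Re s > 0 \<Longrightarrow> (\<lambda>N. \<Sum>k=1..N. \<psi> k * npow k s) \<longlonglongrightarrow> \<Phi> s"
    by blast
  moreover have "\<Phi> s = Lser \<psi> s" if "Re s > 1" for s
    using LIMSEQ_unique[OF calculation(2) Lser_LIMSEQ[OF assms(1,2) that]] that by simp
  ultimately show ?thesis by blast
qed

text \<open>Multiplication by \<open>1 - 2 powr (1 - s)\<close> removes the pole at \<open>1\<close>.\<close>

lemma Lser_principal_continuation:
  assumes "b > 0"
  shows "\<exists>\<Phi>. \<Phi> holomorphic_on {s. Re s > 0} \<and>
    (\<forall>s. Re s > 1 \<longrightarrow> \<Phi> s = (1 - 2 * npow 2 s) * Lser (principal_char b) s)"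
proof -
  let ?c = "principal_char b"
  \<comment> \<open>The coefficients of the L-series multiplied by 1 - 2 powr (1 - s). They have
    period 2 b, and the terms subtracted at even n make them sum to 0 over it.\<close>
  define a where "a n = ?c n - (if even n then 2 * ?c (n div 2) else 0)" for n
  have per: "?c (n + b) = ?c n" for n
    by (rule dirichlet_charD(2)[OF dirichlet_char_principal]) (simp add: cong_def)
  have per2: "?c (n + 2 * b) = ?c n" for n using per[of "n + b"] per[of n] by (simp add: add_ac mult_2)
  have "a (n + 2 * b) = a n" for n
    unfolding a_def using per2[of n] per[of "n div 2"] by auto
  moreover have "(\<Sum>n<2 * b. a n) = 0"
  proof -
    have "(\<Sum>n<b + m. ?c n) = (\<Sum>n<b. ?c n) + (\<Sum>n<m. ?c n)" for m
    proof (induction m)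
      case (Suc m)
      then show ?case using per[of m] by (simp add: add.commute[of b])
    qed simp
    from this[of b] have 1: "(\<Sum>n<2 * b. ?c n) = 2 * (\<Sum>n<b. ?c n)" unfolding mult_2 .
    have "(\<Sum>n<2 * m. if even n then 2 * ?c (n div 2) else 0) = 2 * (\<Sum>n<m. ?c n)" for m
      by (induction m) (simp_all add: distrib_left)
    then show ?thesis unfolding a_def using 1 by (simp add: sum_subtractf)
  qed
  ultimately obtain M where "\<And>n. norm (\<Sum>k=1..n. a k) \<le> M"
    using periodic_bounded_partial_sums[of "2 * b" a] assms by auto
  from dirichlet_series_abel[OF this] obtain \<Phi> where
    \<Phi>: "\<Phi> holomorphic_on {s. Re s > 0}" "\<And>s. Re s > 0 \<Longrightarrow> (\<lambda>N. \<Sum>k=1..N. a k * npow k s) \<longlonglongrightarrow> \<Phi> s"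
    by blast
  have "\<Phi> s = (1 - 2 * npow 2 s) * Lser ?c s" if s: "Re s > 1" for s
  proof -
    let ?g = "\<lambda>n. ?c n * npow n s" and ?E = "(*) 2 ` {1::nat..}"
    have L: "(?g has_sum Lser ?c s) {1..}"
      by (rule has_sum_Lser[OF dirichlet_char_principal assms s])
    have "((\<lambda>n. - (2 * npow 2 s) * ?g n) has_sum - (2 * npow 2 s) * Lser ?c s) {1..}"
      by (rule has_sum_cmult_right[OF L])
    then have "((\<lambda>n. (if even (2 * n) then - 2 * ?c (2 * n div 2) else 0) * npow (2 * n) s) has_sum
        - (2 * npow 2 s) * Lser ?c s) {1..}"
      by (rule has_sum_cong[THEN iffD1, rotated]) (simp add: npow_mult)
    then have "((\<lambda>n. (if even n then - 2 * ?c (n div 2) else 0) * npow n s) has_sum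
        - (2 * npow 2 s) * Lser ?c s) ?E"
      by (subst has_sum_reindex) (auto simp: inj_on_def o_def)
    then have "((\<lambda>n. (if even n then - 2 * ?c (n div 2) else 0) * npow n s) has_sum
        - (2 * npow 2 s) * Lser ?c s) {1..}"
      by (rule has_sum_cong_neutral[THEN iffD1, rotated 3]) (auto elim!: evenE)
    from has_sum_add[OF L this] have "((\<lambda>n. ?g n + (if even n then - 2 * ?c (n div 2) else 0) * npow n s)
        has_sum (1 - 2 * npow 2 s) * Lser ?c s) {1..}"
      by (simp add: left_diff_distrib)
    also have "(\<lambda>n. ?g n + (if even n then - 2 * ?c (n div 2) else 0) * npow n s) = (\<lambda>n. a n * npow n s)"
      by (auto simp: a_def fun_eq_iff left_diff_distrib)
    finally have "((\<lambda>n. a n * npow n s) has_sum (1 - 2 * npow 2 s) * Lser ?c s) {1..}" .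
    from has_sum_LIMSEQ_from_1[OF this] \<Phi>(2)[of s] s show ?thesis by (auto intro: LIMSEQ_unique)
  qed
  then show ?thesis using \<Phi>(1) by blast
qed

section \<open>Alternating derivatives at 2\<close>

text \<open>Nonnegative Taylor coefficients in powers of 2 - s, a local form of complete
  monotonicity; the order on complex numbers also makes them real. The small ball stays in Re s
  \<ge> 3/2, where the Euler products converge uniformly.\<close>

definition cmon :: "(complex \<Rightarrow> complex) \<Rightarrow> bool" where
  "cmon g \<longleftrightarrow> g holomorphic_on ball 2 (1/2) \<and> (\<forall>k. 0 \<le> (- 1) ^ k * (deriv ^^ k) g 2)"

text \<open>Leibniz rule: the sign (-1)^n splits as (-1)^i (-1)^(n-i).\<close>

lemma cmon_mult:
  assumes "cmon f" "cmon g"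
  shows "cmon (\<lambda>s. f s * g s)"
proof -
  have "0 \<le> (- 1) ^ n * (deriv ^^ n) (\<lambda>s. f s * g s) 2" for n
  proof -
    have "(- 1) ^ n * (deriv ^^ n) (\<lambda>s. f s * g s) 2 =
        (\<Sum>i=0..n. of_nat (n choose i) * (((- 1) ^ i * (deriv ^^ i) f 2) * ((- 1) ^ (n - i) * (deriv ^^ (n - i)) g 2)))"
    proof -
      have "(deriv ^^ n) (\<lambda>s. f s * g s) 2 =
          (\<Sum>i=0..n. of_nat (n choose i) * (deriv ^^ i) f 2 * (deriv ^^ (n - i)) g 2)"
        using assms by (intro higher_deriv_mult[of _ "ball 2 (1/2)"]) (simp_all add: cmon_def)
      moreover have "(- 1 :: complex) ^ n = (- 1) ^ i * (- 1) ^ (n - i)" if "i \<in> {0..n}" for i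
        using that by (simp flip: power_add)
      ultimately show ?thesis
        unfolding sum_distrib_left by (simp add: sum_distrib_left mult_ac)
    qed
    moreover have "0 \<le> (of_nat (n choose i) :: complex)" for i by (simp add: less_eq_complex_def)
    moreover have "0 \<le> (- 1) ^ i * (deriv ^^ i) f 2" "0 \<le> (- 1) ^ i * (deriv ^^ i) g 2" for i
      using assms unfolding cmon_def by blast+
    ultimately show ?thesis by (simp only: sum_nonneg mult_nonneg_nonneg)
  qed
  then show ?thesis using assms by (auto simp: cmon_def intro: holomorphic_intros)
qed

lemma cmon_add:
  assumes "cmon f" "cmon g"
  shows "cmon (\<lambda>s. f s + g s)"
proof -
  have "(deriv ^^ n) (\<lambda>s. f s + g s) 2 = (deriv ^^ n) f 2 + (deriv ^^ n) g 2" for n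
    using assms by (intro higher_deriv_add[of _ "ball 2 (1/2)"]) (simp_all add: cmon_def)
  then show ?thesis using assms by (auto simp: cmon_def distrib_left intro!: holomorphic_intros add_nonneg_nonneg)
qed

lemma cmon_npow:
  assumes "n > 0"
  shows "cmon (npow n)"
proof -
  have "(deriv ^^ k) (npow n) = (\<lambda>s. (- of_real (ln (real n))) ^ k * npow n s)" for k
  proof (induction k)
    case (Suc k)
    have "deriv (\<lambda>s. (- of_real (ln (real n))) ^ k * npow n s) s = (- of_real (ln (real n))) ^ Suc k * npow n s" for s
      unfolding npow_def by (rule DERIV_imp_deriv) (auto intro!: derivative_eq_intros)
    then show ?case using Suc by simp
  qed simp
  then have "(- 1) ^ k * (deriv ^^ k) (npow n) 2 = of_real (ln (real n) ^ k * real n powr (-2))" for k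
    using npow_of_real[OF assms, of 2] by (simp add: mult.assoc[symmetric] flip: power_mult_distrib)
  moreover have "ln (real n) \<ge> 0" using assms by simp
  ultimately show ?thesis
    by (auto simp: cmon_def less_eq_complex_def intro!: holomorphic_intros)
qed

lemma cmon_1: "cmon (\<lambda>_. 1)"
proof -
  have eq: "npow 1 = (\<lambda>_. 1)" by (rule ext) simp
  have "cmon (npow 1)" by (rule cmon_npow) simp
  then show ?thesis unfolding eq .
qed

lemma cmon_prod: "(\<And>i. i \<in> A \<Longrightarrow> cmon (f i)) \<Longrightarrow> cmon (\<lambda>s. \<Prod>i\<in>A. f i s)"
  by (induction A rule: infinite_finite_induct) (auto intro: cmon_mult cmon_1)

lemma cmon_power: "cmon f \<Longrightarrow> cmon (\<lambda>s. f s ^ n)"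
  by (induction n) (auto intro: cmon_mult cmon_1)

lemma cmon_limit:
  assumes lim: "uniform_limit (ball 2 (1/2)) f g sequentially" and f: "\<And>n. cmon (f n)"
    and g: "g holomorphic_on ball 2 (1/2)"
  shows "cmon g"
proof -
  have "0 \<le> (- 1) ^ k * (deriv ^^ k) g 2" for k
  proof -
    have "(\<lambda>n. (deriv ^^ k) (f n) 2) \<longlonglongrightarrow> (deriv ^^ k) g 2"
      by (rule higher_deriv_complex_uniform_limit[OF lim]) (use f in \<open>auto simp: cmon_def\<close>)
    then have l: "(\<lambda>n. (- 1) ^ k * (deriv ^^ k) (f n) 2) \<longlonglongrightarrow> (- 1) ^ k * (deriv ^^ k) g 2"
      by (intro tendsto_intros)
    have nn: "0 \<le> Re ((- 1) ^ k * (deriv ^^ k) (f n) 2)" "Im ((- 1) ^ k * (deriv ^^ k) (f n) 2) = 0" for n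
      using f[of n] unfolding cmon_def less_eq_complex_def by (metis zero_complex.simps)+
    show ?thesis
      unfolding less_eq_complex_def
    proof
      show "Re 0 \<le> Re ((- 1) ^ k * (deriv ^^ k) g 2)"
        using LIMSEQ_le_const[OF tendsto_Re[OF l], of 0] nn(1) by auto
      show "Im 0 = Im ((- 1) ^ k * (deriv ^^ k) g 2)"
        using LIMSEQ_unique[OF tendsto_Im[OF l, unfolded nn(2)] tendsto_const] by simp
    qed
  qed
  then show ?thesis using g by (simp add: cmon_def)
qed

lemma ball_2_half: "s \<in> ball 2 (1/2) \<Longrightarrow> Re s \<ge> 3/2"
  using abs_Re_le_cmod[of "2 - s"] by (auto simp: dist_norm)

lemma norm_npow_le_half:
  assumes "n \<ge> 2" "Re s \<ge> 1"
  shows "norm (npow n s) \<le> 1 / 2"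
proof -
  have "norm (npow n s) \<le> real n powr (- 1)" using assms by (intro norm_npow_le) simp_all
  also have "\<dots> = 1 / real n" using assms by (simp add: powr_minus_divide)
  also have "\<dots> \<le> 1 / 2" using assms by (intro divide_left_mono) simp_all
  finally show ?thesis .
qed

lemma npow_nat_power: "n > 0 \<Longrightarrow> npow (n ^ k) s = npow n s ^ k"
  by (induction k) (simp_all add: npow_mult)

text \<open>On the ball n^(-s) has norm at most 1/2, so this is a uniform limit of sums of powers of
  n^(-s).\<close>

lemma cmon_geometric:
  assumes "n \<ge> 2"
  shows "cmon (\<lambda>s. 1 / (1 - npow n s))"
proof (rule cmon_limit)
  have ne: "npow n s \<noteq> 1" if "s \<in> ball 2 (1/2)" for s
    using norm_npow_le_half[OF assms, of s] ball_2_half[OF that] by auto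
  then show "(\<lambda>s. 1 / (1 - npow n s)) holomorphic_on ball 2 (1/2)"
    by (intro holomorphic_intros) (auto simp: npow_def)
  show "cmon (\<lambda>s. \<Sum>j<J. npow n s ^ j)" for J
  proof (induction J)
    case 0
    show ?case by (simp add: cmon_def)
  next
    case (Suc J)
    then show ?case using assms by (auto intro!: cmon_add cmon_power cmon_npow)
  qed
  have "uniform_limit (ball 2 (1/2)) (\<lambda>J s. \<Sum>j<J. npow n s ^ j) (\<lambda>s. \<Sum>j. npow n s ^ j) sequentially"
  proof (rule Weierstrass_m_test)
    show "norm (npow n s ^ j) \<le> (1/2) ^ j" if "s \<in> ball 2 (1/2)" for j s
      using norm_npow_le_half[OF assms, of s] ball_2_half[OF that]
      unfolding norm_power by (intro power_mono) auto
  qed (simp add: summable_geometric)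
  moreover have "(\<Sum>j. npow n s ^ j) = 1 / (1 - npow n s)" if "s \<in> ball 2 (1/2)" for s
    using norm_npow_le_half[OF assms, of s] ball_2_half[OF that] by (intro suminf_geometric) auto
  ultimately show "uniform_limit (ball 2 (1/2)) (\<lambda>J s. \<Sum>j<J. npow n s ^ j) (\<lambda>s. 1 / (1 - npow n s)) sequentially"
    by (subst uniform_limit_cong'[where g = "\<lambda>J s. \<Sum>j<J. npow n s ^ j" and i = "\<lambda>s. \<Sum>j. npow n s ^ j"]) auto
qed

text \<open>Landau's device: for 0 < s \<le> 2 every Taylor term at 2 is nonnegative, so the
  constant term is a lower bound. Holomorphy on the full disc of radius 2 carries the bound beyond
  the region where the Dirichlet series converge absolutely.\<close>

lemma cmon_eval:
  assumes g: "cmon g" "g holomorphic_on ball 2 2" and s: "0 < s" "s \<le> 2"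
  shows "Re (g 2) \<le> Re (g (of_real s))"
proof -
  define t where "t n = (deriv ^^ n) g 2 / fact n * (of_real s - 2) ^ n" for n
  have "of_real s \<in> ball (2::complex) 2"
    using s norm_of_real[of "2 - s", where 'a = complex] by (simp add: dist_norm)
  from holomorphic_power_series[OF g(2) this] have "t sums g (of_real s)" unfolding t_def .
  then have sm: "(\<lambda>n. Re (t n)) sums Re (g (of_real s))" by (rule sums_Re)
  have nn: "Re (t n) \<ge> 0" for n
  proof -
    have "(of_real s - 2 :: complex) ^ n = (- 1) ^ n * of_real ((2 - s) ^ n)"
      by (simp flip: power_mult_distrib)
    then have "t n = of_real ((2 - s) ^ n / fact n) * ((- 1) ^ n * (deriv ^^ n) g 2)"
      unfolding t_def by simp
    then have "Re (t n) = (2 - s) ^ n / fact n * Re ((- 1) ^ n * (deriv ^^ n) g 2)"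
      by (simp only: times_complex.sel Re_complex_of_real Im_complex_of_real mult_zero_left diff_zero)
    moreover have "Re ((- 1) ^ n * (deriv ^^ n) g 2) \<ge> 0"
      using g(1) unfolding cmon_def less_eq_complex_def by (metis zero_complex.simps(1))
    ultimately show ?thesis using s by (metis diff_ge_0_iff_ge divide_nonneg_nonneg fact_ge_zero mult_nonneg_nonneg zero_le_power)
  qed
  have "(\<Sum>n<1. Re (t n)) \<le> Re (g (of_real s))"
    using sum_le_suminf[of "\<lambda>n. Re (t n)" "{..<1}"] nn sums_summable[OF sm] sums_unique[OF sm] by auto
  then show ?thesis by (simp add: t_def)
qed

section \<open>Primes congruent to 1\<close>

definition Lprod :: "nat \<Rightarrow> complex \<Rightarrow> complex" where
  "Lprod b s = (\<Prod>\<psi> | dirichlet_char b \<psi>. Lser \<psi> s)"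

text \<open>The reciprocal of the local factor at p of the product of all L-series. Reciprocals keep
  finite products entire, and the Euler product becomes the statement that \<open>Lprod\<close>
  times \<open>euler_part\<close> tends to 1.\<close>

definition euler_factor :: "nat \<Rightarrow> nat \<Rightarrow> complex \<Rightarrow> complex" where
  "euler_factor b p s = (\<Prod>\<psi> | dirichlet_char b \<psi>. 1 - \<psi> p * npow p s)"

definition euler_part :: "nat \<Rightarrow> nat \<Rightarrow> complex \<Rightarrow> complex" where
  "euler_part b P s = (\<Prod>p | prime p \<and> p \<le> P. euler_factor b p s)"

lemma uniform_limit_prod_1:
  fixes t :: "'i \<Rightarrow> nat \<Rightarrow> 'b \<Rightarrow> complex"
  assumes "\<And>i. i \<in> Y \<Longrightarrow> uniform_limit S (t i) (\<lambda>_. 1) sequentially"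
  shows "uniform_limit S (\<lambda>n s. \<Prod>i\<in>Y. t i n s) (\<lambda>_. 1) sequentially"
  using assms
proof (induction Y rule: infinite_finite_induct)
  case (insert i Y)
  have "uniform_limit S (\<lambda>n s. t i n s * (\<Prod>j\<in>Y. t j n s)) (\<lambda>_. 1 * 1) sequentially"
    by (rule uniform_lim_mult) (use insert in \<open>auto intro!: finite_imp_bounded finite_subset[of _ "{1}"]\<close>)
  then show ?case using insert by simp
qed (simp_all add: uniform_limit_const)

lemma Lprod_euler:
  assumes b: "b > 0" and \<sigma>: "\<sigma> > 1"
  shows "uniform_limit {s. Re s \<ge> \<sigma>} (\<lambda>P s. Lprod b s * euler_part b P s) (\<lambda>_. 1) sequentially"
proof -
  have 1: "uniform_limit {s. Re s \<ge> \<sigma>} (\<lambda>P s. Lser \<psi> s * (\<Prod>p | prime p \<and> p \<le> P. 1 - \<psi> p * npow p s)) (\<lambda>_. 1) sequentially"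
    if "dirichlet_char b \<psi>" for \<psi>
  proof (rule uniform_limitI)
    fix e :: real assume "e > 0"
    then have "\<forall>\<^sub>F P in sequentially. powr_tail \<sigma> P < e"
      using powr_tail_tendsto_0[OF \<sigma>] by (simp add: order_tendstoD(2))
    then show "\<forall>\<^sub>F P in sequentially. \<forall>s\<in>{s. Re s \<ge> \<sigma>}.
        dist (Lser \<psi> s * (\<Prod>p | prime p \<and> p \<le> P. 1 - \<psi> p * npow p s)) 1 < e"
    proof eventually_elim
      case (elim P)
      then show ?case using Lser_euler[OF that b \<sigma>, of _ P] by (auto simp: dist_norm intro: order.strict_trans1)
    qed
  qed
  have "(\<Prod>\<psi> | dirichlet_char b \<psi>. Lser \<psi> s * (\<Prod>p | prime p \<and> p \<le> P. 1 - \<psi> p * npow p s)) =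
      Lprod b s * euler_part b P s" for P s
    unfolding Lprod_def euler_part_def euler_factor_def by (subst prod.distrib, subst prod.swap) (rule refl)
  moreover have "uniform_limit {s. Re s \<ge> \<sigma>}
      (\<lambda>P s. \<Prod>\<psi> | dirichlet_char b \<psi>. Lser \<psi> s * (\<Prod>p | prime p \<and> p \<le> P. 1 - \<psi> p * npow p s)) (\<lambda>_. 1) sequentially"
    by (rule uniform_limit_prod_1) (use 1 in simp)
  ultimately show ?thesis by simp
qed

lemma Lprod_euler_LIMSEQ:
  assumes "b > 0" "Re s > 1"
  shows "(\<lambda>P. Lprod b s * euler_part b P s) \<longlonglongrightarrow> 1"
  using tendsto_uniform_limitI[OF Lprod_euler[OF assms]] by simp

text \<open>For p not coprime to b all characters vanish at p, and \<open>r = 0\<close> encodes the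
  factor 1; otherwise this is the product over all characters.\<close>

lemma euler_factor_eq:
  assumes b: "b > 0" and p: "prime p"
  shows "\<exists>f r. f > 0 \<and> f \<le> card {\<psi>. dirichlet_char b \<psi>} \<and> r \<le> card {\<psi>. dirichlet_char b \<psi>} \<and>
    (coprime p b \<longrightarrow> r > 0) \<and> (f \<ge> 2 \<or> [p = 1] (mod b) \<or> r = 0) \<and>
    (\<forall>s. euler_factor b p s = (1 - npow p s ^ f) ^ r)"
proof (cases "coprime p b")
  case True
  from dirichlet_char_prod[OF b True] obtain f r where
    fr: "f > 0 \<and> r > 0 \<and> f * r = card {\<psi>. dirichlet_char b \<psi>} \<and> (f = 1 \<longleftrightarrow> [p = 1] (mod b)) \<and>
    (\<forall>u. (\<Prod>\<psi> | dirichlet_char b \<psi>. 1 - \<psi> p * u) = (1 - u ^ f) ^ r)" by (elim exE)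
  then have "f \<le> card {\<psi>. dirichlet_char b \<psi>}" "r \<le> card {\<psi>. dirichlet_char b \<psi>}" "f \<ge> 2 \<or> f = 1"
    by (auto simp flip: conjunct1[OF conjunct2[OF conjunct2[OF fr]]])
  then show ?thesis using fr unfolding euler_factor_def by (intro exI[of _ f] exI[of _ r]) simp
next
  case False
  have "finite {\<psi>. dirichlet_char b \<psi>}" "{\<psi>. dirichlet_char b \<psi>} \<noteq> {}" using finite_dirichlet_char[OF b] dirichlet_char_principal[of b] by auto
  then have "card {\<psi>. dirichlet_char b \<psi>} > 0" by (simp add: card_gt_0_iff)
  moreover have "euler_factor b p s = 1" for s
    unfolding euler_factor_def using False dirichlet_charD(3)[of b _ p] by (intro prod.neutral) auto
  ultimately show ?thesis using False by (intro exI[of _ 1] exI[of _ 0]) simp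
qed

lemma euler_factor_nonzero:
  assumes "b > 0" "prime p" "Re s > 0"
  shows "euler_factor b p s \<noteq> 0"
proof -
  obtain f r where fr: "f > 0" "euler_factor b p s = (1 - npow p s ^ f) ^ r"
    using euler_factor_eq[OF assms(1,2)] by (elim exE conjE) simp
  have "norm (npow p s) < 1"
    using assms(3) prime_gt_1_nat[OF assms(2)] powr_less_mono[of "- Re s" 0 "real p"] by (simp add: norm_npow)
  then have "norm (npow p s ^ f) < 1" unfolding norm_power using fr(1) by (intro power_less_one_iff[THEN iffD2]) auto
  then show ?thesis using fr(2) by auto
qed

lemma euler_part_nonzero:
  assumes "b > 0" "Re s > 0"
  shows "euler_part b P s \<noteq> 0"
  unfolding euler_part_def using euler_factor_nonzero[OF assms(1) _ assms(2)] by (subst prod_zero_iff) auto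

lemma Lprod_nonzero:
  assumes "b > 0" "Re s > 1"
  shows "Lprod b s \<noteq> 0"
proof
  assume "Lprod b s = 0"
  then show False using Lprod_euler_LIMSEQ[OF assms] by (simp add: LIMSEQ_const_iff)
qed

lemma holomorphic_euler_part [holomorphic_intros]: "euler_part b P holomorphic_on A"
  unfolding euler_part_def euler_factor_def by (intro holomorphic_intros)

text \<open>Write N for the number of characters and y = p^(-f s). The upper bound comes from r > 0
  and f \<le> N. The lower one comes from ln (1 - y) \<ge> - 2 y for y \<le> 1/2: unless r = 0, y is
  at most 1/p, and at most 1/p^2 when p is not 1 modulo b, since then f \<ge> 2.\<close>

lemma real_euler_factor:
  assumes b: "b > 0" and p: "prime p" and s: "s > 0"
  shows "\<exists>v. euler_factor b p (of_real s) = of_real v \<and> 0 < v \<and> v \<le> 1 \<and>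
    (coprime p b \<longrightarrow> v \<le> 1 - real p powr (- real (card {\<psi>. dirichlet_char b \<psi>}) * s)) \<and>
    (s \<ge> 1 \<longrightarrow> v \<ge> exp (- 2 * real (card {\<psi>. dirichlet_char b \<psi>}) * (if [p = 1] (mod b) then 1 / real p else 1 / real p ^ 2)))"
proof -
  let ?N = "card {\<psi>. dirichlet_char b \<psi>}" and ?x = "if [p = 1] (mod b) then 1 / real p else 1 / real p ^ 2"
  obtain f r where fr: "f > 0" "f \<le> ?N" "r \<le> ?N" "coprime p b \<Longrightarrow> r > 0" "f \<ge> 2 \<or> [p = 1] (mod b) \<or> r = 0"
    "euler_factor b p (of_real s) = (1 - npow p (of_real s) ^ f) ^ r"
    using euler_factor_eq[OF b p] by (elim exE conjE) simp
  have p2: "real p \<ge> 2" using prime_ge_2_nat[OF p] by simp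
  define y where "y = real p powr (- real f * s)"
  have "npow p (of_real s) ^ f = npow p (of_real (real f * s))"
    using p2 by (subst npow_power) simp_all
  then have y: "npow p (of_real s) ^ f = of_real y"
    unfolding y_def using p2 npow_of_real[of p "real f * s"] by simp
  have y1: "0 < y" "y < 1"
    unfolding y_def using p2 s fr(1) powr_less_mono[of "- real f * s" 0 "real p"] by auto
  show ?thesis
  proof (intro exI[of _ "(1 - y) ^ r"] conjI impI)
    show "euler_factor b p (of_real s) = of_real ((1 - y) ^ r)" using fr(6) y by simp
    show "0 < (1 - y) ^ r" "(1 - y) ^ r \<le> 1" using y1 by (auto intro: power_le_one)
    show "(1 - y) ^ r \<le> 1 - real p powr (- real ?N * s)" if "coprime p b"
    proof -
      have "(1 - y) ^ r \<le> (1 - y) ^ 1" using y1 fr(4)[OF that] by (intro power_decreasing) auto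
      also have "real p powr (- real ?N * s) \<le> y"
        unfolding y_def using p2 fr(2) s by (intro powr_mono) auto
      then have "(1 - y) ^ 1 \<le> 1 - real p powr (- real ?N * s)" by simp
      finally show ?thesis .
    qed
    show "(1 - y) ^ r \<ge> exp (- 2 * real ?N * ?x)" if "s \<ge> 1"
    proof (cases "r = 0")
      case False
      have "y \<le> ?x"
      proof (cases "[p = 1] (mod b)")
        case True
        have "1 \<le> real f * s" using fr(1) that mult_mono[of 1 "real f" 1 s] by auto
        then have "y \<le> real p powr (- 1)" unfolding y_def using p2 by (intro powr_mono) auto
        then show ?thesis using True p2 by (simp add: powr_minus_divide)
      next
        case F: False
        then have "f \<ge> 2" using fr(5) False by simp
        then have "2 \<le> real f * s" using that mult_mono[of 2 "real f" 1 s] by auto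
        then have "y \<le> real p powr (- 2)" unfolding y_def using p2 by (intro powr_mono) auto
        then show ?thesis using F p2 by (simp add: powr_minus_divide)
      qed
      moreover have "?x \<le> 1 / 2"
      proof -
        have "1 / real p \<le> 1 / 2" using p2 by (intro divide_left_mono) auto
        moreover have "1 / real p ^ 2 \<le> 1 / real p"
          using p2 by (intro divide_left_mono) (auto simp: power2_eq_square)
        ultimately show ?thesis by simp
      qed
      ultimately have yx: "y \<le> ?x" "y \<le> 1 / 2" by simp_all
      have "- 2 * y \<le> - y - 2 * y ^ 2" using yx y1 by (simp add: power2_eq_square)
      also have "\<dots> \<le> ln (1 - y)" using yx(2) y1 by (intro ln_one_minus_pos_lower_bound) auto
      finally have l: "- 2 * y \<le> ln (1 - y)" .
      have "- 2 * real ?N * ?x \<le> - 2 * real r * y"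
        using yx(1) y1 fr(3) mult_mono[of "real r" "real ?N" y ?x] by simp
      also have "\<dots> = real r * (- 2 * y)" by simp
      also have "\<dots> \<le> real r * ln (1 - y)" using l by (intro mult_left_mono) simp_all
      finally have "exp (- 2 * real ?N * ?x) \<le> exp (real r * ln (1 - y))" by simp
      also have "\<dots> = (1 - y) ^ r" using y1 by (simp add: exp_of_nat_mult)
      finally show ?thesis .
    qed simp
  qed
qed

text \<open>Only primes congruent to 1 contribute order 1/p to the logarithm of the Euler product;
  the rest costs at most the sum of all 1/n^2. So the finite products of reciprocal factors stay
  above \<open>\<kappa>\<close>, uniformly in s > 1.\<close>

lemma Lprod_bounded:
  assumes b: "b > 0" and S: "\<And>P. (\<Sum>p | prime p \<and> p \<le> P \<and> [p = 1] (mod b). 1 / real p) \<le> S"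
  shows "\<exists>K. \<forall>s>1. norm (Lprod b (of_real s)) \<le> K"
proof -
  let ?N = "real (card {\<psi>. dirichlet_char b \<psi>})"
  define T where "T = (\<Sum>n. 1 / real n ^ 2)"
  define \<kappa> where "\<kappa> = exp (- 2 * ?N * (S + T))"
  have low: "\<kappa> \<le> norm (euler_part b P (of_real s))" if s: "s > 1" for s P
  proof -
    have s0: "s > 0" using s by simp
    let ?x = "\<lambda>p. if [p = 1] (mod b) then 1 / real p else 1 / real p ^ 2"
    have "(\<Sum>p | prime p \<and> p \<le> P. ?x p) \<le>
        (\<Sum>p | prime p \<and> p \<le> P. (if [p = 1] (mod b) then 1 / real p else 0) + 1 / real p ^ 2)"
      by (intro sum_mono) auto
    also have "\<dots> = (\<Sum>p | prime p \<and> p \<le> P \<and> [p = 1] (mod b). 1 / real p) + (\<Sum>p | prime p \<and> p \<le> P. 1 / real p ^ 2)"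
      unfolding sum.distrib by (simp add: sum.inter_filter[symmetric] conj_assoc)
    also have "(\<Sum>p | prime p \<and> p \<le> P. 1 / real p ^ 2) \<le> T"
      unfolding T_def by (intro sum_le_suminf inverse_power_summable[of 2, where 'a = real, unfolded inverse_eq_divide]) auto
    finally have x: "(\<Sum>p | prime p \<and> p \<le> P. ?x p) \<le> S + T" using S[of P] by simp
    have "\<kappa> \<le> exp (- 2 * ?N * (\<Sum>p | prime p \<and> p \<le> P. ?x p))"
      unfolding \<kappa>_def using mult_left_mono[OF x, of "2 * ?N"] by simp
    also have "\<dots> = (\<Prod>p | prime p \<and> p \<le> P. exp (- 2 * ?N * ?x p))"
      by (subst exp_sum[symmetric]) (simp_all add: sum_distrib_left)
    also have "\<dots> \<le> (\<Prod>p | prime p \<and> p \<le> P. norm (euler_factor b p (of_real s)))"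
    proof (intro prod_mono conjI)
      fix p assume "p \<in> {p. prime p \<and> p \<le> P}"
      then have p: "prime p" by simp
      obtain v where "euler_factor b p (of_real s) = of_real v" "0 < v" "s \<ge> 1 \<Longrightarrow> v \<ge> exp (- 2 * ?N * ?x p)"
        using real_euler_factor[OF b p s0] by (elim exE conjE) simp
      then show "exp (- 2 * ?N * ?x p) \<le> norm (euler_factor b p (of_real s))" using s by simp
    qed simp
    finally show ?thesis by (simp add: euler_part_def prod_norm)
  qed
  have "norm (Lprod b (of_real s)) \<le> 1 / \<kappa>" if s: "s > 1" for s
  proof -
    have "(\<lambda>P. norm (Lprod b (of_real s) * euler_part b P (of_real s))) \<longlonglongrightarrow> norm (1::complex)"
      using s by (intro tendsto_norm Lprod_euler_LIMSEQ b) simp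
    moreover have "norm (Lprod b (of_real s)) * \<kappa> \<le> norm (Lprod b (of_real s) * euler_part b P (of_real s))" for P
      unfolding norm_mult by (intro mult_left_mono low s) simp
    ultimately have "norm (Lprod b (of_real s)) * \<kappa> \<le> norm (1::complex)"
      by (intro LIMSEQ_le_const) auto
    then show ?thesis by (simp add: \<kappa>_def field_simps)
  qed
  then show ?thesis by blast
qed

text \<open>At a zero Re s = 1 and Im s times ln 2 is a multiple of 2 pi. In the disc Im s has
  absolute value below 2, so only the multiple 0 is possible.\<close>

lemma one_minus_two_npow_nonzero:
  assumes "s \<in> ball 2 2" "s \<noteq> 1"
  shows "1 - 2 * npow 2 s \<noteq> 0"
proof
  assume "1 - 2 * npow 2 s = 0"
  moreover have "2 * npow 2 s = exp ((1 - s) * of_real (ln 2))"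
    by (simp add: npow_def left_diff_distrib exp_diff exp_minus exp_of_real divide_inverse)
  ultimately have "exp ((1 - s) * of_real (ln 2)) = 1" by simp
  then obtain n :: int where n: "Re ((1 - s) * of_real (ln 2)) = 0" "Im ((1 - s) * of_real (ln 2)) = of_int (2 * n) * pi"
    by (auto simp: exp_eq_1)
  have re: "Re s = 1" using n(1) by simp
  have "\<bar>Im s\<bar> \<le> norm (2 - s)" using abs_Im_le_cmod[of "2 - s"] by simp
  then have "\<bar>Im s\<bar> < 2" using assms(1) by (simp add: dist_norm)
  moreover have "\<bar>Im s\<bar> * ln 2 \<le> \<bar>Im s\<bar> * 1" using ln_le_minus_one[of 2] by (intro mult_left_mono) simp_all
  ultimately have "\<bar>Im s * ln 2\<bar> < 2" by (simp add: abs_mult)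
  then have "\<bar>of_int (2 * n) * pi\<bar> < 2" using n(2) by simp
  then have "real_of_int \<bar>n\<bar> * pi < 1" by (simp add: abs_mult)
  moreover have "1 * 1 \<le> real_of_int \<bar>n\<bar> * pi" if "n \<noteq> 0"
    using that pi_gt3 by (intro mult_mono) simp_all
  ultimately have "n = 0" by fastforce
  then have "Im s = 0" using n(2) by simp
  then show False using re assms(2) by (simp add: complex_eq_iff)
qed

lemma npow_2_1: "2 * npow 2 1 = 1"
  using npow_of_real[of 2 1] by (simp add: powr_minus_divide mult.commute)

lemma deriv_one_minus_two_npow: "deriv (\<lambda>s. 1 - 2 * npow 2 s) 1 = of_real (ln 2)"
proof (rule DERIV_imp_deriv)
  have "((\<lambda>s. 1 - 2 * npow 2 s) has_field_derivative (of_real (ln 2) * (2 * npow 2 1))) (at 1)"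
    unfolding npow_def by (auto intro!: derivative_eq_intros)
  then show "((\<lambda>s. 1 - 2 * npow 2 s) has_field_derivative of_real (ln 2)) (at 1)" by (simp add: npow_2_1)
qed

lemma Lprod_times_holomorphic:
  assumes b: "b > 0"
  shows "\<exists>G. G holomorphic_on {s. Re s > 0} \<and> (\<forall>s. Re s > 1 \<longrightarrow> G s = (1 - 2 * npow 2 s) * Lprod b s)"
proof -
  let ?X = "{\<psi>. dirichlet_char b \<psi>}" and ?c = "principal_char b"
  obtain E where E: "E holomorphic_on {s. Re s > 0}" "\<And>s. Re s > 1 \<Longrightarrow> E s = (1 - 2 * npow 2 s) * Lser ?c s"
    using Lser_principal_continuation[OF b] by blast
  have "\<forall>\<psi>\<in>?X - {?c}. \<exists>\<Phi>. \<Phi> holomorphic_on {s. Re s > 0} \<and> (\<forall>s. Re s > 1 \<longrightarrow> \<Phi> s = Lser \<psi> s)"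
    using Lser_continuation[OF _ b] by simp
  from bchoice[OF this] obtain \<Phi> where
    \<Phi>: "\<forall>\<psi>\<in>?X - {?c}. \<Phi> \<psi> holomorphic_on {s. Re s > 0} \<and> (\<forall>s. Re s > 1 \<longrightarrow> \<Phi> \<psi> s = Lser \<psi> s)" by blast
  define G where "G s = E s * (\<Prod>\<psi>\<in>?X - {?c}. \<Phi> \<psi> s)" for s
  have "G holomorphic_on {s. Re s > 0}"
    unfolding G_def using E(1) \<Phi> by (intro holomorphic_intros) auto
  moreover have "G s = (1 - 2 * npow 2 s) * Lprod b s" if "Re s > 1" for s
  proof -
    have "Lprod b s = Lser ?c s * (\<Prod>\<psi>\<in>?X - {?c}. Lser \<psi> s)"
      unfolding Lprod_def using finite_dirichlet_char[OF b] dirichlet_char_principal by (intro prod.remove) auto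
    moreover have "(\<Prod>\<psi>\<in>?X - {?c}. \<Phi> \<psi> s) = (\<Prod>\<psi>\<in>?X - {?c}. Lser \<psi> s)"
      using \<Phi> that by (intro prod.cong) auto
    ultimately show ?thesis unfolding G_def using E(2)[OF that] by simp
  qed
  ultimately show ?thesis by blast
qed

lemma ball_2_2_Re_pos: "s \<in> ball 2 2 \<Longrightarrow> Re s > 0"
  using abs_Re_le_cmod[of "2 - s"] by (auto simp: dist_norm)

text \<open>The product G of \<open>Lprod\<close> with 1 - 2 powr (1 - s) continues to Re s > 0, and
  boundedness of \<open>Lprod\<close> to the right of 1 forces G 1 = 0. Dividing both G and the
  auxiliary factor by s - 1 gives a quotient g / k whose denominator has no zero in the
  disc.\<close>

lemma Lprod_extension:
  assumes b: "b > 0" and K: "\<And>s. s > 1 \<Longrightarrow> norm (Lprod b (of_real s)) \<le> K"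
  shows "\<exists>F. F holomorphic_on ball 2 2 \<and> (\<forall>s. Re s > 1 \<longrightarrow> F s = Lprod b s)"
proof -
  obtain G where G: "G holomorphic_on {s. Re s > 0}" "\<And>s. Re s > 1 \<Longrightarrow> G s = (1 - 2 * npow 2 s) * Lprod b s"
    using Lprod_times_holomorphic[OF b] by blast
  have op: "open {s. Re s > 0}" by (rule open_halfspace_Re_gt)
  define u where "u n = complex_of_real (1 + 1 / real (Suc n))" for n
  have "(\<lambda>n. 1 + 1 / real (Suc n)) \<longlonglongrightarrow> 1 + 0"
    by (intro tendsto_add tendsto_const LIMSEQ_Suc lim_1_over_n)
  then have "(\<lambda>n. complex_of_real (1 + 1 / real (Suc n))) \<longlonglongrightarrow> complex_of_real (1 + 0)"
    by (rule tendsto_of_real)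
  then have u: "u \<longlonglongrightarrow> 1" unfolding u_def by simp
  have "isCont G 1"
    using holomorphic_on_imp_continuous_on[OF G(1)] op by (simp add: continuous_on_eq_continuous_at)
  then have G1: "(\<lambda>n. G (u n)) \<longlonglongrightarrow> G 1" using u isCont_tendsto_compose by blast
  have "isCont (\<lambda>s. 1 - 2 * npow 2 s) 1" unfolding npow_def by (intro continuous_intros)
  then have q: "(\<lambda>n. norm (1 - 2 * npow 2 (u n)) * K) \<longlonglongrightarrow> norm (1 - 2 * npow 2 1) * K"
    using u by (intro tendsto_mult tendsto_norm isCont_tendsto_compose[of 1 "\<lambda>s. 1 - 2 * npow 2 s"] tendsto_const)
  then have q: "(\<lambda>n. norm (1 - 2 * npow 2 (u n)) * K) \<longlonglongrightarrow> 0" by (simp add: npow_2_1)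
  have "\<forall>\<^sub>F n in sequentially. norm (G (u n)) \<le> norm (1 - 2 * npow 2 (u n)) * K"
  proof (intro always_eventually allI)
    fix n
    have "Re (u n) > 1" unfolding u_def by simp
    then have "norm (G (u n)) = norm (1 - 2 * npow 2 (u n)) * norm (Lprod b (u n))"
      using G(2) by (simp add: norm_mult)
    also have "\<dots> \<le> norm (1 - 2 * npow 2 (u n)) * K"
      unfolding u_def by (intro mult_left_mono K) simp_all
    finally show "norm (G (u n)) \<le> norm (1 - 2 * npow 2 (u n)) * K" .
  qed
  then have "(\<lambda>n. G (u n)) \<longlonglongrightarrow> 0" using q by (rule Lim_null_comparison)
  then have G0: "G 1 = 0" using G1 LIMSEQ_unique by blast
  define q where "q s = 1 - 2 * npow 2 s" for s
  define g where "g s = (if s = 1 then deriv G 1 else (G s - G 1) / (s - 1))" for s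
  define k where "k s = (if s = 1 then deriv q 1 else (q s - q 1) / (s - 1))" for s
  have "q holomorphic_on UNIV" unfolding q_def by (intro holomorphic_intros)
  then have k: "k holomorphic_on UNIV" unfolding k_def by (rule pole_lemma_open) simp
  have g: "g holomorphic_on {s. Re s > 0}" unfolding g_def by (rule pole_lemma_open[OF G(1) op])
  have q1: "q 1 = 0" unfolding q_def by (simp add: npow_2_1)
  have knz: "k s \<noteq> 0" if "s \<in> ball 2 2" for s
  proof (cases "s = 1")
    case True
    have "deriv q 1 = of_real (ln 2)" unfolding q_def by (rule deriv_one_minus_two_npow)
    then show ?thesis using True by (simp add: k_def)
  next
    case False
    then show ?thesis using one_minus_two_npow_nonzero[OF that False] q1 unfolding k_def by (simp add: q_def)
  qed
  have "(\<lambda>s. g s / k s) holomorphic_on ball 2 2"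
    using knz ball_2_2_Re_pos
    by (intro holomorphic_intros holomorphic_on_subset[OF g] holomorphic_on_subset[OF k]) auto
  moreover have "g s / k s = Lprod b s" if "Re s > 1" "s \<in> ball 2 2" for s
  proof -
    have "s \<noteq> 1" using that by auto
    then show ?thesis using G(2)[OF that(1)] G0 q1 one_minus_two_npow_nonzero[OF that(2)]
      by (simp add: g_def k_def q_def)
  qed
  \<comment> \<open>Agreement with \<open>Lprod\<close> is claimed on all of Re s > 1, so outside
    the disc the extension is defined by it.\<close>
  moreover have "(\<lambda>s. if s \<in> ball 2 2 then g s / k s else Lprod b s) holomorphic_on ball 2 2"
    by (rule holomorphic_transform[OF calculation(1)]) simp
  ultimately show ?thesis
    by (intro exI[of _ "\<lambda>s. if s \<in> ball 2 2 then g s / k s else Lprod b s"]) simp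
qed

lemma cmon_inverse_euler_factor:
  assumes "b > 0" "prime p"
  shows "cmon (\<lambda>s. 1 / euler_factor b p s)"
proof -
  obtain f r where fr: "f > 0" "\<And>s. euler_factor b p s = (1 - npow p s ^ f) ^ r"
    using euler_factor_eq[OF assms] by (elim exE conjE) simp
  have p: "p \<ge> 2" using prime_ge_2_nat[OF assms(2)] .
  then have "p ^ f \<ge> 2" using fr(1) self_le_power[of p f] by simp
  then have "cmon (\<lambda>s. (1 / (1 - npow (p ^ f) s)) ^ r)" by (intro cmon_power cmon_geometric)
  then show ?thesis using p by (simp add: fr(2) npow_nat_power power_divide)
qed

text \<open>On the small ball, F times the truncated product is the uniform limit of the products of
  1 / \<open>euler_factor\<close> over P < p \<le> P + Q. These have alternating derivatives, and at
  2 they are at least 1 because each reciprocal factor lies in (0, 1].\<close>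

lemma cmon_Lprod_part:
  assumes b: "b > 0" and F: "F holomorphic_on ball 2 2" "\<And>s. Re s > 1 \<Longrightarrow> F s = Lprod b s"
  shows "cmon (\<lambda>s. F s * euler_part b P s) \<and> 1 \<le> Re (F 2 * euler_part b P 2)"
proof -
  let ?B = "ball (2::complex) (1/2)"
  define R where "R s = F s * euler_part b P s" for s
  define V where "V Q s = (\<Prod>p | prime p \<and> P < p \<and> p \<le> P + Q. 1 / euler_factor b p s)" for Q s
  have R22: "R holomorphic_on ball 2 2" unfolding R_def by (intro holomorphic_intros F(1))
  have B1: "Re s > 1" if "s \<in> ?B" for s using ball_2_half[OF that] by simp
  have V: "V Q s = R s / (F s * euler_part b (P + Q) s)" if s: "s \<in> ?B" for Q s
  proof -
    have "{p. prime p \<and> p \<le> P + Q} = {p. prime p \<and> p \<le> P} \<union> {p. prime p \<and> P < p \<and> p \<le> P + Q}" by auto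
    then have "euler_part b (P + Q) s = euler_part b P s * (\<Prod>p | prime p \<and> P < p \<and> p \<le> P + Q. euler_factor b p s)"
      unfolding euler_part_def by (simp only:) (rule prod.union_disjoint; auto)
    moreover have "F s \<noteq> 0" using F(2) B1[OF s] Lprod_nonzero[OF b] by simp
    moreover have "euler_part b P s \<noteq> 0" using euler_part_nonzero[OF b] B1[OF s] by simp
    ultimately show ?thesis unfolding V_def R_def by (simp add: prod_dividef)
  qed
  have lim1: "uniform_limit ?B (\<lambda>Q s. F s * euler_part b (P + Q) s) (\<lambda>_. 1) sequentially"
  proof -
    have "uniform_limit {s. Re s \<ge> 3/2} (\<lambda>Q s. Lprod b s * euler_part b Q s) (\<lambda>_. 1) sequentially"
      by (rule Lprod_euler[OF b]) simp
    then have "uniform_limit ?B (\<lambda>Q s. Lprod b s * euler_part b Q s) (\<lambda>_. 1) sequentially"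
      by (rule uniform_limit_on_subset) (use ball_2_half in auto)
    then have "uniform_limit ?B (\<lambda>Q s. Lprod b s * euler_part b (P + Q) s) (\<lambda>_. 1) sequentially"
      unfolding uniform_limit_sequentially_iff by (meson trans_le_add2)
    then show ?thesis using F(2) B1 by (subst uniform_limit_cong'[where g = "\<lambda>Q s. Lprod b s * euler_part b (P + Q) s" and i = "\<lambda>_. 1"]) auto
  qed
  have "bounded (R ` cball 2 (1/2))"
    by (intro compact_imp_bounded compact_continuous_image holomorphic_on_imp_continuous_on
        holomorphic_on_subset[OF R22]) (auto simp: subset_iff)
  then have bdd: "bounded (R ` ?B)" by (rule bounded_subset) auto
  have "uniform_limit ?B (\<lambda>Q s. R s / (F s * euler_part b (P + Q) s)) (\<lambda>s. R s / 1) sequentially"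
    by (rule uniform_lim_divide[OF uniform_limit_const lim1 bdd, of 1]) simp_all
  then have limV: "uniform_limit ?B V R sequentially"
    using V by (subst uniform_limit_cong'[where g = "\<lambda>Q s. R s / (F s * euler_part b (P + Q) s)" and i = R]) auto
  have "cmon R"
  proof (rule cmon_limit[OF limV])
    show "cmon (V Q)" for Q
      unfolding V_def by (intro cmon_prod cmon_inverse_euler_factor b) auto
    show "R holomorphic_on ?B" by (rule holomorphic_on_subset[OF R22]) auto
  qed
  moreover have "1 \<le> Re (R 2)"
  proof -
    have "(\<lambda>Q. V Q 2) \<longlonglongrightarrow> R 2" using tendsto_uniform_limitI[OF limV] by simp
    then have l: "(\<lambda>Q. Re (V Q 2)) \<longlonglongrightarrow> Re (R 2)" by (rule tendsto_Re)
    have "1 \<le> Re (V Q 2)" for Q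
    proof -
      have "\<exists>v\<ge>1. (\<Prod>p\<in>A. 1 / euler_factor b p 2) = of_real v" if "finite A" "\<And>p. p \<in> A \<Longrightarrow> prime p" for A
        using that
      proof (induction A rule: finite_induct)
        case empty
        show ?case by (intro exI[of _ 1]) simp
      next
        case (insert p A)
        then obtain v where v: "v \<ge> 1" "(\<Prod>p\<in>A. 1 / euler_factor b p 2) = of_real v" by auto
        obtain w where w: "euler_factor b p (of_real 2) = of_real w" "0 < w" "w \<le> 1"
          using real_euler_factor[OF b, of p 2] insert.prems by auto
        have "1 * 1 \<le> v * (1 / w)" using v w by (intro mult_mono) (auto simp: field_simps)
        then show ?case using insert.hyps v w by (intro exI[of _ "v / w"]) (simp add: mult.commute)
      qed
      note * = this
      have "finite {p. prime p \<and> P < p \<and> p \<le> P + Q}" by (rule finite_subset[of _ "{..P + Q}"]) auto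
      then have "\<exists>v\<ge>1. V Q 2 = of_real v" unfolding V_def by (rule *) simp
      then show ?thesis by (elim exE conjE) simp
    qed
    then show ?thesis using LIMSEQ_le_const[OF l, of 1] by auto
  qed
  ultimately show ?thesis unfolding R_def by simp
qed

lemma Lser_principal_ge:
  assumes b: "b > 0" and \<sigma>: "\<sigma> > 1"
  shows "(\<Sum>n=1..J. Re (principal_char b n) * real n powr (- \<sigma>)) \<le> Re (Lser (principal_char b) (of_real \<sigma>))"
proof -
  let ?t = "\<lambda>N. \<Sum>n=1..N. Re (principal_char b n) * real n powr (- \<sigma>)"
  have "(\<lambda>N. \<Sum>n=1..N. principal_char b n * npow n (of_real \<sigma>)) \<longlonglongrightarrow> Lser (principal_char b) (of_real \<sigma>)"
    by (rule Lser_LIMSEQ[OF dirichlet_char_principal b]) (use \<sigma> in simp)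
  then have "(\<lambda>N. Re (\<Sum>n=1..N. principal_char b n * npow n (of_real \<sigma>))) \<longlonglongrightarrow> Re (Lser (principal_char b) (of_real \<sigma>))"
    by (rule tendsto_Re)
  moreover have "Re (\<Sum>n=1..N. principal_char b n * npow n (of_real \<sigma>)) = ?t N" for N
    unfolding Re_sum by (intro sum.cong) (auto simp: npow_of_real)
  ultimately have "?t \<longlonglongrightarrow> Re (Lser (principal_char b) (of_real \<sigma>))" by simp
  moreover have "incseq ?t"
    by (intro incseq_SucI) (auto simp: principal_char_def)
  ultimately show ?thesis by (rule incseq_le[rotated])
qed

text \<open>For every P, \<open>cmon_eval\<close> bounds F s times the reciprocal factors up to P
  below by 1. These are at most the corresponding factors of the principal L-series at N s, whose
  product tends to 1 / L. Only finitely many factors are evaluated at s, so s \<le> 1 is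
  allowed.\<close>

lemma Lprod_ge_principal:
  assumes b: "b > 0" and F: "F holomorphic_on ball 2 2" "\<And>s. Re s > 1 \<Longrightarrow> F s = Lprod b s"
    and s: "s \<le> 2" "real (card {\<psi>. dirichlet_char b \<psi>}) * s > 1"
  shows "Re (Lser (principal_char b) (of_real (real (card {\<psi>. dirichlet_char b \<psi>}) * s))) \<le> Re (F (of_real s))"
proof -
  let ?N = "real (card {\<psi>. dirichlet_char b \<psi>})" and ?c = "principal_char b"
  have s0: "s > 0" using s(2) by (metis mult_nonneg_nonpos not_le not_one_less_zero of_nat_0_le_iff order.strict_trans zero_less_one order_less_le_trans)
  let ?\<sigma> = "?N * s"
  define L where "L = Re (Lser ?c (of_real ?\<sigma>))"
  define \<pi>' where "\<pi>' P = (\<Prod>p | prime p \<and> p \<le> P. 1 - Re (?c p) * real p powr (- ?\<sigma>))" for P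
  have L1: "L \<ge> 1" using Lser_principal_ge[OF b s(2), of 1] unfolding L_def by (simp add: principal_char_def)
  have eq: "Lser ?c (of_real ?\<sigma>) * (\<Prod>p | prime p \<and> p \<le> P. 1 - ?c p * npow p (of_real ?\<sigma>)) =
      Lser ?c (of_real ?\<sigma>) * of_real (\<pi>' P)" for P
  proof -
    have "(\<Prod>p | prime p \<and> p \<le> P. 1 - ?c p * npow p (of_real ?\<sigma>)) =
       (\<Prod>p | prime p \<and> p \<le> P. of_real (1 - Re (?c p) * real p powr (- ?\<sigma>)))"
    proof (rule prod.cong)
      fix p assume "p \<in> {p. prime p \<and> p \<le> P}"
      then have "p > 0" using prime_gt_0_nat by simp
      then show "1 - ?c p * npow p (of_real ?\<sigma>) = of_real (1 - Re (?c p) * real p powr (- ?\<sigma>))"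
        unfolding npow_of_real[OF \<open>p > 0\<close>] by (simp add: principal_char_def)
    qed simp
    then show ?thesis unfolding \<pi>'_def by simp
  qed
  have "norm (Lser ?c (of_real ?\<sigma>) * (\<Prod>p | prime p \<and> p \<le> P. 1 - ?c p * npow p (of_real ?\<sigma>)) - 1) \<le> powr_tail ?\<sigma> P" for P
    by (rule Lser_euler[OF dirichlet_char_principal b s(2)]) simp
  then have "norm (Lser ?c (of_real ?\<sigma>) * of_real (\<pi>' P) - 1) \<le> powr_tail ?\<sigma> P" for P
    unfolding eq .
  moreover have "\<bar>L * \<pi>' P - 1\<bar> \<le> norm (Lser ?c (of_real ?\<sigma>) * of_real (\<pi>' P) - 1)" for P
    using abs_Re_le_cmod[of "Lser ?c (of_real ?\<sigma>) * of_real (\<pi>' P) - 1"] by (simp add: L_def)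
  ultimately have "norm (L * \<pi>' P - 1) \<le> powr_tail ?\<sigma> P" for P
    unfolding real_norm_def using order.trans by blast
  then have "(\<lambda>P. L * \<pi>' P - 1) \<longlonglongrightarrow> 0"
    by (intro Lim_null_comparison[OF _ powr_tail_tendsto_0[OF s(2)]] always_eventually allI)
  from tendsto_add[OF this tendsto_const[of 1]] have lim: "(\<lambda>P. L * \<pi>' P) \<longlonglongrightarrow> 1" by simp
  have ge: "1 \<le> Re (F (of_real s)) * \<pi>' P \<and> 0 \<le> \<pi>' P" for P
  proof -
    let ?A = "{p. prime p \<and> p \<le> P}"
    have "\<forall>p\<in>?A. \<exists>v. euler_factor b p (of_real s) = of_real v \<and> 0 < v \<and> v \<le> 1 - Re (?c p) * real p powr (- ?\<sigma>)"
    proof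
      fix p assume "p \<in> ?A"
      then obtain v where "euler_factor b p (of_real s) = of_real v \<and> 0 < v \<and> v \<le> 1 \<and>
        (coprime p b \<longrightarrow> v \<le> 1 - real p powr (- real (card {\<psi>. dirichlet_char b \<psi>}) * s))"
        using real_euler_factor[OF b _ s0, of p] by blast
      then show "\<exists>v. euler_factor b p (of_real s) = of_real v \<and> 0 < v \<and> v \<le> 1 - Re (?c p) * real p powr (- ?\<sigma>)"
        by (intro exI[of _ v]) (simp add: principal_char_def)
    qed
    from bchoice[OF this] obtain v where v: "\<forall>p\<in>?A. euler_factor b p (of_real s) = of_real (v p) \<and> 0 < v p \<and>
        v p \<le> 1 - Re (?c p) * real p powr (- ?\<sigma>)" by blast
    have "euler_part b P (of_real s) = of_real (\<Prod>p\<in>?A. v p)"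
      unfolding euler_part_def of_real_prod using v by (intro prod.cong) auto
    then have eq: "Re (F (of_real s) * euler_part b P (of_real s)) = Re (F (of_real s)) * (\<Prod>p\<in>?A. v p)" by (simp del: of_real_prod)
    have cm: "cmon (\<lambda>s. F s * euler_part b P s)" "1 \<le> Re (F 2 * euler_part b P 2)"
      using cmon_Lprod_part[OF b F] by blast+
    have "Re (F 2 * euler_part b P 2) \<le> Re (F (of_real s) * euler_part b P (of_real s))"
      by (rule cmon_eval[OF cm(1) _ s0 s(1)]) (intro holomorphic_intros F(1))
    then have 1: "1 \<le> Re (F (of_real s)) * (\<Prod>p\<in>?A. v p)" using cm(2) eq by linarith
    have vpos: "0 < (\<Prod>p\<in>?A. v p)" using v by (intro prod_pos) auto
    have "0 < Re (F (of_real s))"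
      using 1 vpos zero_less_mult_pos2[of "Re (F (of_real s))" "\<Prod>p\<in>?A. v p"] by linarith
    moreover have le: "(\<Prod>p\<in>?A. v p) \<le> \<pi>' P" unfolding \<pi>'_def using v by (intro prod_mono) (auto intro: less_imp_le)
    ultimately have "Re (F (of_real s)) * (\<Prod>p\<in>?A. v p) \<le> Re (F (of_real s)) * \<pi>' P" by (intro mult_left_mono) simp_all
    then show ?thesis using 1 vpos le by linarith
  qed
  have "L \<le> Re (F (of_real s)) * 1"
  proof (rule LIMSEQ_le)
    show "(\<lambda>P. L) \<longlonglongrightarrow> L" by simp
    show "(\<lambda>P. Re (F (of_real s)) * (L * \<pi>' P)) \<longlonglongrightarrow> Re (F (of_real s)) * 1"
      by (intro tendsto_mult tendsto_const lim)
    have "L * 1 \<le> L * (Re (F (of_real s)) * \<pi>' P)" for P using ge[of P] L1 by (intro mult_left_mono) auto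
    then show "\<exists>N. \<forall>P\<ge>N. L \<le> Re (F (of_real s)) * (L * \<pi>' P)" by (simp add: mult_ac)
  qed
  then show ?thesis unfolding L_def by simp
qed

text \<open>The numbers 1 + b j with j \<ge> 1 are coprime to b, and their reciprocals are at least
  1 / ((1 + b) j).\<close>

lemma harmonic_ap_unbounded:
  assumes "b > 0"
  shows "\<exists>J. (\<Sum>n=1..J. Re (principal_char b n) * real n powr - 1) > K"
proof (rule ccontr)
  assume "\<not> ?thesis"
  then have K: "(\<Sum>n=1..J. Re (principal_char b n) * real n powr - 1) \<le> K" for J by (simp add: not_less)
  have "(\<Sum>j<m. 1 / real (1 + b * Suc j)) \<le> K" for m
  proof -
    have "(\<Sum>j<m. 1 / real (1 + b * Suc j)) = (\<Sum>n\<in>(\<lambda>j. 1 + b * Suc j) ` {..<m}. Re (principal_char b n) * real n powr - 1)"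
    proof (subst sum.reindex)
      show "inj_on (\<lambda>j. 1 + b * Suc j) {..<m}" using assms by (auto simp: inj_on_def)
      have "[1 = 1 + b * Suc j] (mod b)" for j
        unfolding cong_def by (rule mod_mult_self2[symmetric])
      then have "coprime (1 + b * Suc j) b" for j by (rule cong_imp_coprime) simp
      then show "(\<Sum>j<m. 1 / real (1 + b * Suc j)) =
          sum ((\<lambda>n. Re (principal_char b n) * real n powr - 1) \<circ> (\<lambda>j. 1 + b * Suc j)) {..<m}"
        by (intro sum.cong) (simp_all add: principal_char_def powr_minus_divide del: mult_Suc_right)
    qed
    also have "\<dots> \<le> (\<Sum>n=1..1 + b * m. Re (principal_char b n) * real n powr - 1)"
    proof (rule sum_mono2)
      show "(\<lambda>j. 1 + b * Suc j) ` {..<m} \<subseteq> {1..1 + b * m}"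
        by (auto simp del: mult_Suc_right intro: mult_le_mono2)
    qed (auto simp: principal_char_def)
    also have "\<dots> \<le> K" by (rule K)
    finally show ?thesis .
  qed
  then have "summable (\<lambda>j. 1 / real (1 + b * Suc j))"
    by (intro summableI_nonneg_bounded[of _ K]) simp_all
  then have "summable (\<lambda>j. real (1 + b) * (1 / real (1 + b * Suc j)))" by (rule summable_mult)
  then have "summable (\<lambda>j. 1 / real (Suc j))"
  proof (rule summable_comparison_test'[where N = 0])
    fix j :: nat
    have "1 * real (1 + b * Suc j) \<le> real (1 + b) * real (Suc j)"
      by (simp add: algebra_simps)
    then have "1 / real (Suc j) \<le> real (1 + b) / real (1 + b * Suc j)"
      by (subst frac_le_eq) (auto simp: divide_le_0_iff simp del: of_nat_Suc of_nat_add of_nat_mult mult_Suc_right)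
    then show "norm (1 / real (Suc j)) \<le> real (1 + b) * (1 / real (1 + b * Suc j))" by simp
  qed
  then have "summable (\<lambda>j. 1 / real j)" by (rule summable_Suc_iff[of "\<lambda>n. 1 / real n", THEN iffD1])
  then show False using not_summable_harmonic[where 'a = real] by (simp add: inverse_eq_divide)
qed

theorem sum_primes_1_mod_unbounded:
  assumes b: "b > 0"
  shows "\<exists>P. (\<Sum>p | prime p \<and> p \<le> P \<and> [p = 1] (mod b). 1 / real p) > S"
proof (rule ccontr)
  assume "\<not> ?thesis"
  then have "(\<Sum>p | prime p \<and> p \<le> P \<and> [p = 1] (mod b). 1 / real p) \<le> S" for P by (simp add: not_less)
  from Lprod_bounded[OF b this] obtain K where "\<And>s. s > 1 \<Longrightarrow> norm (Lprod b (of_real s)) \<le> K" by blast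
  from Lprod_extension[OF b this] obtain F where F: "F holomorphic_on ball 2 2" "\<And>s. Re s > 1 \<Longrightarrow> F s = Lprod b s"
    by blast
  let ?n = "card {\<psi>. dirichlet_char b \<psi>}"
  have "?n > 0" using finite_dirichlet_char[OF b] dirichlet_char_principal[of b] by (auto simp: card_gt_0_iff)
  then have N: "real ?n \<ge> 1" by simp
  \<comment> \<open>N times \<open>u k\<close> is 1 + 1/(k + 1), so these points tend to 1/N from
    the right, and 1/N is interior to the disc on which F is continuous.\<close>
  define u where "u k = (1 + 1 / real (Suc k)) / real ?n" for k
  have u2: "u k \<le> 2" "real ?n * u k > 1" for k
  proof -
    have "1 / real (Suc k) \<le> 1" by simp
    then have "1 + 1 / real (Suc k) \<le> 2 * real ?n" using N by linarith
    then show "u k \<le> 2" unfolding u_def using N by (simp add: divide_le_eq)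
    show "real ?n * u k > 1" unfolding u_def using N by simp
  qed
  have "(\<lambda>k. (1 + 1 / real (Suc k)) / real ?n) \<longlonglongrightarrow> (1 + 0) / real ?n"
    using N by (intro tendsto_divide tendsto_add tendsto_const LIMSEQ_Suc lim_1_over_n) simp
  then have u: "u \<longlonglongrightarrow> 1 / real ?n" unfolding u_def by simp
  have "norm (2 - complex_of_real (1 / real ?n)) < 2"
  proof -
    have "norm (2 - complex_of_real (1 / real ?n)) = \<bar>2 - 1 / real ?n\<bar>"
      using norm_of_real[of "2 - 1 / real ?n", where 'a = complex] by simp
    also have "0 < 1 / real ?n" "1 / real ?n \<le> 1" using N by auto
    then have "\<bar>2 - 1 / real ?n\<bar> < 2" by linarith
    finally show ?thesis .
  qed
  then have "isCont F (of_real (1 / real ?n))"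
    using holomorphic_on_imp_continuous_on[OF F(1)]
    by (simp add: continuous_on_eq_continuous_at dist_norm)
  moreover have "(\<lambda>k. complex_of_real (u k)) \<longlonglongrightarrow> of_real (1 / real ?n)" using u by (rule tendsto_of_real)
  ultimately have "(\<lambda>k. F (of_real (u k))) \<longlonglongrightarrow> F (of_real (1 / real ?n))" by (rule isCont_tendsto_compose)
  then have limF: "(\<lambda>k. Re (F (of_real (u k)))) \<longlonglongrightarrow> Re (F (of_real (1 / real ?n)))" by (rule tendsto_Re)
  \<comment> \<open>For fixed J the partial sum is continuous in the exponent and bounded by F at
    \<open>u k\<close>; in the limit F at 1/N bounds all harmonic sums over integers coprime to
    b.\<close>
  have "(\<Sum>n=1..J. Re (principal_char b n) * real n powr - 1) \<le> Re (F (of_real (1 / real ?n)))" for J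
  proof (rule LIMSEQ_le[OF _ limF])
    have nu: "(\<lambda>k. - (real ?n * u k)) \<longlonglongrightarrow> - (real ?n * (1 / real ?n))" by (intro tendsto_intros u)
    show "(\<lambda>k. \<Sum>n=1..J. Re (principal_char b n) * real n powr (- (real ?n * u k)))
        \<longlonglongrightarrow> (\<Sum>n=1..J. Re (principal_char b n) * real n powr - 1)"
    proof (rule tendsto_sum)
      fix n assume "n \<in> {1..J}"
      then have "(\<lambda>k. Re (principal_char b n) * real n powr (- (real ?n * u k)))
          \<longlonglongrightarrow> Re (principal_char b n) * real n powr (- (real ?n * (1 / real ?n)))"
        by (intro tendsto_mult tendsto_const tendsto_powr nu) auto
      then show "(\<lambda>k. Re (principal_char b n) * real n powr (- (real ?n * u k)))
          \<longlonglongrightarrow> Re (principal_char b n) * real n powr - 1" using N by simp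
    qed
    show "\<exists>M. \<forall>k\<ge>M. (\<Sum>n=1..J. Re (principal_char b n) * real n powr (- (real ?n * u k))) \<le> Re (F (of_real (u k)))"
      using Lser_principal_ge[OF b u2(2)] Lprod_ge_principal[OF b F u2] order.trans by blast
  qed
  then show False using harmonic_ap_unbounded[OF b, of "Re (F (of_real (1 / real ?n)))"] by (simp add: not_less[symmetric])
qed

section \<open>Gcd matrices over sequences containing an arithmetic progression\<close>

lemma one_mod_iff: "[z = 1] (mod b) \<longleftrightarrow> (\<exists>k. z = 1 + b * k)" if "z > (0::nat)"
proof
  assume "[z = 1] (mod b)"
  then have "b dvd z - 1" using that by (simp add: cong_altdef_nat)
  then obtain k where "z - 1 = b * k" by auto
  then show "\<exists>k. z = 1 + b * k" using that by (intro exI[of _ k]) simp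
next
  assume "\<exists>k. z = 1 + b * k"
  then obtain k where z: "z = 1 + b * k" by blast
  show "[z = 1] (mod b)" unfolding cong_def z by (rule mod_mult_self2)
qed

abbreviation primes_ap :: "nat \<Rightarrow> nat set" where
  "primes_ap b \<equiv> {p. prime p \<and> (\<exists>k. p = 1 + b * k)}"

lemma primes_ap_iff: "p \<in> primes_ap b \<longleftrightarrow> prime p \<and> [p = 1] (mod b)"
  using one_mod_iff[of p b] prime_gt_0_nat[of p] by auto

text \<open>Licenses the facts on \<open>enumerate\<close> used below, which are those for infinite
  sets.\<close>

lemma infinite_primes_ap:
  assumes "b > 0"
  shows "infinite (primes_ap b)"
proof
  assume fin: "finite (primes_ap b)"
  obtain P where "(\<Sum>p | prime p \<and> p \<le> P \<and> [p = 1] (mod b). 1 / real p) > (\<Sum>p\<in>primes_ap b. 1 / real p)"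
    using sum_primes_1_mod_unbounded[OF assms] by blast
  moreover have "(\<Sum>p | prime p \<and> p \<le> P \<and> [p = 1] (mod b). 1 / real p) \<le> (\<Sum>p\<in>primes_ap b. 1 / real p)"
    by (rule sum_mono2[OF fin]) (use primes_ap_iff in auto)
  ultimately show False by simp
qed

lemma prime_ap_mem: "b > 0 \<Longrightarrow> prime_ap b i \<in> primes_ap b"
  unfolding prime_ap_def using enumerate_in_set[OF infinite_primes_ap] .

lemma prime_ap_inj: "b > 0 \<Longrightarrow> i \<ge> 1 \<Longrightarrow> j \<ge> 1 \<Longrightarrow> prime_ap b i = prime_ap b j \<Longrightarrow> i = j"
  using strict_mono_eq[OF strict_mono_enumerate[OF infinite_primes_ap], of b "i - 1" "j - 1"]
  unfolding prime_ap_def by simp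

lemma prime_ap_ge: "b > 0 \<Longrightarrow> i - 1 \<le> prime_ap b i"
  unfolding prime_ap_def by (rule le_enumerate[OF infinite_primes_ap])

lemma prime_ap_surj:
  assumes "b > 0" "p \<in> primes_ap b"
  obtains i where "i \<ge> 1" "prime_ap b i = p"
proof -
  obtain n where "enumerate (primes_ap b) n = p"
    using enumerate_Ex[OF infinite_primes_ap[OF assms(1)] assms(2)] by blast
  then show thesis using that[of "Suc n"] by (simp add: prime_ap_def)
qed

lemma sum_inverse_prime_ap_unbounded:
  assumes b: "b > 0"
  shows "filterlim (\<lambda>N. \<Sum>i=1..N. 1 / real (prime_ap b i)) at_top sequentially"
  unfolding filterlim_at_top
proof
  fix Z :: real
  obtain P where P: "(\<Sum>p | prime p \<and> p \<le> P \<and> [p = 1] (mod b). 1 / real p) > Z"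
    using sum_primes_1_mod_unbounded[OF b] by blast
  have "Z \<le> (\<Sum>i=1..N. 1 / real (prime_ap b i))" if N: "N \<ge> Suc P" for N
  proof -
    have inj: "inj_on (prime_ap b) {1..N}" by (rule inj_onI) (auto dest: prime_ap_inj[OF b, rotated 2])
    have "{p. prime p \<and> p \<le> P \<and> [p = 1] (mod b)} \<subseteq> prime_ap b ` {1..N}"
    proof
      fix p assume p: "p \<in> {p. prime p \<and> p \<le> P \<and> [p = 1] (mod b)}"
      then obtain i where i: "i \<ge> 1" "prime_ap b i = p" using prime_ap_surj[OF b, of p] primes_ap_iff by blast
      then have "i - 1 \<le> P" using prime_ap_ge[OF b, of i] p by simp
      then show "p \<in> prime_ap b ` {1..N}" using i N by auto
    qed
    then have "(\<Sum>p | prime p \<and> p \<le> P \<and> [p = 1] (mod b). 1 / real p) \<le> (\<Sum>p\<in>prime_ap b ` {1..N}. 1 / real p)"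
      by (intro sum_mono2) auto
    also have "\<dots> = (\<Sum>i=1..N. 1 / real (prime_ap b i))" by (subst sum.reindex[OF inj]) (simp add: o_def)
    finally show ?thesis using P by simp
  qed
  then show "\<forall>\<^sub>F N in sequentially. Z \<le> (\<Sum>i=1..N. 1 / real (prime_ap b i))"
    by (intro eventually_sequentiallyI[of "Suc P"])
qed

text \<open>By 1 - t \<le> exp (- t), a block of indices with large sum of 1 / k makes the product
  small; starting the block late keeps the primes above \<open>lo\<close> and, by divergence, still
  allows a large sum.\<close>

lemma prod_one_minus_small:
  fixes k :: "nat \<Rightarrow> real"
  assumes b: "b > 0" and lim: "filterlim (\<lambda>N. \<Sum>i=1..N. 1 / k (prime_ap b i)) at_top sequentially"
    and k: "\<And>p. p \<in> primes_ap b \<Longrightarrow> k p \<ge> 1" and \<epsilon>: "\<epsilon> > 0"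
  shows "\<exists>S. finite S \<and> S \<subseteq> primes_ap b \<and> (\<forall>p\<in>S. p > lo) \<and> (\<Prod>p\<in>S. 1 - 1 / k p) < \<epsilon>"
proof -
  let ?s = "\<lambda>i. 1 / k (prime_ap b i)"
  define N0 where "N0 = lo + 2"
  \<comment> \<open>A block sum of at least 1 - ln \<epsilon> bounds the product by exp (ln
    \<epsilon> - 1), which is below \<epsilon>.\<close>
  have "\<forall>\<^sub>F N in sequentially. (\<Sum>i=1..N0. ?s i) + (1 - ln \<epsilon>) \<le> (\<Sum>i=1..N. ?s i) \<and> N0 \<le> N"
    using lim unfolding filterlim_at_top by (intro eventually_conj eventually_ge_at_top) blast
  then obtain N where N: "(\<Sum>i=1..N0. ?s i) + (1 - ln \<epsilon>) \<le> (\<Sum>i=1..N. ?s i)" "N0 \<le> N"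
    by (auto simp: eventually_sequentially)
  have "{1..N} = {1..N0} \<union> {N0<..N}" using N(2) by (auto simp: N0_def)
  then have "(\<Sum>i=1..N. ?s i) = (\<Sum>i=1..N0. ?s i) + (\<Sum>i\<in>{N0<..N}. ?s i)"
    by (simp only:) (rule sum.union_disjoint; auto)
  then have big: "(\<Sum>i\<in>{N0<..N}. ?s i) \<ge> 1 - ln \<epsilon>" using N(1) by simp
  define S where "S = prime_ap b ` {N0<..N}"
  have inj: "inj_on (prime_ap b) {N0<..N}" by (rule inj_onI) (auto dest: prime_ap_inj[OF b, rotated 2])
  have sub: "S \<subseteq> primes_ap b" unfolding S_def using prime_ap_mem[OF b] by blast
  have "(\<Prod>p\<in>S. 1 - 1 / k p) \<le> (\<Prod>p\<in>S. exp (- (1 / k p)))"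
  proof (intro prod_mono conjI)
    fix p assume "p \<in> S"
    then have "k p \<ge> 1" using sub k by blast
    then show "0 \<le> 1 - 1 / k p" by simp
    show "1 - 1 / k p \<le> exp (- (1 / k p))" using exp_ge_add_one_self[of "- (1 / k p)"] by simp
  qed
  also have "\<dots> = exp (- (\<Sum>p\<in>S. 1 / k p))" by (subst exp_sum[symmetric]) (simp_all add: S_def sum_negf)
  also have "(\<Sum>p\<in>S. 1 / k p) = (\<Sum>i\<in>{N0<..N}. ?s i)" unfolding S_def by (simp add: sum.reindex[OF inj])
  also have "exp (- (\<Sum>i\<in>{N0<..N}. ?s i)) \<le> exp (ln \<epsilon> - 1)" using big by simp
  also have "\<dots> < exp (ln \<epsilon>)" by simp
  also have "\<dots> = \<epsilon>" using \<epsilon> by simp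
  finally have "(\<Prod>p\<in>S. 1 - 1 / k p) < \<epsilon>" .
  moreover have "p > lo" if pS: "p \<in> S" for p
  proof -
    obtain i where "i \<in> {N0<..N}" "p = prime_ap b i" using pS unfolding S_def by blast
    then show ?thesis using prime_ap_ge[OF b, of i] unfolding N0_def by auto
  qed
  ultimately show ?thesis using sub by (intro exI[of _ S]) (simp add: S_def)
qed

section \<open>Eigenvalue estimates for the gcd matrices\<close>

lemma multiplicative_imp_prime_multiplicative:
  assumes "multiplicative f" "f 1 = 1"
  shows "prime_multiplicative f"
  unfolding prime_multiplicative_def
proof (intro conjI allI impI assms(2))
  fix p m :: nat assume p: "prime p" "m > 0" "\<not> p dvd m"
  then have "gcd p m = 1" using prime_imp_coprime[of p m] by simp
  then show "f (p * m) = f p * f m" using assms(1)[unfolded multiplicative_def, rule_format, of p m] p(2) prime_gt_0_nat[OF p(1)] by simp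
qed

text \<open>For z = 1 + b t one has a z = a + b (a t), and z > b e gives a t \<ge> t \<ge>
  e.\<close>

lemma progression_contains_multiple:
  fixes a b e z :: nat
  assumes a: "a \<ge> 1" and b: "b > 0" and ap: "\<And>t. t \<ge> e \<Longrightarrow> \<exists>i. x (Suc i) = a + b * t"
    and z: "[z = 1] (mod b)" "z > b * e"
  shows "\<exists>i. x (Suc i) = a * z"
proof -
  obtain t where t: "z = 1 + b * t" using one_mod_iff[of z b] z by auto
  have "b * e \<le> b * t" using z(2) t by linarith
  then have "e \<le> t" using b by simp
  also have "t \<le> a * t" using a by simp
  finally obtain i where "x (Suc i) = a + b * (a * t)" using ap by blast
  then show ?thesis unfolding t by (intro exI[of _ i]) (simp add: algebra_simps)
qed

text \<open>The fixed powers of \<open>p0\<close> separate the supports of the test vectors.\<close>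

lemma eigenvalue_small:
  fixes h g :: "nat \<Rightarrow> complex" and k :: "nat \<Rightarrow> real" and x :: "nat \<Rightarrow> nat" and a b e q :: nat
  assumes a: "a \<ge> 1" and b: "b > 0" and q: "q \<ge> 1"
    and x: "\<And>i. x (Suc i) > 0" and ap: "\<And>t. t \<ge> e \<Longrightarrow> \<exists>i. x (Suc i) = a + b * t"
    and h: "prime_multiplicative h" and g: "\<And>m. m > 0 \<Longrightarrow> h m = (\<Sum>t | t dvd m. g t)" "\<And>t i. t dvd x (Suc i) \<Longrightarrow> 0 \<le> g t"
    and k: "\<And>p. p \<in> primes_ap b \<Longrightarrow> h p = of_real (k p) \<and> k p \<ge> 1"
    and lim: "filterlim (\<lambda>N. \<Sum>i=1..N. 1 / k (prime_ap b i)) at_top sequentially"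
    and eig: "\<And>n. n \<ge> 1 \<Longrightarrow> ordered_eigenvalues (gcd_matrix h x n) (eig n)"
  shows "(\<lambda>n. eig n q) \<longlonglongrightarrow> 0"
proof (rule LIMSEQ_I)
  fix r :: real assume r: "r > 0"
  define p0 where "p0 = prime_ap b 1"
  have p0: "prime p0" "[p0 = 1] (mod b)" using prime_ap_mem[OF b, of 1] unfolding p0_def primes_ap_iff by blast+
  \<comment> \<open>The exponent b e + 1 makes the power of p0 exceed b e, so that the products
    formed with it land in the progression; the added j yields q different bases.\<close>
  define y where "y j = a * p0 ^ (b * e + 1 + j)" for j
  have y0: "y j > 0" for j unfolding y_def using a prime_gt_0_nat[OF p0(1)] by simp
  define H where "H = (\<Sum>j<q. norm (h (y j)))"
  have H0: "H \<ge> 0" unfolding H_def by (intro sum_nonneg) simp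
  \<comment> \<open>\<open>H\<close> bounds h at all q bases at once, and H + 1 avoids division by
    0.\<close>
  define \<epsilon> where "\<epsilon> = r / (real q * (H + 1))"
  have "\<epsilon> > 0" unfolding \<epsilon>_def using r q H0 by simp
  \<comment> \<open>Primes above a + p0 divide neither a nor a power of p0, hence no
    \<open>y j\<close>.\<close>
  then obtain S where S: "finite S" "S \<subseteq> primes_ap b" "\<forall>p\<in>S. p > a + p0" "(\<Prod>p\<in>S. 1 - 1 / k p) < \<epsilon>"
    using prod_one_minus_small[OF b lim, of \<epsilon> "a + p0"] k by blast
  define \<rho> where "\<rho> = (\<Prod>p\<in>S. 1 - 1 / k p)"
  have \<rho>0: "0 \<le> \<rho>" unfolding \<rho>_def
  proof (rule prod_nonneg)
    fix p assume "p \<in> S"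
    then have "k p \<ge> 1" using k[OF subsetD[OF S(2)]] by blast
    then show "0 \<le> 1 - 1 / k p" by simp
  qed
  have Spr: "prime p" "[p = 1] (mod b)" if "p \<in> S" for p
    using primes_ap_iff[THEN iffD1, OF subsetD[OF S(2) that]] by blast+
  have Sp: "prime p \<and> \<not> p dvd y j" if "p \<in> S" for p j
  proof -
    have p: "prime p" "p > a" "p \<noteq> p0" using Spr(1)[OF that] bspec[OF S(3) that] by auto
    have "\<not> p dvd a" using p(2) a by (auto dest: dvd_imp_le)
    moreover have "\<not> p dvd p0 ^ (b * e + 1 + j)"
      using p(1,3) p0(1) prime_dvd_power primes_dvd_imp_eq by blast
    ultimately show ?thesis using p(1) unfolding y_def by (simp add: prime_dvd_mult_iff)
  qed
  have "\<exists>i. x (Suc i) = y j * \<Prod>A" if A: "A \<subseteq> S" for A j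
  proof -
    define z where "z = p0 ^ (b * e + 1 + j) * \<Prod>A"
    have A0: "\<Prod>A > 0" by (rule prod_pos) (use prime_gt_0_nat[OF Spr(1)] A in blast)
    have "[\<Prod>A = (\<Prod>p\<in>A. 1)] (mod b)" using Spr(2) A by (intro cong_prod) auto
    then have "[z = 1 ^ (b * e + 1 + j) * 1] (mod b)"
      unfolding z_def by (intro cong_mult cong_pow p0(2)) simp
    then have "[z = 1] (mod b)" by simp
    moreover have "z > b * e"
    proof -
      have "b * e < b * e + 1 + j" by simp
      also have "\<dots> < p0 ^ (b * e + 1 + j)" using prime_gt_1_nat[OF p0(1)] by (intro power_gt_expt) simp
      also have "\<dots> \<le> z" unfolding z_def using A0 by simp
      finally show ?thesis .
    qed
    ultimately obtain i where "x (Suc i) = a * z" using progression_contains_multiple[OF a b ap] by blast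
    then show ?thesis unfolding y_def z_def by (auto simp: mult.assoc)
  qed
  note ex = this
  define \<phi>0 where "\<phi>0 jA = (SOME i. x (Suc i) = y (fst jA) * \<Prod>(snd jA))" for jA
  have \<phi>: "x (Suc (\<phi>0 (j, A))) = y j * \<Prod>A" if "A \<subseteq> S" for j A
    unfolding \<phi>0_def fst_conv snd_conv by (rule someI_ex) (rule ex[OF that])
  define n0 where "n0 = q + Suc (Max (\<phi>0 ` ({..<q} \<times> Pow S)))"
  have lt: "\<phi>0 (j, A) < n" if "j < q" "A \<subseteq> S" "n \<ge> n0" for j A n
  proof -
    have "\<phi>0 (j, A) \<le> Max (\<phi>0 ` ({..<q} \<times> Pow S))" using that S(1) by (intro Max_ge) auto
    then show ?thesis using that(3) unfolding n0_def by simp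
  qed
  have "norm (eig n q - 0) < r" if n: "n \<ge> n0" for n
  proof -
    define w where "w j i = (if i \<in> (\<lambda>A. \<phi>0 (j, A)) ` Pow S then \<Prod>p | p \<in> S \<and> p dvd x (Suc i). - complex_of_real (1 / k p) else 0)" for j i
    have k1: "h p = of_real (k p) \<and> k p > 0" if "p \<in> S" for p
      using k[OF subsetD[OF S(2) that]] by simp
    have form: "cinner n (w j) (mat_app n (\<lambda>i j. h (gcd (x (Suc i)) (x (Suc j)))) (w j)) = h (y j) * of_real \<rho>" "w j (\<phi>0 (j, {})) = 1"
      if "j < q" for j
      using test_vector_form[where \<phi> = "\<lambda>A. \<phi>0 (j, A)" and y = "y j" and n = n and x = x and S = S and h = h and k = k,
          OF h S(1) Sp y0 k1] \<phi> lt[OF that _ n] unfolding w_def \<rho>_def by auto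
    have E: "Re (cinner n (w j) (mat_app n (\<lambda>i j. h (gcd (x (Suc i)) (x (Suc j)))) (w j))) \<le> H * \<rho>" if "j < q" for j
    proof -
      have "Re (h (y j)) \<le> norm (h (y j))" by (rule complex_Re_le_cmod)
      also have "\<dots> \<le> H" unfolding H_def using that by (intro member_le_sum) auto
      finally show ?thesis unfolding form(1)[OF that] using \<rho>0 by (simp add: mult_right_mono)
    qed
    have w0: "w j' (\<phi>0 (j, {})) = 0" if "j < q" "j' < q" "j \<noteq> j'" for j j'
    proof -
      \<comment> \<open>A coincidence of indices would give y j = y j' times the product of A. No
        prime of \<open>S\<close> divides \<open>y j\<close>, so A is empty and the exponents of p0
        agree, against the choice of j and j'.\<close>
      have "\<phi>0 (j, {}) \<noteq> \<phi>0 (j', A)" if A: "A \<subseteq> S" for A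
      proof
        assume "\<phi>0 (j, {}) = \<phi>0 (j', A)"
        then have eq: "y j = y j' * \<Prod>A" using \<phi>[of "{}" j] \<phi>[OF A, of j'] by simp
        have "A = {}"
        proof (rule ccontr)
          assume "A \<noteq> {}"
          then obtain p where p: "p \<in> A" by blast
          then have "p dvd \<Prod>A" using A S(1) finite_subset by (intro dvd_prodI) auto
          then have "p dvd y j" unfolding eq by simp
          then show False using Sp[of p j] p A by blast
        qed
        then have "p0 ^ (b * e + 1 + j) = p0 ^ (b * e + 1 + j')" using eq a unfolding y_def by simp
        then show False using \<open>j \<noteq> j'\<close> prime_gt_1_nat[OF p0(1)] by simp
      qed
      then show ?thesis unfolding w_def by auto
    qed
    have n1: "q \<le> n" "n \<ge> 1" using n unfolding n0_def by auto
    have "0 \<le> eig n q" "eig n q \<le> real q * (H * \<rho>)"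
      by (rule gcd_matrix_eigenvalue_bound[where ix = "\<lambda>j. \<phi>0 (j, {})" and w = w, OF g x q n1(1) _ eig[OF n1(2)] E lt[OF _ _ n] form(2) w0];
          (use H0 \<rho>0 in simp)?)+
    moreover have "real q * (H * \<rho>) < r"
    proof -
      have "H * \<rho> \<le> (H + 1) * \<rho>" using \<rho>0 by (intro mult_right_mono) auto
      also have "\<dots> < (H + 1) * \<epsilon>" using S(4) H0 unfolding \<rho>_def by (intro mult_strict_left_mono) auto
      finally have "real q * (H * \<rho>) < real q * ((H + 1) * \<epsilon>)" using q by (intro mult_strict_left_mono) auto
      also have "\<dots> = (real q * (H + 1)) * \<epsilon>" by (simp only: mult.assoc)
      also have "real q * (H + 1) \<noteq> 0" using q H0 by simp
      then have "(real q * (H + 1)) * \<epsilon> = r" unfolding \<epsilon>_def by simp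
      finally show ?thesis .
    qed
    ultimately show ?thesis by simp
  qed
  then show "\<exists>no. \<forall>n\<ge>no. norm (eig n q - 0) < r" by blast
qed


text \<open>The matrix is 0, so the general bound applies with g = 0, unit vectors as test vectors
  and E = 0.\<close>

lemma eigenvalue_zero:
  fixes h :: "nat \<Rightarrow> complex" and x :: "nat \<Rightarrow> nat"
  assumes h: "\<And>m. m > 0 \<Longrightarrow> h m = 0" and x: "\<And>i. x (Suc i) > 0" and q: "1 \<le> q" "q \<le> n"
    and eig: "ordered_eigenvalues (gcd_matrix h x n) l"
  shows "l q = 0"
proof -
  have H: "h (gcd (x (Suc i)) (x (Suc j))) = 0" for i j using x[of i] by (intro h) simp
  have "0 \<le> l q \<and> l q \<le> real q * 0"
  proof (intro conjI; rule gcd_matrix_eigenvalue_bound[where x = x and h = h and n = n and g = "\<lambda>_. 0"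
        and w = "\<lambda>j i. if i = j then 1 else 0" and ix = "\<lambda>j. j" and E = 0])
  qed (use h x q eig in \<open>simp_all add: H cinner_def mat_app_def\<close>)
  then show ?thesis by simp
qed

theorem theorem1p8:
  fixes a b c q d e :: nat
    and x :: "nat \<Rightarrow> nat"
    and f h :: "nat \<Rightarrow> complex"
    and eig :: "nat \<Rightarrow> nat \<Rightarrow> real"
  assumes "a \<ge> 1" and "b \<ge> 1" and "c \<ge> 1" and "q \<ge> 1"
    and "c > d"
    and x_pos: "\<And>i. i \<ge> 1 \<Longrightarrow> x i > 0"
    and x_incr: "strict_mono_on {1..} x"
    and x_ap: "\<exists>r. strict_mono_on {e..} r \<and> (\<forall>i \<ge> e. r i \<ge> 1 \<and> x (r i) = a + b * i)"
    and f_C: "f \<in> class_C x"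
    and f_mult: "multiplicative f"
    and f_incr: "increasing_on_seq f (prime_ap b)"
    and h_def: "h = dirichlet_conv (dirichlet_power f c) (dirichlet_power moebius d)"
    and eig: "\<And>n. n \<ge> 1 \<Longrightarrow> ordered_eigenvalues (gcd_matrix h x n) (eig n)"
  shows "((\<exists>i \<ge> 1. h (prime_ap b i) = 0) \<longrightarrow> (\<forall>\<^sub>F n in sequentially. eig n q = 0)) \<and>
    ((\<forall>i \<ge> 1. h (prime_ap b i) \<noteq> 0) \<and>
      filterlim (\<lambda>N. \<Sum>i = 1..N. Re (1 / f (prime_ap b i))) at_top sequentially \<longrightarrow>
        (\<lambda>n. eig n q) \<longlonglongrightarrow> 0) \<and>
    ((\<exists>C > 0. \<forall>i \<ge> 1. f (prime_ap b i) \<le> complex_of_real C * of_nat (prime_ap b i)) \<longrightarrow>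
        (\<lambda>n. eig n q) \<longlonglongrightarrow> 0)"
proof -
  have b: "b > 0" and xS: "x (Suc i) > 0" for i using assms(2) x_pos[of "Suc i"] by simp_all
  have "f (1 * 1) = f 1 * f 1" 
    by (rule f_mult[unfolded multiplicative_def, rule_format]) simp_all
  then have "f 1 = 0 \<or> f 1 = 1" by simp
  then show ?thesis
  proof
    \<comment> \<open>Then f vanishes on the positive integers and h everywhere; every matrix is 0,
      and all three claims hold.\<close>
    assume f1: "f 1 = 0"
    have f0: "f m = 0" if "m > 0" for m
      using f_mult[unfolded multiplicative_def, rule_format, of m 1] that f1 by simp
    obtain c' where c': "c = Suc c'" using \<open>c \<ge> 1\<close> by (cases c) auto
    have "dirichlet_conv g (\<lambda>_. 0) = (\<lambda>_. 0)" for g by (rule ext) (simp add: dirichlet_conv_def)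
    then have "dirichlet_conv (dirichlet_power f c') f = (\<lambda>_. 0)"
      using dirichlet_conv_cong[of f "\<lambda>_. 0"] f0 by simp
    then have "h m = 0" for m unfolding h_def c' by (simp add: dirichlet_conv_def)
    then have "eig n q = 0" if "n \<ge> q" for n
      using eigenvalue_zero[OF _ xS \<open>q \<ge> 1\<close> that eig[of n]] that \<open>q \<ge> 1\<close> by simp
    then have ev: "\<forall>\<^sub>F n in sequentially. eig n q = 0" by (rule eventually_sequentiallyI)
    then have "(\<lambda>n. eig n q) \<longlonglongrightarrow> 0" by (rule tendsto_eventually)
    with ev show ?thesis by simp
  next
    assume f1: "f 1 = 1"
    note fpm = multiplicative_imp_prime_multiplicative[OF f_mult f1]
    obtain r where "\<And>i. i \<ge> e \<Longrightarrow> r i \<ge> 1 \<and> x (r i) = a + b * i" using x_ap by blast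
    then have ap: "\<exists>i. x (Suc i) = a + b * t" if "t \<ge> e" for t
      using that by (metis Suc_le_D One_nat_def)
    define D where "D = {m. \<exists>i\<ge>1. m dvd x i}"
    have nonneg: "0 \<le> dirichlet_conv f moebius m" if "m \<in> D" for m using f_C that unfolding class_C_def D_def by blast
    obtain g where g: "\<forall>m\<in>D. 0 \<le> g m" "\<forall>m. m > 0 \<longrightarrow> h m = (\<Sum>t | t dvd m. g t)"
    proof -
      have "\<exists>g. (\<forall>m\<in>D. 0 \<le> g m) \<and> (\<forall>m. m > 0 \<longrightarrow> h m = (\<Sum>t | t dvd m. g t))"
        unfolding h_def
      proof (rule divisor_sum_representation[OF \<open>c > d\<close> _ _ nonneg])
        show "e \<in> D" if "m \<in> D" "e dvd m" for m e using that dvd_trans unfolding D_def by blast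
        show "m > 0" if "m \<in> D" for m using that x_pos dvd_pos_nat unfolding D_def by blast
      qed
      then show thesis using that by blast
    qed
    have hpm: "prime_multiplicative h"
      unfolding h_def using prime_multiplicative_conv(1) prime_multiplicative_power fpm prime_multiplicative_moebius by blast
    define F where "F p = Re (f p)" for p
    define k where "k p = real c * F p - real d" for p
    have fp: "f p = of_real (F p)" "F p \<ge> 1" if p: "p \<in> primes_ap b" for p
    proof -
      have pp: "prime p" "[p = 1] (mod b)" using p primes_ap_iff by blast+
      \<comment> \<open>A multiple of p occurs in the sequence, so the class condition applies at p:
        f p + mu p = f p - 1 is real and nonnegative.\<close>
      have "[p ^ (b * e + 1) = 1 ^ (b * e + 1)] (mod b)" by (rule cong_pow[OF pp(2)])
      then have "[p ^ (b * e + 1) = 1] (mod b)" by simp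
      moreover have "b * e < p ^ (b * e + 1)" using power_gt_expt[of p "b * e + 1"] prime_gt_1_nat[OF pp(1)] by simp
      ultimately obtain i where "x (Suc i) = a * p ^ (b * e + 1)"
        using progression_contains_multiple[where x = x, OF \<open>a \<ge> 1\<close> b ap] by blast
      then have "p dvd x (Suc i)" by simp
      then have "p \<in> D" unfolding D_def by (intro CollectI exI[of _ "Suc i"]) simp
      from nonneg[OF this] have "0 \<le> f p + moebius p"
        using prime_multiplicative_conv(2)[OF fpm prime_multiplicative_moebius pp(1)] by simp
      then show "f p = of_real (F p)" "F p \<ge> 1"
        by (simp_all add: moebius_prime[OF pp(1)] less_eq_complex_def F_def complex_eq_iff)
    qed
    have hp: "h p = of_real (k p) \<and> k p \<ge> 1" if p: "p \<in> primes_ap b" for p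
    proof
      have pp: "prime p" using p by blast
      have "h p = of_nat c * f p + of_nat d * moebius p"
        unfolding h_def
        using prime_multiplicative_conv(2)[OF _ _ pp] prime_multiplicative_power[OF fpm, of c]
          prime_multiplicative_power[OF prime_multiplicative_moebius, of d] pp by simp
      then show "h p = of_real (k p)" using moebius_prime[OF pp] fp(1)[OF p] by (simp add: k_def)
      have "real c * 1 \<le> real c * F p" using fp(2)[OF p] by (intro mult_left_mono) auto
      moreover have "real c \<ge> real d + 1" using \<open>c > d\<close> by simp
      ultimately show "k p \<ge> 1" unfolding k_def by linarith
    qed
    have lim: "(\<lambda>n. eig n q) \<longlonglongrightarrow> 0"
      if L: "filterlim (\<lambda>N. \<Sum>i = 1..N. Re (1 / f (prime_ap b i))) at_top sequentially"
    proof (rule eigenvalue_small[where h = h and g = g and k = k and x = x and e = e, OF \<open>a \<ge> 1\<close> b \<open>q \<ge> 1\<close> xS ap hpm _ _ hp _ eig])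
      show "h m = (\<Sum>t | t dvd m. g t)" if "m > 0" for m using g(2) that by blast
      show "0 \<le> g t" if "t dvd x (Suc i)" for t i
      proof -
        have "t \<in> D" unfolding D_def using that by (intro CollectI exI[of _ "Suc i"]) simp
        then show ?thesis using g(1) by blast
      qed
      show "filterlim (\<lambda>N. \<Sum>i=1..N. 1 / k (prime_ap b i)) at_top sequentially"
      proof (rule filterlim_at_top_mono)
        show "filterlim (\<lambda>N. (1 / real c) * (\<Sum>i = 1..N. Re (1 / f (prime_ap b i)))) at_top sequentially"
          by (rule filterlim_tendsto_pos_mult_at_top[OF tendsto_const _ L]) (use \<open>c \<ge> 1\<close> in simp)
        \<comment> \<open>Since k p = c F p - d is positive and at most c F p, divergence for 1 / f,
          scaled by 1 / c, passes to 1 / k.\<close>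
        have "1 / real c * Re (1 / f p) \<le> 1 / k p" if p: "p \<in> primes_ap b" for p
        proof -
          have "0 < k p" "k p \<le> real c * F p" using hp[OF p] by (auto simp: k_def)
          then have "1 / (real c * F p) \<le> 1 / k p" by (intro divide_left_mono) (auto intro: mult_pos_pos)
          moreover have "Re (1 / f p) = 1 / F p" unfolding fp(1)[OF p] by (metis Re_complex_of_real of_real_1 of_real_divide)
          ultimately show ?thesis by simp
        qed
        then show "\<forall>\<^sub>F N in sequentially. 1 / real c * (\<Sum>i = 1..N. Re (1 / f (prime_ap b i))) \<le> (\<Sum>i = 1..N. 1 / k (prime_ap b i))"
          using prime_ap_mem[OF b] unfolding sum_distrib_left by (intro always_eventually allI sum_mono) blast
      qed
    qed
    \<comment> \<open>This contradicts the premise of the first claim, which is therefore settled in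
      this case.\<close>
    have "h (prime_ap b i) \<noteq> 0" for i using hp[OF prime_ap_mem[OF b, of i]] by auto
    moreover have "(\<lambda>n. eig n q) \<longlonglongrightarrow> 0"
      if C: "C > 0" "\<forall>i\<ge>1. f (prime_ap b i) \<le> complex_of_real C * of_nat (prime_ap b i)" for C
    proof (rule lim, rule filterlim_at_top_mono)
      show "filterlim (\<lambda>N. (1 / C) * (\<Sum>i = 1..N. 1 / real (prime_ap b i))) at_top sequentially"
        by (rule filterlim_tendsto_pos_mult_at_top[OF tendsto_const _ sum_inverse_prime_ap_unbounded[OF b]]) (use C(1) in simp)
      \<comment> \<open>The growth bound turns divergence of the sum of 1 / p into divergence of the
        sum of 1 / f p, which reduces the third claim to the limit already shown.\<close>
      have "1 / C * (1 / real (prime_ap b i)) \<le> Re (1 / f (prime_ap b i))" if i: "i \<ge> 1" for i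
      proof -
        let ?p = "prime_ap b i"
        note f = fp[OF prime_ap_mem[OF b, of i]]
        have "F ?p \<le> C * real ?p" using C(2) i unfolding F_def less_eq_complex_def by fastforce
        moreover have "?p > 0" using prime_ap_mem[OF b, of i] prime_gt_0_nat by blast
        ultimately have "1 / (C * real ?p) \<le> 1 / F ?p"
          using f(2) C(1) by (intro divide_left_mono mult_pos_pos) simp_all
        moreover have "Re (1 / f ?p) = 1 / F ?p" unfolding f(1) by (metis Re_complex_of_real of_real_1 of_real_divide)
        ultimately show ?thesis by simp
      qed
      then show "\<forall>\<^sub>F N in sequentially. 1 / C * (\<Sum>i = 1..N. 1 / real (prime_ap b i)) \<le> (\<Sum>i = 1..N. Re (1 / f (prime_ap b i)))"
        unfolding sum_distrib_left by (intro always_eventually allI sum_mono) simp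
    qed
    ultimately show ?thesis using lim by blast
  qed
qed

end
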